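(* Let $X$ be an infinite dimensional complex Banach space, let $T\in L(X)$ and let $1\le i\le 12$. The following conditions are equivalent: (i) there exists $(M,N)\in Red(T)$ such that $T_M\in\mathbf{R}_i$ and $T_N$ is nilpotent, that is, $T\in\mathbf{DR}_i$; (ii) $T$ is of Kato type and $0$ is not an accumulation point of $\sigma_{\mathbf{R}_i}(T)$; (iii) $T$ is of Kato type and $0$ is not an interior point of $\sigma_{\mathbf{R}_i}(T)$; (iv) there exists a projection $P\in L(X)$ that commutes with $T$ such that $T+P\in\mathbf{R}_i$ and $TP$ is nilpotent.
   Context: $L(Y)$ is the algebra of bounded linear operators on a Banach space $Y$; $T-\lambda$ means $T-\lambda I$. For a Banach space $Y$ (finite dimensional or zero spaces allowed) and $S\in L(Y)$, $N(S)$ and $R(S)$ are the kernel and range, $\alpha(S)=\dim N(S)$, $\beta(S)=\operatorname{codim}R(S)$, $\operatorname{asc}(S)=\inf\{n\ge0:N(S^n)=N(S^{n+1})\}$, $\operatorname{dsc}(S)=\inf\{n\ge0:R(S^n)=R(S^{n+1})\}$ ($\inf\emptyset=\infty$). Classes of operators on $Y$: $\Phi_+(Y)$: $R(S)$ closed and $\alpha(S)<\infty$; $\Phi_-(Y)$: $\beta(S)<\infty$; $\Phi(Y)$: $\alpha(S),\beta(S)<\infty$; for semi-Fredholm $S$, $\operatorname{ind}(S)=\alpha(S)-\beta(S)$; $\mathcal{W}_+(Y)=\{S\in\Phi_+(Y):\operatorname{ind}(S)\le0\}$; $\mathcal{W}_-(Y)=\{S\in\Phi_-(Y):\operatorname{ind}(S)\ge0\}$;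 $\mathcal{W}(Y)=\{S\in\Phi(Y):\operatorname{ind}(S)=0\}$; $\mathcal{B}_+(Y)=\{S\in\Phi_+(Y):\operatorname{asc}(S)<\infty\}$; $\mathcal{B}_-(Y)=\{S\in\Phi_-(Y):\operatorname{dsc}(S)<\infty\}$; $\mathcal{B}(Y)=\mathcal{B}_+(Y)\cap\mathcal{B}_-(Y)$; $\mathcal{M}(Y)$: bounded below operators ($c\|x\|\le\|Sx\|$ for some $c>0$ and all $x$); $\mathcal{Q}(Y)$: surjective operators; $L(Y)^{-1}$: invertible operators. $\mathbf{R}_1=\Phi_+$, $\mathbf{R}_2=\Phi_-$, $\mathbf{R}_3=\Phi$, $\mathbf{R}_4=\mathcal{W}_+$, $\mathbf{R}_5=\mathcal{W}_-$, $\mathbf{R}_6=\mathcal{W}$, $\mathbf{R}_7=\mathcal{B}_+$, $\mathbf{R}_8=\mathcal{B}_-$, $\mathbf{R}_9=\mathcal{B}$, $\mathbf{R}_{10}=\mathcal{M}$, $\mathbf{R}_{11}=\mathcal{Q}$, $\mathbf{R}_{12}=L(\cdot)^{-1}$, where membership of an operator in $\mathbf{R}_i$ refers to the class on the space on which it acts. $\sigma_{\mathbf{R}_i}(T)=\{\lambda\in\mathbb{C}:T-\lambda\notin\mathbf{R}_i\}$. $(M,N)\in Red(T)$ means that $M,N$ are closed $T$-invariant subspaces of $X$ with $X=M\oplus N$; $T_M\in L(M)$, $T_N\in L(N)$ are the restrictions of $T$. $\mathbf{DR}_i$ is the class of $T\in L(X)$ for which there is $(M,N)\in Red(T)$ with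 $T_M\in\mathbf{R}_i$ and $T_N$ nilpotent. $S\in L(Y)$ is Kato if $R(S)$ is closed and $N(S)\subset R(S^n)$ for all $n\ge 0$. $T$ is of Kato type if there is $(M,N)\in Red(T)$ such that $T_M$ is Kato and $T_N$ is nilpotent. *)

theory Defs
  imports "HOL-Analysis.Analysis"
begin

section \<open>Complex Banach spaces\<close>

class complex_banach = banach +
  fixes scaleC :: "complex \<Rightarrow> 'a \<Rightarrow> 'a"  (infixr "*\<^sub>C" 75)
  assumes scaleC_add_right: "a *\<^sub>C (x + y) = a *\<^sub>C x + a *\<^sub>C y"
    and scaleC_add_left: "(a + b) *\<^sub>C x = a *\<^sub>C x + b *\<^sub>C x"
    and scaleC_scaleC: "a *\<^sub>C (b *\<^sub>C x) = (a * b) *\<^sub>C x"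
    and scaleC_of_real: "complex_of_real r *\<^sub>C x = r *\<^sub>R x"
    and norm_scaleC: "norm (a *\<^sub>C x) = cmod a * norm x"

lemma scaleC_one: "1 *\<^sub>C x = (x :: 'a::complex_banach)"
  using scaleC_of_real[of 1 x] by simp

global_interpretation complex_vector: vector_space "scaleC :: complex \<Rightarrow> 'a \<Rightarrow> 'a::complex_banach"
  defines csubspace = complex_vector.subspace
    and cspan = complex_vector.span
    and cdependent = complex_vector.dependent
    and crepresentation = complex_vector.representation
    and cextend_basis = complex_vector.extend_basis
    and cdim_nat = complex_vector.dim
  by unfold_locales (simp_all add: scaleC_add_right scaleC_add_left scaleC_scaleC scaleC_one)

text \<open>
  The library dimension takes the value 0 on infinite-dimensional spaces; here the dimension is
  \<open>\<infinity>\<close> in that case.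
\<close>

definition cdim :: "'a::complex_banach set \<Rightarrow> enat" where
  "cdim V = (if \<exists>B. finite B \<and> V \<subseteq> cspan B then enat (cdim_nat V) else \<infinity>)"

definition direct_sum :: "'a::complex_banach set \<Rightarrow> 'a set \<Rightarrow> 'a set \<Rightarrow> bool" where
  "direct_sum Y M N \<longleftrightarrow> csubspace M \<and> csubspace N \<and> M \<inter> N = {0} \<and> Y = {m + n | m n. m \<in> M \<and> n \<in> N}"

text \<open>
  The codimension of a subspace \<open>R\<close> of \<open>Y\<close> is the dimension of an algebraic complement of
  \<open>R\<close> in \<open>Y\<close>. Complements exist and all have the same dimension, see \<open>complement_exists\<close> and
  \<open>codim_eq_cdim_complement\<close>, so the infimum is over a nonempty set of equal values.
\<close>

definition codim :: "'a::complex_banach set \<Rightarrow> 'a set \<Rightarrow> enat" where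
  "codim Y R = (INF W\<in>{W. direct_sum Y R W}. cdim W)"

lemma complement_exists:
  assumes "csubspace Y" "csubspace R" "R \<subseteq> Y"
  shows "\<exists>W. direct_sum Y R W"
proof -
  obtain A where A: "A \<subseteq> R" "\<not> cdependent A" "R \<subseteq> cspan A"
    using complex_vector.maximal_independent_subset[of R] by blast
  obtain B where B: "A \<subseteq> B" "B \<subseteq> Y" "\<not> cdependent B" "Y \<subseteq> cspan B"
    using complex_vector.maximal_independent_subset_extend[of A Y] A assms(3) by blast
  have R: "R = cspan A"
    using A assms(2) by (simp add: complex_vector.span_minimal subset_antisym)
  have Y: "Y = cspan B"
    using B assms(1) by (simp add: complex_vector.span_minimal subset_antisym)
  have "x = 0" if x: "x \<in> cspan A" "x \<in> cspan (B - A)" for x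
  proof -
    have xB: "x \<in> cspan B"
      using x(1) B(1) complex_vector.span_mono by blast
    have 1: "crepresentation B x = crepresentation A x"
      using complex_vector.representation_extend[OF B(3) x(1) B(1)] .
    have 2: "crepresentation B x = crepresentation (B - A) x"
      using complex_vector.representation_extend[OF B(3) x(2)] by blast
    have "crepresentation B x b = 0" for b
      using 1 2 complex_vector.representation_ne_zero[of A x b]
        complex_vector.representation_ne_zero[of "B - A" x b] by fastforce
    then show ?thesis
      using complex_vector.sum_nonzero_representation_eq[OF B(3) xB] by simp
  qed
  moreover have "cspan B = {m + n | m n. m \<in> cspan A \<and> n \<in> cspan (B - A)}"
    using complex_vector.span_Un[of A "B - A"] B(1) by (auto simp: Un_absorb1)
  ultimately have "direct_sum Y R (cspan (B - A))"
    unfolding direct_sum_def R Y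
    by (auto simp: complex_vector.subspace_span complex_vector.span_zero)
  then show ?thesis ..
qed

lemma direct_sum_superset:
  assumes "direct_sum Y M N"
  shows "N \<subseteq> Y"
proof
  fix x assume "x \<in> N"
  moreover have "0 \<in> M"
    using assms complex_vector.subspace_0 by (auto simp: direct_sum_def)
  ultimately have "\<exists>m n. x = m + n \<and> m \<in> M \<and> n \<in> N"
    by (intro exI[of _ 0] exI[of _ x]) simp
  then show "x \<in> Y"
    using assms by (simp add: direct_sum_def)
qed

lemma cdim_complement_le:
  assumes V: "direct_sum Y R V" and W: "direct_sum Y R W"
  shows "cdim W \<le> cdim V"
proof (cases "\<exists>B. finite B \<and> V \<subseteq> cspan B")
  case False
  then have "cdim V = \<infinity>"
    by (simp add: cdim_def)
  then show ?thesis by simp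
next
  case True
  have sub: "csubspace R" "csubspace V" "csubspace W"
    using V W by (simp_all add: direct_sum_def)
  have RW: "R \<inter> W = {0}"
    using W by (simp add: direct_sum_def)
  obtain A where A: "A \<subseteq> V" "\<not> cdependent A" "V \<subseteq> cspan A" "card A = cdim_nat V"
    using complex_vector.basis_exists[of V] by blast
  have fin: "finite A"
    using True A complex_vector.independent_span_bound by (meson subset_trans)
  have "\<exists>w. w \<in> W \<and> v - w \<in> R" if "v \<in> A" for v
  proof -
    have "v \<in> Y"
      using direct_sum_superset[OF V] A(1) that by blast
    then obtain r w where "v = r + w" "r \<in> R" "w \<in> W"
      using W unfolding direct_sum_def by blast
    then show ?thesis by (intro exI[of _ w]) simp
  qed
  then obtain f where f: "\<And>v. v \<in> A \<Longrightarrow> f v \<in> W \<and> v - f v \<in> R"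
    by metis
  have "W \<subseteq> cspan (f ` A)"
  proof
    fix w assume w: "w \<in> W"
    have "w \<in> Y"
      using direct_sum_superset[OF W] w by blast
    then obtain r v where rv: "w = r + v" "r \<in> R" "v \<in> V"
      using V unfolding direct_sum_def by blast
    then obtain c where c: "v = (\<Sum>a\<in>A. c a *\<^sub>C a)"
      using A(3) complex_vector.span_finite[OF fin] by auto
    define u where "u = (\<Sum>a\<in>A. c a *\<^sub>C f a)"
    have "v - u = (\<Sum>a\<in>A. c a *\<^sub>C (a - f a))"
      by (simp add: c u_def sum_subtractf complex_vector.scale_right_diff_distrib)
    also have "\<dots> \<in> R"
      using f by (intro complex_vector.subspace_sum[OF sub(1)] complex_vector.subspace_scale[OF sub(1)]) auto
    finally have "r + (v - u) \<in> R"
      using rv(2) complex_vector.subspace_add[OF sub(1)] by blast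
    then have "w - u \<in> R"
      by (simp add: rv(1) algebra_simps)
    moreover have "u \<in> W"
      unfolding u_def
      using f by (intro complex_vector.subspace_sum[OF sub(3)] complex_vector.subspace_scale[OF sub(3)]) auto
    then have "w - u \<in> W"
      using w complex_vector.subspace_diff[OF sub(3)] by blast
    ultimately have "w = u"
      using RW by (metis IntI right_minus_eq singletonD)
    then show "w \<in> cspan (f ` A)"
      by (simp only: u_def)
        (intro complex_vector.span_sum complex_vector.span_scale complex_vector.span_base imageI)
  qed
  moreover from this have "cdim_nat W \<le> card A"
    using complex_vector.dim_le_card[of W "f ` A"] fin card_image_le[OF fin, of f] by auto
  ultimately show ?thesis
    using True fin A(4) by (auto simp: cdim_def)
qed

lemma codim_eq_cdim_complement:
  assumes "direct_sum Y R W"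
  shows "codim Y R = cdim W"
  unfolding codim_def
  by (rule antisym) (use assms in \<open>auto intro!: INF_lower INF_greatest cdim_complement_le\<close>)

section \<open>Operators on a closed subspace\<close>

text \<open>
  Throughout, \<open>Y\<close> is a closed subspace of the ambient type (so a Banach space), and an operator on
  \<open>Y\<close> is given by a function on the ambient type of which only the values on \<open>Y\<close> matter. In
  particular the restriction of \<open>T\<close> to a closed invariant subspace \<open>M\<close> is \<open>T\<close> itself, viewed as
  an operator on \<open>M\<close>. The whole space is \<open>Y = UNIV\<close>.
\<close>

definition L :: "'a::complex_banach set \<Rightarrow> ('a \<Rightarrow> 'a) set" where
  "L Y = {S. (\<forall>x\<in>Y. S x \<in> Y)
     \<and> (\<forall>x\<in>Y. \<forall>y\<in>Y. S (x + y) = S x + S y)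
     \<and> (\<forall>c. \<forall>x\<in>Y. S (c *\<^sub>C x) = c *\<^sub>C S x)
     \<and> (\<exists>K. \<forall>x\<in>Y. norm (S x) \<le> K * norm x)}"

lemma L_UNIV_iff:
  "S \<in> L UNIV \<longleftrightarrow> bounded_linear S \<and> (\<forall>c x. S (c *\<^sub>C x) = c *\<^sub>C S x)"
proof
  assume S: "S \<in> L UNIV"
  then obtain K where K: "\<And>x. norm (S x) \<le> K * norm x"
    by (auto simp: L_def)
  have "bounded_linear S"
  proof (rule bounded_linear_intro[where K = K])
    show "S (r *\<^sub>R x) = r *\<^sub>R S x" for r x
      using S by (simp add: L_def flip: scaleC_of_real)
  qed (use S K in \<open>auto simp: L_def mult.commute\<close>)
  then show "bounded_linear S \<and> (\<forall>c x. S (c *\<^sub>C x) = c *\<^sub>C S x)"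
    using S by (auto simp: L_def)
next
  assume S: "bounded_linear S \<and> (\<forall>c x. S (c *\<^sub>C x) = c *\<^sub>C S x)"
  then obtain K where "\<And>x. norm (S x) \<le> norm x * K"
    using bounded_linear.bounded by blast
  then show "S \<in> L UNIV"
    using S by (auto simp: L_def linear_add bounded_linear.linear mult.commute intro!: exI[of _ K])
qed

definition ker :: "'a::complex_banach set \<Rightarrow> ('a \<Rightarrow> 'a) \<Rightarrow> 'a set" where
  "ker Y S = {x \<in> Y. S x = 0}"

definition ran :: "'a::complex_banach set \<Rightarrow> ('a \<Rightarrow> 'a) \<Rightarrow> 'a set" where
  "ran Y S = S ` Y"

definition nullity :: "'a::complex_banach set \<Rightarrow> ('a \<Rightarrow> 'a) \<Rightarrow> enat" where
  "nullity Y S = cdim (ker Y S)"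

definition defect :: "'a::complex_banach set \<Rightarrow> ('a \<Rightarrow> 'a) \<Rightarrow> enat" where
  "defect Y S = codim Y (ran Y S)"

definition ascent :: "'a::complex_banach set \<Rightarrow> ('a \<Rightarrow> 'a) \<Rightarrow> enat" where
  "ascent Y S = Inf {enat n | n. ker Y (S ^^ n) = ker Y (S ^^ (n + 1))}"

definition descent :: "'a::complex_banach set \<Rightarrow> ('a \<Rightarrow> 'a) \<Rightarrow> enat" where
  "descent Y S = Inf {enat n | n. ran Y (S ^^ n) = ran Y (S ^^ (n + 1))}"

text \<open>Only meaningful if at least one of the two terms is finite.\<close>

definition ind :: "'a::complex_banach set \<Rightarrow> ('a \<Rightarrow> 'a) \<Rightarrow> ereal" where
  "ind Y S = ereal_of_enat (nullity Y S) - ereal_of_enat (defect Y S)"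

definition Phi_plus :: "'a::complex_banach set \<Rightarrow> ('a \<Rightarrow> 'a) set" where
  "Phi_plus Y = {S \<in> L Y. closed (ran Y S) \<and> nullity Y S < \<infinity>}"

definition Phi_minus :: "'a::complex_banach set \<Rightarrow> ('a \<Rightarrow> 'a) set" where
  "Phi_minus Y = {S \<in> L Y. defect Y S < \<infinity>}"

definition Phi :: "'a::complex_banach set \<Rightarrow> ('a \<Rightarrow> 'a) set" where
  "Phi Y = {S \<in> L Y. nullity Y S < \<infinity> \<and> defect Y S < \<infinity>}"

definition W_plus :: "'a::complex_banach set \<Rightarrow> ('a \<Rightarrow> 'a) set" where
  "W_plus Y = {S \<in> Phi_plus Y. ind Y S \<le> 0}"

definition W_minus :: "'a::complex_banach set \<Rightarrow> ('a \<Rightarrow> 'a) set" where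
  "W_minus Y = {S \<in> Phi_minus Y. ind Y S \<ge> 0}"

definition Weyl :: "'a::complex_banach set \<Rightarrow> ('a \<Rightarrow> 'a) set" where
  "Weyl Y = {S \<in> Phi Y. ind Y S = 0}"

definition B_plus :: "'a::complex_banach set \<Rightarrow> ('a \<Rightarrow> 'a) set" where
  "B_plus Y = {S \<in> Phi_plus Y. ascent Y S < \<infinity>}"

definition B_minus :: "'a::complex_banach set \<Rightarrow> ('a \<Rightarrow> 'a) set" where
  "B_minus Y = {S \<in> Phi_minus Y. descent Y S < \<infinity>}"

definition Browder :: "'a::complex_banach set \<Rightarrow> ('a \<Rightarrow> 'a) set" where
  "Browder Y = B_plus Y \<inter> B_minus Y"

definition bounded_below :: "'a::complex_banach set \<Rightarrow> ('a \<Rightarrow> 'a) set" where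
  "bounded_below Y = {S \<in> L Y. \<exists>c>0. \<forall>x\<in>Y. c * norm x \<le> norm (S x)}"

definition surjective_ops :: "'a::complex_banach set \<Rightarrow> ('a \<Rightarrow> 'a) set" where
  "surjective_ops Y = {S \<in> L Y. ran Y S = Y}"

definition invertible_ops :: "'a::complex_banach set \<Rightarrow> ('a \<Rightarrow> 'a) set" where
  "invertible_ops Y = {S \<in> L Y. \<exists>S'\<in>L Y. \<forall>x\<in>Y. S (S' x) = x \<and> S' (S x) = x}"

text \<open>Used for \<open>1 \<le> i \<le> 12\<close> only; the list is indexed from 0.\<close>

definition Rclass :: "nat \<Rightarrow> 'a::complex_banach set \<Rightarrow> ('a \<Rightarrow> 'a) set" where
  "Rclass i Y =
     [Phi_plus Y, Phi_minus Y, Phi Y, W_plus Y, W_minus Y, Weyl Y,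
      B_plus Y, B_minus Y, Browder Y, bounded_below Y, surjective_ops Y, invertible_ops Y] ! (i - 1)"

definition Rspectrum :: "nat \<Rightarrow> ('a::complex_banach \<Rightarrow> 'a) \<Rightarrow> complex set" where
  "Rspectrum i T = {z. (\<lambda>x. T x - z *\<^sub>C x) \<notin> Rclass i UNIV}"

definition nilpotent_on :: "'a::complex_banach set \<Rightarrow> ('a \<Rightarrow> 'a) \<Rightarrow> bool" where
  "nilpotent_on Y S \<longleftrightarrow> (\<exists>n. \<forall>x\<in>Y. (S ^^ n) x = 0)"

definition Red :: "('a::complex_banach \<Rightarrow> 'a) \<Rightarrow> ('a set \<times> 'a set) set" where
  "Red T = {(M, N). closed M \<and> closed N \<and> T ` M \<subseteq> M \<and> T ` N \<subseteq> N \<and> direct_sum UNIV M N}"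

definition DR :: "nat \<Rightarrow> ('a::complex_banach \<Rightarrow> 'a) set" where
  "DR i = {T \<in> L UNIV. \<exists>(M, N)\<in>Red T. T \<in> Rclass i M \<and> nilpotent_on N T}"

definition Kato :: "'a::complex_banach set \<Rightarrow> ('a \<Rightarrow> 'a) set" where
  "Kato Y = {S \<in> L Y. closed (ran Y S) \<and> (\<forall>n. ker Y S \<subseteq> ran Y (S ^^ n))}"

definition Kato_type :: "('a::complex_banach \<Rightarrow> 'a) \<Rightarrow> bool" where
  "Kato_type T \<longleftrightarrow> (\<exists>(M, N)\<in>Red T. T \<in> Kato M \<and> nilpotent_on N T)"

end

(*
  Condition (i) can be sharpened. If T restricted to M is semi-Fredholm but not Kato, there are x in the
  kernel and n with x = T^(n-1) y outside the closed subspace T^n(M). A functional f with f = 0 on T^n(M)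
  and f(x) = 1 gives M = M0 + N0 with M0 the common kernel of all f T^j and N0 the span of all T^j y; T is
  nilpotent on N0, and nullity and defect both drop by one, so membership in R_i survives and the process
  stops. Hence T may be taken to be Kato on M.

  If T is Kato on M, so is T - z for small z, with the same nullity and the same defect: each of them is
  upper and lower semicontinuous near every point of a disc, hence constant on it. For Kato operators finite
  ascent means injective and finite descent means surjective, so membership in R_i depends on the nullity
  and the defect only. Since T - z is invertible on N for nonzero z, all conditions with the spectrum follow.
  Condition (iv) is (i) for the projection onto N along M, because T + 1 is invertible on N.
*)
theory Submission
  imports Defs
begin

text \<open>The obstacle is that nullity and defect may be infinite. Semicontinuity at one point
  says, for each n, that a bound by n persists on a neighbourhood that depends on n, and this is
  worthless for an infinite value. On a disc where every T - z is Kato, semicontinuity holds at each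
  point, and connectedness then forces a single value, finite or not.

  Lower semicontinuity is what breaks down for general semi-Fredholm operators: a nilpotent block
  loses its kernel under every nonzero shift. A Kato operator maps the intersection of all T^n(Y)
  onto itself, has its kernel there, and is bounded below modulo it. The first and the last property
  survive small shifts, and together they lift each vector of (T - z)(Y) with a constant independent
  of z.

  Quotients are replaced by distances to a subspace, adjoints by functionals biorthogonal to
  finitely many vectors.\<close>

section \<open>Lifting and the open mapping theorem\<close>

text \<open>Correct the residual again and again: it shrinks by the factor q each time, so the
  corrections form an absolutely convergent series in \<open>Y\<close>. The set \<open>V\<close>
  only has to be stable under passing to residuals; later it is an image, the closure of an image,
  or an invariant subspace.\<close>

lemma approx_lift:
  fixes f :: "'b::banach \<Rightarrow> 'c::real_normed_vector"
  assumes f: "bounded_linear f" and Y: "subspace Y" "closed Y"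
    and q: "0 \<le> q" "q < 1"
    and step: "\<And>v. v \<in> V \<Longrightarrow> \<exists>x\<in>Y. norm x \<le> C * norm v \<and> v - f x \<in> V \<and> norm (v - f x) \<le> q * norm v"
    and v: "v \<in> V"
  shows "\<exists>x\<in>Y. f x = v \<and> norm x \<le> C / (1 - q) * norm v"
proof -
  interpret f: bounded_linear f by (fact f)
  obtain g where g: "\<And>v. v \<in> V \<Longrightarrow> g v \<in> Y \<and> norm (g v) \<le> C * norm v \<and> v - f (g v) \<in> V
      \<and> norm (v - f (g v)) \<le> q * norm v"
    using step by metis
  define r where "r k = ((\<lambda>v. v - f (g v)) ^^ k) v" for k
  have r0: "r 0 = v" and rS: "\<And>k. r (Suc k) = r k - f (g (r k))"
    by (simp_all add: r_def)
  have rV: "r k \<in> V" for k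
    by (induction k) (use r0 rS v g in auto)
  have rn: "norm (r k) \<le> q ^ k * norm v" for k
  proof (induction k)
    case (Suc k)
    have "norm (r (Suc k)) \<le> q * norm (r k)"
      using g[OF rV[of k]] by (simp add: rS)
    also have "\<dots> \<le> q * (q ^ k * norm v)"
      using Suc q by (intro mult_left_mono) auto
    finally show ?case by (simp add: mult.assoc)
  qed (simp add: r0)
  show ?thesis
  \<comment> \<open>For v = 0 the sign of \<open>C\<close> is left open, so the comparison series is
    used for nonzero v only.\<close>
  proof (cases "v = 0")
    case True
    then show ?thesis
      using Y(1) by (auto intro!: bexI[of _ 0] simp: f.zero subspace_0)
  next
    case False
    have C: "0 \<le> C"
    proof -
      have "0 \<le> C * norm v"
        using g[OF v] norm_ge_zero order_trans by blast
      with False show ?thesis by (simp add: zero_le_mult_iff)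
    qed
    have gn: "norm (g (r k)) \<le> C * norm v * q ^ k" for k
    proof -
      have "norm (g (r k)) \<le> C * norm (r k)"
        using g[OF rV[of k]] by simp
      also have "\<dots> \<le> C * (q ^ k * norm v)"
        using rn[of k] C by (intro mult_left_mono)
      finally show ?thesis by (simp add: ac_simps)
    qed
    have geo: "(\<lambda>k. C * norm v * q ^ k) sums (C * norm v * (1 / (1 - q)))"
      using q by (intro sums_mult geometric_sums) auto
    have summ: "summable (\<lambda>k. norm (g (r k)))"
      by (rule summable_comparison_test_ev[OF _ sums_summable[OF geo]]) (simp add: gn)
    then have summ': "summable (\<lambda>k. g (r k))"
      by (rule summable_norm_cancel)
    define x where "x = (\<Sum>k. g (r k))"
    have "norm x \<le> (\<Sum>k. norm (g (r k)))"
      unfolding x_def by (rule summable_norm[OF summ])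
    also have "\<dots> \<le> C * norm v * (1 / (1 - q))"
      by (rule sums_le[OF gn summable_sums[OF summ] geo])
    finally have nx: "norm x \<le> C / (1 - q) * norm v" by simp
    have lim: "(\<lambda>n. \<Sum>k<n. g (r k)) \<longlonglongrightarrow> x"
      unfolding x_def using summ' summable_LIMSEQ by blast
    have "(\<Sum>k<n. g (r k)) \<in> Y" for n
      using g rV Y(1) by (intro subspace_sum) auto
    then have xY: "x \<in> Y"
      using closed_sequentially[OF Y(2) _ lim] by blast
    have "f (\<Sum>k<n. g (r k)) = v - r n" for n
      by (induction n) (simp_all add: r0 rS f.add f.zero)
    moreover have "r \<longlonglongrightarrow> 0"
    proof (rule Lim_null_comparison)
      show "\<forall>\<^sub>F n in sequentially. norm (r n) \<le> q ^ n * norm v"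
        using rn by simp
      show "(\<lambda>n. q ^ n * norm v) \<longlonglongrightarrow> 0"
        using q by (intro tendsto_mult_left_zero LIMSEQ_power_zero) auto
    qed
    ultimately have "(\<lambda>n. f (\<Sum>k<n. g (r k))) \<longlonglongrightarrow> v - 0"
      by (simp only:) (intro tendsto_intros)
    moreover have "(\<lambda>n. f (\<Sum>k<n. g (r k))) \<longlonglongrightarrow> f x"
      using f.tendsto[OF lim] .
    ultimately have "f x = v"
      using LIMSEQ_unique by fastforce
    with nx xY show ?thesis by blast
  qed
qed

text \<open>By Baire some \<open>F n\<close> has an interior point u relative to the complete space
  \<open>R\<close>. Subtracting approximants of u from approximants of u + v approximates every
  small v in \<open>R\<close>, and \<open>approx_lift\<close> turns approximation into
  equality.\<close>

lemma open_mapping_lift: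
  fixes f :: "'b::banach \<Rightarrow> 'c::banach"
  assumes f: "bounded_linear f" and Y: "subspace Y" "closed Y" and R: "closed (f ` Y)"
  obtains C where "C > 0" "\<And>v. v \<in> f ` Y \<Longrightarrow> \<exists>x\<in>Y. f x = v \<and> norm x \<le> C * norm v"
proof -
  interpret f: bounded_linear f by (fact f)
  define R where "R = f ` Y"
  have subR: "subspace R"
    unfolding R_def using f.linear_axioms Y(1) by (rule linear_subspace_image)
  define F where "F n = closure (f ` (Y \<inter> cball 0 (real n)))" for n
  have FR: "F n \<subseteq> R" for n
    unfolding F_def R_def using R by (intro closure_minimal) auto
  have UF: "\<Union>(range F) = R"
  proof
    show "R \<subseteq> \<Union>(range F)"
    proof
      fix v assume "v \<in> R"
      then obtain x where x: "x \<in> Y" "v = f x" by (auto simp: R_def)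
      obtain n where "norm x \<le> real n" using real_arch_simple by blast
      then have "x \<in> Y \<inter> cball 0 (real n)" using x by simp
      then have "v \<in> f ` (Y \<inter> cball 0 (real n))" unfolding x(2) by (rule imageI)
      then show "v \<in> \<Union>(range F)"
        unfolding F_def using closure_subset[of "f ` (Y \<inter> cball 0 (real n))"] by auto
    qed
  qed (use FR in auto)
  have "\<exists>n. top_of_set R interior_of F n \<noteq> {}"
  proof (rule ccontr)
    assume none: "\<not> ?thesis"
    have "top_of_set R interior_of \<Union>(range F) = {}"
    proof (rule Baire_category_alt)
      have "closedin euclidean R" using R by (simp add: R_def)
      then show "completely_metrizable_space (top_of_set R) \<or> locally_compact_space (top_of_set R) \<and> regular_space (top_of_set R)"
        using completely_metrizable_space_closedin completely_metrizable_space_euclidean by blast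
      show "closedin (top_of_set R) T \<and> top_of_set R interior_of T = {}" if "T \<in> range F" for T
      proof -
        obtain n where n: "T = F n" using \<open>T \<in> range F\<close> by blast
        have "closed (F n)" by (simp add: F_def)
        then show ?thesis
          using none FR[of n] unfolding n by (auto intro: closed_subset)
      qed
    qed simp
    then have "R = {}"
      unfolding UF using interior_of_topspace[of "top_of_set R"] by simp
    then show False
      using subspace_0[OF subR] by simp
  qed
  then obtain n u where u: "u \<in> top_of_set R interior_of F n" by blast
  then obtain U where U: "open U" "u \<in> U" "R \<inter> U \<subseteq> F n" "u \<in> R"
    by (auto simp: interior_of_def openin_open)
  then obtain r where r: "r > 0" "ball u r \<subseteq> U"
    using open_contains_ball by blast
  have approx: "\<exists>x\<in>Y. norm x \<le> 2 * real n \<and> norm (f x - v) < e"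
    if v: "v \<in> R" "norm v < r" and e: "e > 0" for v e
  proof -
    have "u + v \<in> R \<inter> U"
      using U(4) v r(2) subR by (auto simp: subspace_add dist_norm)
    then have "u + v \<in> F n" "u \<in> F n" using U by auto
    moreover have "\<exists>a\<in>Y \<inter> cball 0 (real n). dist (f a) w < e / 2" if "w \<in> F n" for w
      using that half_gt_zero[OF e] unfolding F_def closure_approachable by blast
    ultimately obtain a b where a: "a \<in> Y \<inter> cball 0 (real n)" "dist (f a) (u + v) < e / 2"
      and b: "b \<in> Y \<inter> cball 0 (real n)" "dist (f b) u < e / 2"
      by blast
    show ?thesis
    proof (intro bexI[of _ "a - b"] conjI)
      show "norm (a - b) \<le> 2 * real n"
        using norm_triangle_ineq4[of a b] a b by simp
      have "f (a - b) - v = (f a - (u + v)) - (f b - u)"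
        by (simp add: f.diff)
      also have "norm \<dots> \<le> norm (f a - (u + v)) + norm (f b - u)"
        by (rule norm_triangle_ineq4)
      also have "\<dots> < e"
        using a(2) b(2) by (simp add: dist_norm)
      finally show "norm (f (a - b) - v) < e" .
    qed (use a b Y in \<open>auto simp: subspace_diff\<close>)
  qed
  have step: "\<exists>x\<in>Y. norm x \<le> 4 * real n / r * norm v \<and> v - f x \<in> R \<and> norm (v - f x) \<le> 1 / 2 * norm v"
    if v: "v \<in> R" for v
  proof (cases "v = 0")
    case True
    then show ?thesis
      using Y subspace_0[OF subR] by (intro bexI[of _ 0]) (auto simp: f.zero subspace_0)
  next
    case False
    \<comment> \<open>Scales v to norm r / 2, inside the ball where \<open>approx\<close> works.
      Scaling back turns the error r / 4 into half of norm v, and the bound 2 n into 4 n / r times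
      norm v.\<close>
    define s where "s = r / (2 * norm v)"
    have s: "s > 0" using r False by (simp add: s_def)
    have "norm (s *\<^sub>R v) < r" using r False by (simp add: s_def)
    then obtain x where x: "x \<in> Y" "norm x \<le> 2 * real n" "norm (f x - s *\<^sub>R v) < r / 4"
      using approx[of "s *\<^sub>R v" "r / 4"] v r subR by (auto simp: subspace_scale)
    show ?thesis
    proof (intro bexI[of _ "x /\<^sub>R s"] conjI)
      show xs: "x /\<^sub>R s \<in> Y" using x Y by (simp add: subspace_scale)
      show "v - f (x /\<^sub>R s) \<in> R"
        using v xs subR by (auto simp: R_def intro!: subspace_diff[OF subR[unfolded R_def]])
      have "norm (x /\<^sub>R s) = norm x / s" using s by (simp add: divide_inverse_commute)
      also have "\<dots> \<le> 2 * real n / s" using x s by (simp add: divide_right_mono)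
      also have "\<dots> = 4 * real n / r * norm v" using r False by (simp add: s_def field_simps)
      finally show "norm (x /\<^sub>R s) \<le> 4 * real n / r * norm v" .
      have "v - f (x /\<^sub>R s) = - ((f x - s *\<^sub>R v) /\<^sub>R s)"
        using s by (simp add: f.scaleR scaleR_diff_right)
      then have "norm (v - f (x /\<^sub>R s)) = norm (f x - s *\<^sub>R v) / s"
        using s by (simp add: divide_inverse_commute)
      also have "\<dots> \<le> r / 4 / s" using x s by (intro divide_right_mono) auto
      also have "\<dots> = 1 / 2 * norm v" using r False by (simp add: s_def field_simps)
      finally show "norm (v - f (x /\<^sub>R s)) \<le> 1 / 2 * norm v" .
    qed
  qed
  have lift: "\<exists>x\<in>Y. f x = v \<and> norm x \<le> 4 * real n / r / (1 - 1 / 2) * norm v" if "v \<in> f ` Y" for v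
    by (rule approx_lift[OF f Y, where V = R]) (use step that in \<open>auto simp: R_def\<close>)
  show thesis
  proof
    \<comment> \<open>The summand 1 keeps the constant positive for n = 0.\<close>
    show "4 * real n / r / (1 - 1 / 2) + 1 > 0"
      using r by (simp add: add_nonneg_pos)
    fix v assume "v \<in> f ` Y"
    then obtain x where "x \<in> Y" "f x = v" "norm x \<le> 4 * real n / r / (1 - 1 / 2) * norm v"
      using lift by blast
    then show "\<exists>x\<in>Y. f x = v \<and> norm x \<le> (4 * real n / r / (1 - 1 / 2) + 1) * norm v"
      by (intro bexI[of _ x]) (auto simp: distrib_right intro: add_increasing2)
  qed
qed

text \<open>A point v of the closure has an image point y within norm v / 2, hence of norm at most 2
  norm v. Lifting y leaves a residual that stays in the closure and has at most half the norm, so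
  \<open>approx_lift\<close> reaches every point of the closure.\<close>

lemma closed_image_if_lift:
  fixes f :: "'b::banach \<Rightarrow> 'c::real_normed_vector"
  assumes f: "bounded_linear f" and Y: "subspace Y" "closed Y"
    and lift: "\<And>v. v \<in> f ` Y \<Longrightarrow> \<exists>x\<in>Y. f x = v \<and> norm x \<le> C * norm v"
  shows "closed (f ` Y)"
proof -
  interpret f: bounded_linear f by (fact f)
  have "\<exists>x\<in>Y. norm x \<le> 2 * \<bar>C\<bar> * norm v \<and> v - f x \<in> closure (f ` Y) \<and> norm (v - f x) \<le> 1 / 2 * norm v"
    if v: "v \<in> closure (f ` Y)" for v
  proof (cases "v = 0")
    case True
    then show ?thesis
      using v subspace_0[OF Y(1)] by (intro bexI[of _ 0]) (auto simp: f.zero)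
  next
    case False
    obtain y where y: "y \<in> f ` Y" "dist y v < norm v / 2"
      using v False unfolding closure_approachable by (metis half_gt_zero zero_less_norm_iff)
    obtain x where x: "x \<in> Y" "f x = y" "norm x \<le> C * norm y" using lift[OF y(1)] by blast
    have "norm y \<le> 2 * norm v"
      using y(2) norm_triangle_ineq2[of y v] norm_ge_zero[of v] unfolding dist_norm by linarith
    then have "C * norm y \<le> \<bar>C\<bar> * (2 * norm v)"
      by (intro mult_mono) auto
    moreover have "v - f x \<in> closure (f ` Y)"
      unfolding closure_approachable
    proof (intro allI impI)
      fix e :: real assume "e > 0"
      then obtain w where w: "w \<in> Y" "dist (f w) v < e"
        using v unfolding closure_approachable by blast
      then have "f (w - x) \<in> f ` Y" "dist (f (w - x)) (v - f x) < e"
        using subspace_diff[OF Y(1) w(1) x(1)] by (blast, simp add: f.diff dist_norm)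
      then show "\<exists>y\<in>f ` Y. dist y (v - f x) < e" by blast
    qed
    ultimately show ?thesis
      using x y by (intro bexI[of _ x]) (auto simp: dist_norm norm_minus_commute)
  qed
  then have "\<exists>x\<in>Y. f x = v" if "v \<in> closure (f ` Y)" for v
    using approx_lift[OF f Y, of "1/2" "closure (f ` Y)" "2 * \<bar>C\<bar>" v] that by auto
  then have "closure (f ` Y) \<subseteq> f ` Y" by blast
  then show ?thesis
    using closure_subset_eq by blast
qed

section \<open>The Hahn-Banach theorem\<close>

text \<open>Homogeneity is only an inequality here, which is easy to check for infima;
  \<open>sublinear_scaleR\<close> recovers equality.\<close>

definition sublinear :: "('a::real_vector \<Rightarrow> real) \<Rightarrow> bool" where
  "sublinear q \<longleftrightarrow> (\<forall>x y. q (x + y) \<le> q x + q y) \<and> (\<forall>r\<ge>0. \<forall>x. q (r *\<^sub>R x) \<le> r * q x)"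

lemma sublinear_add: "sublinear q \<Longrightarrow> q (x + y) \<le> q x + q y"
  by (simp add: sublinear_def)

lemma sublinear_scaleR_le: "sublinear q \<Longrightarrow> 0 \<le> r \<Longrightarrow> q (r *\<^sub>R x) \<le> r * q x"
  by (simp add: sublinear_def)

lemma sublinear_zero: "sublinear q \<Longrightarrow> q 0 = 0"
  using sublinear_scaleR_le[of q 0 0] sublinear_add[of q 0 0] by simp

lemma sublinear_scaleR:
  assumes "sublinear q" "0 \<le> r"
  shows "q (r *\<^sub>R x) = r * q x"
proof (cases "r = 0")
  case False
  have "q ((1 / r) *\<^sub>R (r *\<^sub>R x)) \<le> 1 / r * q (r *\<^sub>R x)"
    using assms by (intro sublinear_scaleR_le) auto
  with assms False have "r * q x \<le> q (r *\<^sub>R x)"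
    by (simp add: field_simps)
  with assms show ?thesis
    by (simp add: sublinear_def order_antisym)
qed (use assms in \<open>simp add: sublinear_zero\<close>)

lemma sublinear_neg_le: "sublinear q \<Longrightarrow> - q (- x) \<le> q x"
  using sublinear_add[of q x "- x"] sublinear_zero[of q] by simp

text \<open>Pulls q down along the ray of x: the parameter 0 shows that q' stays below q, the
  parameter 1 gives the value at - x. It serves twice: a minimal sublinear functional must be odd,
  and a linear minorant of q' touches q at x.\<close>

lemma sublinear_reduce:
  assumes q: "sublinear q"
  obtains q' where "sublinear q'" "\<And>z. q' z \<le> q z" "q' (- x) \<le> - q x"
proof -
  define h where "h z t = q (z + t *\<^sub>R x) - t * q x" for z t
  define q' where "q' z = (INF t\<in>{0..}. h z t)" for z
  have lower: "- q (- z) \<le> h z t" if "0 \<le> t" for z t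
    using sublinear_add[OF q, of "z + t *\<^sub>R x" "- z"] sublinear_scaleR[OF q that, of x]
    by (simp add: h_def)
  then have bdd: "bdd_below (h z ` {0..})" for z
    by (intro bdd_belowI2) auto
  have le: "q' z \<le> h z t" if "0 \<le> t" for z t
    unfolding q'_def using that by (intro cINF_lower bdd) auto
  have ge: "c \<le> q' z" if "\<And>t. 0 \<le> t \<Longrightarrow> c \<le> h z t" for c z
    unfolding q'_def using that by (intro cINF_greatest) auto
  show thesis
  proof
    show "q' z \<le> q z" for z
      using le[of 0 z] by (simp add: h_def)
    show "q' (- x) \<le> - q x"
      using le[of 1 "- x"] sublinear_zero[OF q] by (simp add: h_def)
    show "sublinear q'"
      unfolding sublinear_def
    proof (intro conjI allI impI)
      fix z w
      have "q' (z + w) \<le> h z s + h w t" if "0 \<le> s" "0 \<le> t" for s t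
      proof -
        have "q' (z + w) \<le> h (z + w) (s + t)"
          using that by (intro le) auto
        also have "\<dots> \<le> h z s + h w t"
          using sublinear_add[OF q, of "z + s *\<^sub>R x" "w + t *\<^sub>R x"]
          by (simp add: h_def algebra_simps)
        finally show ?thesis .
      qed
      then have "q' (z + w) - h w t \<le> q' z" if "0 \<le> t" for t
        using that by (intro ge) (simp add: algebra_simps)
      then have "q' (z + w) - q' z \<le> q' w"
        by (intro ge) (simp add: algebra_simps)
      then show "q' (z + w) \<le> q' z + q' w" by simp
    next
      fix r :: real and z assume r: "0 \<le> r"
      show "q' (r *\<^sub>R z) \<le> r * q' z"
      proof (cases "r = 0")
        case True
        then show ?thesis
          using le[of 0 0] sublinear_zero[OF q] by (simp add: h_def)
      next
        case False
        have "q' (r *\<^sub>R z) / r \<le> h z t" if "0 \<le> t" for t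
        proof -
          have "q' (r *\<^sub>R z) \<le> h (r *\<^sub>R z) (r * t)"
            using r that by (intro le) auto
          also have "\<dots> = r * h z t"
            using sublinear_scaleR[OF q r, of "z + t *\<^sub>R x"] by (simp add: h_def algebra_simps)
          finally show ?thesis using r False by (simp add: field_simps)
        qed
        then have "q' (r *\<^sub>R z) / r \<le> q' z" by (rule ge)
        then show ?thesis using r False by (simp add: field_simps)
      qed
    qed
  qed
qed

text \<open>By minimality \<open>sublinear_reduce\<close> changes nothing, so m is odd, and oddness
  reverses the inequality of subadditivity.\<close>

lemma linear_if_minimal_sublinear:
  assumes m: "sublinear m" and min: "\<And>q. sublinear q \<Longrightarrow> (\<And>z. q z \<le> m z) \<Longrightarrow> q = m"
  shows "linear m"
proof -
  have neg: "m (- x) = - m x" for x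
  proof -
    obtain q where "sublinear q" "\<And>z. q z \<le> m z" "q (- x) \<le> - m x"
      using sublinear_reduce[OF m] by blast
    with min have "m (- x) \<le> - m x" by metis
    with sublinear_neg_le[OF m, of x] show ?thesis by simp
  qed
  show ?thesis
  proof (rule linearI)
    show "m (x + y) = m x + m y" for x y
      using sublinear_add[OF m, of x y] sublinear_add[OF m, of "- x" "- y"] neg[of x] neg[of y] neg[of "x + y"]
      by simp
    show "m (r *\<^sub>R x) = r *\<^sub>R m x" for r x
      using sublinear_scaleR[OF m, of r x] sublinear_scaleR[OF m, of "- r" x] neg[of "r *\<^sub>R x"]
      by (cases "0 \<le> r") auto
  qed
qed

text \<open>Subadditivity of the infimum mixes two members of \<open>C\<close>; in a chain the
  smaller of the two serves for both arguments.\<close>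

lemma sublinear_chain_Inf:
  assumes C: "C \<noteq> {}" "\<And>q. q \<in> C \<Longrightarrow> sublinear q"
    and chain: "\<And>a b. a \<in> C \<Longrightarrow> b \<in> C \<Longrightarrow> (\<forall>z. a z \<le> b z) \<or> (\<forall>z. b z \<le> a z)"
    and bdd: "\<And>z. bdd_below ((\<lambda>q. q z) ` C)"
  shows "sublinear (\<lambda>z. INF q\<in>C. q z)"
proof -
  define u where "u z = (INF q\<in>C. q z)" for z
  have le: "u z \<le> q z" if "q \<in> C" for q z
    unfolding u_def using that by (intro cINF_lower bdd)
  have ge: "c \<le> u z" if "\<And>q. q \<in> C \<Longrightarrow> c \<le> q z" for c z
    unfolding u_def using that C by (intro cINF_greatest) auto
  have "sublinear u"
    unfolding sublinear_def
  proof (intro conjI allI impI)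
    fix z w
    have "u (z + w) \<le> a z + b w" if ab: "a \<in> C" "b \<in> C" for a b
    proof -
      obtain c where c: "c \<in> C" "c z \<le> a z" "c w \<le> b w"
        using chain[OF ab] ab by (metis order_refl)
      then show ?thesis
        using le[OF c(1), of "z + w"] sublinear_add[OF C(2)[OF c(1)], of z w] by linarith
    qed
    then have "u (z + w) - b w \<le> u z" if "b \<in> C" for b
      using that by (intro ge) (simp add: algebra_simps)
    then have "u (z + w) - u z \<le> u w"
      by (intro ge) (simp add: algebra_simps)
    then show "u (z + w) \<le> u z + u w" by simp
  next
    fix r :: real and z assume r: "0 \<le> r"
    show "u (r *\<^sub>R z) \<le> r * u z"
    proof (cases "r = 0")
      case True
      obtain q where q: "q \<in> C" using C by blast
      show ?thesis
        using True le[OF q, of 0] sublinear_zero[OF C(2)[OF q]] by simp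
    next
      case False
      have "u (r *\<^sub>R z) / r \<le> q z" if q: "q \<in> C" for q
        using le[OF q, of "r *\<^sub>R z"] sublinear_scaleR[OF C(2)[OF q] r, of z] r False
        by (simp add: field_simps)
      then have "u (r *\<^sub>R z) / r \<le> u z" by (rule ge)
      then show ?thesis using r False by (simp add: field_simps)
    qed
  qed
  then show ?thesis by (simp add: u_def[abs_def])
qed

lemma sublinear_minorant:
  assumes p: "sublinear p"
  obtains g where "linear g" "\<And>z. g z \<le> p z"
proof -
  define A where "A = {q. sublinear q \<and> (\<forall>z. q z \<le> p z)}"
  \<comment> \<open>The reversed order, so that the maximal element of Zorn's lemma is a minimal
    functional.\<close>
  define P where "P a b \<longleftrightarrow> (\<forall>z. b z \<le> a z)" for a b :: "'a \<Rightarrow> real"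
  have "\<exists>m\<in>A. \<forall>a\<in>A. P m a \<longrightarrow> a = m"
  proof (rule predicate_Zorn)
    show "partial_order_on A (relation_of P A)"
      by (rule partial_order_on_relation_ofI) (auto simp: P_def fun_eq_iff intro: order_trans order.antisym)
  next
    fix C assume "C \<in> Chains (relation_of P A)"
    then have C: "\<And>q. q \<in> C \<Longrightarrow> q \<in> A" "\<And>a b. a \<in> C \<Longrightarrow> b \<in> C \<Longrightarrow> P a b \<or> P b a"
      by (auto simp: Chains_def relation_of_def)
    show "\<exists>u\<in>A. \<forall>a\<in>C. P a u"
    proof (cases "C = {}")
      case True
      then show ?thesis using p by (auto simp: A_def)
    next
      case False
      have bdd: "bdd_below ((\<lambda>q. q z) ` C)" for z
      proof (rule bdd_belowI2)
        fix q assume "q \<in> C"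
        then have q: "sublinear q" "\<And>z. q z \<le> p z" using C by (auto simp: A_def)
        then show "- p (- z) \<le> q z"
          using sublinear_neg_le[OF q(1), of z] q(2)[of "- z"] by linarith
      qed
      have "sublinear (\<lambda>z. INF q\<in>C. q z)"
        using False C bdd by (intro sublinear_chain_Inf) (auto simp: A_def P_def)
      moreover have lower: "(INF q\<in>C. q z) \<le> q z" if "q \<in> C" for q z
        using that by (intro cINF_lower bdd)
      moreover obtain q where "q \<in> C" using False by blast
      then have "(INF q\<in>C. q z) \<le> p z" for z
        using lower[of q z] C(1)[of q] order_trans by (auto simp: A_def)
      ultimately show ?thesis
        by (intro bexI[of _ "\<lambda>z. INF q\<in>C. q z"]) (auto simp: A_def P_def)
    qed
  qed
  then obtain m where m: "m \<in> A" "\<And>a. a \<in> A \<Longrightarrow> P m a \<Longrightarrow> a = m" by blast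
  show thesis
  proof
    have "q = m" if "sublinear q" "\<And>z. q z \<le> m z" for q
      using m that order_trans unfolding A_def P_def by blast
    then show "linear m"
      using m(1) linear_if_minimal_sublinear unfolding A_def by blast
    show "m z \<le> p z" for z using m by (simp add: A_def)
  qed
qed

text \<open>Reducing p at x before taking a minorant forces g (- x) to be at most - p x. This takes
  the place of extending a functional from the line through x.\<close>

lemma sublinear_support:
  assumes p: "sublinear p"
  obtains g where "linear g" "\<And>z. g z \<le> p z" "g x = p x"
proof -
  obtain q where q: "sublinear q" "\<And>z. q z \<le> p z" "q (- x) \<le> - p x"
    using sublinear_reduce[OF p] by blast
  obtain g where g: "linear g" "\<And>z. g z \<le> q z"
    using sublinear_minorant[OF q(1)] by blast
  have "g (- x) = - g x" using g(1) by (rule linear_neg)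
  then have "p x \<le> g x" using g(2)[of "- x"] q(3) by linarith
  moreover have le: "g z \<le> p z" for z using g(2) q(2) order_trans by blast
  ultimately show thesis using that[of g] g(1) by (simp add: order_antisym)
qed

section \<open>Separating a point from a closed complex subspace\<close>

lemma infdist_less_obtain:
  assumes "infdist x A < e" "A \<noteq> {}"
  obtains a where "a \<in> A" "dist x a < e"
proof -
  have "\<exists>a\<in>A. dist x a < e"
  proof (rule ccontr)
    assume "\<not> ?thesis"
    then have "e \<le> (INF a\<in>A. dist x a)" using assms(2) by (intro cINF_greatest) auto
    then show False using assms by (simp add: infdist_notempty)
  qed
  then show thesis using that by blast
qed

text \<open>This is the seminorm of the quotient by \<open>R\<close>. It is the dominating
  functional for the separation theorem and later measures vectors modulo
  \<open>core\<close>.\<close>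

lemma sublinear_infdist:
  fixes R :: "'a::real_normed_vector set"
  assumes R: "subspace R"
  shows "sublinear (\<lambda>z. infdist z R)"
proof -
  have ne: "R \<noteq> {}" using R subspace_0 by blast
  have near: "\<exists>a\<in>R. dist z a < infdist z R + e" if "e > 0" for z e
    using infdist_less_obtain[of z R "infdist z R + e"] ne that by auto
  show ?thesis
    unfolding sublinear_def
  proof (intro conjI allI impI)
    fix x y :: 'a
    show "infdist (x + y) R \<le> infdist x R + infdist y R"
    proof (rule field_le_epsilon)
      fix e :: real assume "e > 0"
      then obtain a b where ab: "a \<in> R" "dist x a < infdist x R + e / 2" "b \<in> R" "dist y b < infdist y R + e / 2"
        using near by (meson half_gt_zero)
      have "infdist (x + y) R \<le> dist (x + y) (a + b)"
        using ab R by (intro infdist_le subspace_add)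
      also have "\<dots> \<le> dist x a + dist y b" by (rule dist_triangle_add)
      finally show "infdist (x + y) R \<le> infdist x R + infdist y R + e" using ab by linarith
    qed
  next
    fix r :: real and x :: 'a assume r: "0 \<le> r"
    show "infdist (r *\<^sub>R x) R \<le> r * infdist x R"
    proof (cases "r = 0")
      case True
      then show ?thesis using R by (simp add: subspace_0)
    next
      case False
      show ?thesis
      proof (rule field_le_epsilon)
        fix e :: real assume "e > 0"
        then obtain a where a: "a \<in> R" "dist x a < infdist x R + e / r"
          using near r False by (metis divide_pos_pos order_less_le)
        have "infdist (r *\<^sub>R x) R \<le> dist (r *\<^sub>R x) (r *\<^sub>R a)"
          using a R by (intro infdist_le subspace_scale)
        also have "\<dots> = r * dist x a" using r by (simp add: dist_norm flip: scaleR_diff_right)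
        also have "\<dots> \<le> r * infdist x R + e"
          using a(2) r False by (simp add: field_simps)
        finally show "infdist (r *\<^sub>R x) R \<le> r * infdist x R + e" .
      qed
    qed
  qed
qed

definition cfunctional :: "('a::complex_banach \<Rightarrow> complex) \<Rightarrow> bool" where
  "cfunctional f \<longleftrightarrow> bounded_linear f \<and> (\<forall>c x. f (c *\<^sub>C x) = c * f x)"

lemma csubspace_imp_subspace: "csubspace V \<Longrightarrow> subspace V"
  using complex_vector.subspace_0 complex_vector.subspace_add complex_vector.subspace_scale[of V _ "complex_of_real _"]
  by (auto simp: subspace_def scaleC_of_real)

text \<open>Take a real functional g below the distance to \<open>R\<close> that touches it at x. It
  vanishes on \<open>R\<close> with the distance, is bounded by the norm, and is positive at x
  because \<open>R\<close> is closed.\<close>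

theorem Hahn_Banach_separation:
  fixes R :: "'a::complex_banach set"
  assumes R: "csubspace R" "closed R" and x: "x \<notin> R"
  obtains f where "cfunctional f" "\<And>z. z \<in> R \<Longrightarrow> f z = 0" "f x = 1"
proof -
  have subR: "subspace R" using R(1) by (rule csubspace_imp_subspace)
  have ne: "R \<noteq> {}" using subR subspace_0 by blast
  obtain g where g: "linear g" "\<And>z. g z \<le> infdist z R" "g x = infdist x R"
    using sublinear_support[OF sublinear_infdist[OF subR]] by blast
  interpret g: linear g by (fact g(1))
  have gx: "g x > 0"
    using g(3) x R(2) ne in_closed_iff_infdist_zero[of R x] infdist_nonneg[of x R] by fastforce
  have infdist_norm: "infdist z R \<le> norm z" for z
    using infdist_le[OF subspace_0[OF subR], of z] by simp
  have gR: "g z = 0" if "z \<in> R" for z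
    using g(2)[of z] g(2)[of "- z"] that subspace_neg[OF subR that] by (simp add: g.neg)
  have gb: "\<bar>g z\<bar> \<le> norm z" for z
    using g(2)[of z] g(2)[of "- z"] infdist_norm[of z] infdist_norm[of "- z"] by (simp add: g.neg)
  \<comment> \<open>The complex linear functional with real part g.\<close>
  define h where "h z = complex_of_real (g z) - \<i> * complex_of_real (g (\<i> *\<^sub>C z))" for z
  have split: "c *\<^sub>C z = Re c *\<^sub>R z + Im c *\<^sub>R (\<i> *\<^sub>C z)" for c z
    by (subst (1) complex_eq[of c]) (simp only: scaleC_add_left scaleC_scaleC[symmetric] scaleC_of_real[symmetric] mult.commute[of \<i>])
  have hadd: "h (z + w) = h z + h w" for z w
    by (simp add: h_def g.add scaleC_add_right algebra_simps)
  have hC: "h (c *\<^sub>C z) = c * h z" for c z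
  proof -
    have "g (c *\<^sub>C z) = Re c * g z + Im c * g (\<i> *\<^sub>C z)" for c
      by (subst split) (simp add: g.add g.scaleR)
    from this[of c] this[of "\<i> * c"] show ?thesis
      by (simp add: h_def scaleC_scaleC complex_eq_iff algebra_simps)
  qed
  have hb: "norm (h z) \<le> norm z * 2" for z
  proof -
    have "norm (h z) \<le> \<bar>g z\<bar> + \<bar>g (\<i> *\<^sub>C z)\<bar>"
      unfolding h_def using norm_triangle_ineq4[of "complex_of_real (g z)" "\<i> * complex_of_real (g (\<i> *\<^sub>C z))"]
      by (simp add: norm_mult)
    then show ?thesis using gb[of z] gb[of "\<i> *\<^sub>C z"] by (simp add: norm_scaleC)
  qed
  have "bounded_linear h"
  proof (rule bounded_linear_intro[OF hadd _ hb])
    show "h (r *\<^sub>R z) = r *\<^sub>R h z" for r z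
      using hC[of "complex_of_real r" z] by (simp add: scaleC_of_real scaleR_conv_of_real)
  qed
  then have "cfunctional (\<lambda>z. h z / h x)"
    unfolding cfunctional_def using bounded_linear_compose[OF bounded_linear_divide] by (auto simp: hC)
  moreover have "h z = 0" if "z \<in> R" for z
    using that R(1) by (simp add: h_def gR complex_vector.subspace_scale)
  moreover have "h x \<noteq> 0"
    using gx by (simp add: h_def complex_eq_iff)
  ultimately show thesis using that[of "\<lambda>z. h z / h x"] by simp
qed

section \<open>Dimension, codimension and dual functionals\<close>

lemma not_enat_Suc_le_iff: "\<not> enat (Suc n) \<le> d \<longleftrightarrow> d \<le> enat n"
  by (cases d) auto

lemma cdim_le_iff: "cdim V \<le> enat n \<longleftrightarrow> (\<exists>B. finite B \<and> card B \<le> n \<and> V \<subseteq> cspan B)"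
proof
  assume le: "cdim V \<le> enat n"
  then have fin: "\<exists>B. finite B \<and> V \<subseteq> cspan B"
    by (auto simp: cdim_def split: if_splits)
  with le have dim: "cdim_nat V \<le> n"
    by (simp add: cdim_def)
  obtain B where B: "B \<subseteq> V" "\<not> cdependent B" "V \<subseteq> cspan B" "card B = cdim_nat V"
    using complex_vector.basis_exists[of V] by blast
  moreover have "finite B"
    using fin B complex_vector.independent_span_bound by (meson subset_trans)
  ultimately show "\<exists>B. finite B \<and> card B \<le> n \<and> V \<subseteq> cspan B"
    using dim by auto
next
  assume "\<exists>B. finite B \<and> card B \<le> n \<and> V \<subseteq> cspan B"
  then obtain B where B: "finite B" "card B \<le> n" "V \<subseteq> cspan B" by blast
  then have "cdim_nat V \<le> n"
    using complex_vector.dim_le_card order_trans by blast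
  with B show "cdim V \<le> enat n" by (auto simp: cdim_def)
qed

text \<open>With \<open>cdim_le_iff\<close> this reduces statements about possibly infinite
  dimensions to finite sets of vectors, which can be followed under a perturbation.\<close>

lemma cdim_ge_iff: "enat n \<le> cdim V \<longleftrightarrow> (\<exists>B\<subseteq>V. finite B \<and> \<not> cdependent B \<and> card B = n)"
proof
  assume ge: "enat n \<le> cdim V"
  obtain A where A: "A \<subseteq> V" "\<not> cdependent A" "V \<subseteq> cspan A"
    using complex_vector.maximal_independent_subset[of V] by blast
  have "\<exists>B\<subseteq>A. finite B \<and> card B = n"
  proof (cases "finite A")
    case True
    then have "cdim V \<le> enat (card A)"
      using A(3) cdim_le_iff by blast
    with ge have "n \<le> card A"
      using order_trans enat_ord_simps(1) by blast
    then show ?thesis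
      using True by (meson finite_subset obtain_subset_with_card_n)
  next
    case False
    then show ?thesis using infinite_arbitrarily_large by blast
  qed
  then show "\<exists>B\<subseteq>V. finite B \<and> \<not> cdependent B \<and> card B = n"
    using A complex_vector.dependent_mono by (metis subset_trans)
next
  assume "\<exists>B\<subseteq>V. finite B \<and> \<not> cdependent B \<and> card B = n"
  then obtain B where B: "B \<subseteq> V" "finite B" "\<not> cdependent B" "card B = n" by blast
  show "enat n \<le> cdim V"
  proof (cases n)
    case (Suc m)
    have "\<not> cdim V \<le> enat m"
    proof
      assume "cdim V \<le> enat m"
      then obtain A where A: "finite A" "card A \<le> m" "V \<subseteq> cspan A"
        unfolding cdim_le_iff by blast
      then have "card B \<le> card A"
        using B complex_vector.independent_span_bound by (meson subset_trans)
      with A B Suc show False by simp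
    qed
    then show ?thesis
      unfolding Suc using not_enat_Suc_le_iff by blast
  qed (simp flip: zero_enat_def)
qed

lemma cdim_mono: "V \<subseteq> W \<Longrightarrow> cdim V \<le> cdim W"
  by (cases "cdim W") (use cdim_le_iff in \<open>auto, (metis cdim_le_iff order_refl subset_trans)?\<close>)

lemma cdim_eq_0_iff: "csubspace V \<Longrightarrow> cdim V = 0 \<longleftrightarrow> V = {0}"
  using cdim_le_iff[of V 0] complex_vector.subspace_0[of V]
  by (auto simp flip: zero_enat_def)

text \<open>Covers infinite \<open>V\<close> as well, where both sides are infinite. It measures the
  one dimension that is lost in \<open>Kato_split\<close>.\<close>

lemma cdim_direct_sum_line:
  assumes UVW: "direct_sum U V (cspan {y})" and y: "y \<noteq> 0"
  shows "cdim U = cdim V + 1"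
proof -
  have V: "csubspace V" and VW: "V \<inter> cspan {y} = {0}"
    and U: "U = {m + n |m n. m \<in> V \<and> n \<in> cspan {y}}"
    using UVW by (auto simp: direct_sum_def)
  have yV: "y \<notin> V"
    using VW y complex_vector.span_base[of y "{y}"] by auto
  show ?thesis
  proof (cases "cdim V")
    case (enat n)
    obtain B where B: "B \<subseteq> V" "finite B" "\<not> cdependent B" "card B = n"
      using cdim_ge_iff[of n V] enat by auto
    obtain A where A: "finite A" "card A \<le> n" "V \<subseteq> cspan A"
      using cdim_le_iff[of V n] enat by auto
    \<comment> \<open>A vector of \<open>V\<close> outside the span would give n + 1 independent
      vectors inside the span of at most n.\<close>
    have "V \<subseteq> cspan B"
    proof
      fix v assume v: "v \<in> V"
      show "v \<in> cspan B"
      proof (rule ccontr)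
        assume nv: "v \<notin> cspan B"
        then have "\<not> cdependent (insert v B)"
          using B complex_vector.independent_insertI by blast
        then have "card (insert v B) \<le> card A"
          using complex_vector.independent_span_bound[of A "insert v B"] A B v by auto
        moreover have "v \<notin> B" using nv complex_vector.span_base by blast
        ultimately show False using A B by simp
      qed
    qed
    then have VB: "V = cspan B"
      using B V complex_vector.span_minimal by blast
    then have ind: "\<not> cdependent (insert y B)"
      using B yV complex_vector.independent_insertI by blast
    have UB: "U = cspan (insert y B)"
      using complex_vector.span_Un[of B "{y}"] by (simp add: U VB)
    have "y \<notin> B" using yV B by blast
    then have card: "card (insert y B) = Suc n" using B by simp
    have "cdim U \<le> enat (Suc n)"
      unfolding cdim_le_iff UB using B card by (intro exI[of _ "insert y B"]) simp
    moreover have "enat (Suc n) \<le> cdim U"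
      unfolding cdim_ge_iff UB using B card ind
      by (intro exI[of _ "insert y B"] conjI complex_vector.span_superset) auto
    ultimately show ?thesis
      by (simp add: enat one_enat_def)
  next
    case infinity
    have "V \<subseteq> U"
      unfolding U using complex_vector.span_zero[of "{y}"] by force
    then have "cdim V \<le> cdim U" by (rule cdim_mono)
    then show ?thesis by (simp add: infinity)
  qed
qed

lemma direct_sumI:
  assumes "csubspace M" "csubspace N" "\<And>x. x \<in> M \<Longrightarrow> x \<in> N \<Longrightarrow> x = 0"
    and "\<And>m n. m \<in> M \<Longrightarrow> n \<in> N \<Longrightarrow> m + n \<in> Y"
    and "\<And>y. y \<in> Y \<Longrightarrow> \<exists>m\<in>M. \<exists>n\<in>N. y = m + n"
  shows "direct_sum Y M N"
  using assms complex_vector.subspace_0 unfolding direct_sum_def by blast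

lemma direct_sumD:
  assumes "direct_sum Y M N"
  shows "csubspace M" "csubspace N" "x \<in> M \<Longrightarrow> x \<in> N \<Longrightarrow> x = 0"
    and "m \<in> M \<Longrightarrow> n \<in> N \<Longrightarrow> m + n \<in> Y"
    and "y \<in> Y \<Longrightarrow> \<exists>m\<in>M. \<exists>n\<in>N. y = m + n"
    and "M \<subseteq> Y" "N \<subseteq> Y"
proof -
  show "csubspace M" "csubspace N" "x \<in> M \<Longrightarrow> x \<in> N \<Longrightarrow> x = 0"
    "m \<in> M \<Longrightarrow> n \<in> N \<Longrightarrow> m + n \<in> Y" "y \<in> Y \<Longrightarrow> \<exists>m\<in>M. \<exists>n\<in>N. y = m + n"
    using assms by (auto simp: direct_sum_def)
  show "N \<subseteq> Y" using assms by (rule direct_sum_superset)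
  have "0 \<in> N" using assms complex_vector.subspace_0 by (auto simp: direct_sum_def)
  then have "x \<in> Y" if "x \<in> M" for x
  proof -
    have "\<exists>m n. x = m + n \<and> m \<in> M \<and> n \<in> N"
      using that \<open>0 \<in> N\<close> by (intro exI[of _ x] exI[of _ 0]) simp
    then show ?thesis using assms by (simp add: direct_sum_def)
  qed
  then show "M \<subseteq> Y" by blast
qed

lemma direct_sum_unique:
  assumes "direct_sum Y M N" "m \<in> M" "m' \<in> M" "n \<in> N" "n' \<in> N" "m + n = m' + n'"
  shows "m = m'" "n = n'"
proof -
  have "m - m' = n' - n" using assms(6) by (simp add: algebra_simps)
  moreover have "m - m' \<in> M" "n' - n \<in> N"
    using direct_sumD(1,2)[OF assms(1)] assms(2-5) complex_vector.subspace_diff by blast+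
  ultimately have "m - m' = 0" using direct_sumD(3)[OF assms(1)] by metis
  then show "m = m'" "n = n'" using assms(6) by auto
qed

lemma cspan_Un_csubspace:
  assumes "csubspace R"
  shows "cspan (R \<union> B) = {r + b |r b. r \<in> R \<and> b \<in> cspan B}"
proof -
  have "cspan R = R" using assms by (simp add: complex_vector.span_eq_iff)
  then show ?thesis using complex_vector.span_Un[of R B] by (simp only:)
qed

text \<open>Frees upper bounds on the codimension from the choice of a complement: the same
  \<open>B\<close> can be tested against the range of a perturbed operator.\<close>

lemma codim_le_iff:
  assumes Y: "csubspace Y" and R: "csubspace R" "R \<subseteq> Y"
  shows "codim Y R \<le> enat n \<longleftrightarrow> (\<exists>B\<subseteq>Y. finite B \<and> card B \<le> n \<and> Y \<subseteq> cspan (R \<union> B))"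
proof -
  obtain W where W: "direct_sum Y R W"
    using complement_exists[OF Y R] by blast
  have codim: "codim Y R = cdim W" using W by (rule codim_eq_cdim_complement)
  show ?thesis
  proof
    assume le: "codim Y R \<le> enat n"
    obtain B where B: "B \<subseteq> W" "\<not> cdependent B" "W \<subseteq> cspan B"
      using complex_vector.maximal_independent_subset[of W] by blast
    obtain A where A: "finite A" "card A \<le> n" "W \<subseteq> cspan A"
      using le unfolding codim cdim_le_iff by blast
    have "finite B \<and> card B \<le> card A"
      using A B complex_vector.independent_span_bound by (meson subset_trans)
    moreover have "Y \<subseteq> cspan (R \<union> B)"
      using direct_sumD(5)[OF W] B(3) unfolding cspan_Un_csubspace[OF R(1)] by blast
    ultimately show "\<exists>B\<subseteq>Y. finite B \<and> card B \<le> n \<and> Y \<subseteq> cspan (R \<union> B)"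
      using B(1) A(2) direct_sumD(7)[OF W] by (meson order_trans)
  next
    assume "\<exists>B\<subseteq>Y. finite B \<and> card B \<le> n \<and> Y \<subseteq> cspan (R \<union> B)"
    then obtain B where B: "B \<subseteq> Y" "finite B" "card B \<le> n" "Y \<subseteq> cspan (R \<union> B)" by blast
    \<comment> \<open>The vectors of \<open>B\<close> are replaced by their components in the
      complement \<open>W\<close>, which changes them only modulo \<open>R\<close>.\<close>
    have "\<exists>w\<in>W. b - w \<in> R" if "b \<in> B" for b
      using direct_sumD(5)[OF W, of b] B(1) that by (metis add_diff_cancel_right' subsetD)
    then obtain w where w: "\<And>b. b \<in> B \<Longrightarrow> w b \<in> W \<and> b - w b \<in> R" by metis
    have sub: "csubspace W" using W by (rule direct_sumD)
    have wW: "cspan (w ` B) \<subseteq> W"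
      using w sub by (intro complex_vector.span_minimal) auto
    have "R \<union> B \<subseteq> cspan (R \<union> w ` B)"
    proof
      fix x assume "x \<in> R \<union> B"
      then show "x \<in> cspan (R \<union> w ` B)"
      proof
        assume "x \<in> B"
        then have "(x - w x) + w x \<in> cspan (R \<union> w ` B)"
          using w by (intro complex_vector.span_add complex_vector.span_base) auto
        then show ?thesis by simp
      qed (simp add: complex_vector.span_base)
    qed
    then have "cspan (R \<union> B) \<subseteq> cspan (R \<union> w ` B)"
      by (simp add: complex_vector.span_minimal complex_vector.subspace_span)
    have "W \<subseteq> cspan (w ` B)"
    proof
      fix x assume x: "x \<in> W"
      then have "x \<in> cspan (R \<union> w ` B)"
        using direct_sumD(7)[OF W] B(4) \<open>cspan (R \<union> B) \<subseteq> cspan (R \<union> w ` B)\<close> by blast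
      then obtain r u where ru: "x = r + u" "r \<in> R" "u \<in> cspan (w ` B)"
        unfolding cspan_Un_csubspace[OF R(1)] by blast
      have "r = x - u" using ru by simp
      also have "\<dots> \<in> W" using x ru wW sub complex_vector.subspace_diff by blast
      finally have "r = 0" using ru direct_sumD(3)[OF W] by blast
      then show "x \<in> cspan (w ` B)" using ru by simp
    qed
    moreover have "card (w ` B) \<le> n" using card_image_le[OF B(2), of w] B(3) by simp
    ultimately show "codim Y R \<le> enat n"
      unfolding codim cdim_le_iff using B(2) by blast
  qed
qed

text \<open>Used to enlarge the span of a finite set to a complement, and to move a nilpotent
  summand from one part of a reduction to the other.\<close>

lemma direct_sum_assoc:
  assumes Z: "direct_sum Z A B" and Y: "direct_sum Y Z W"
  shows "direct_sum Y A {b + w |b w. b \<in> B \<and> w \<in> W}"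
proof (rule direct_sumI)
  show "csubspace A" using Z by (rule direct_sumD)
  show "csubspace {b + w |b w. b \<in> B \<and> w \<in> W}"
    using direct_sumD(2)[OF Z] direct_sumD(2)[OF Y] by (rule complex_vector.subspace_sums)
next
  fix x assume x: "x \<in> A" "x \<in> {b + w |b w. b \<in> B \<and> w \<in> W}"
  then obtain b w where bw: "x = b + w" "b \<in> B" "w \<in> W" by blast
  have "w = x - b" using bw by simp
  also have "\<dots> \<in> Z"
    using x bw direct_sumD(6,7)[OF Z] complex_vector.subspace_diff[OF direct_sumD(1)[OF Y]] by blast
  finally have "w = 0" using bw direct_sumD(3)[OF Y] by blast
  with bw x show "x = 0" using direct_sumD(3)[OF Z] by simp
next
  fix m n assume "m \<in> A" "n \<in> {b + w |b w. b \<in> B \<and> w \<in> W}"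
  then obtain b w where "n = b + w" "b \<in> B" "w \<in> W" by blast
  with \<open>m \<in> A\<close> have "(m + b) + w \<in> Y"
    using direct_sumD(4)[OF Z] direct_sumD(4)[OF Y] by blast
  then show "m + n \<in> Y" using \<open>n = b + w\<close> by (simp add: add.assoc)
next
  fix y assume "y \<in> Y"
  then obtain z w where "y = z + w" "z \<in> Z" "w \<in> W" using direct_sumD(5)[OF Y] by blast
  moreover obtain a b where "z = a + b" "a \<in> A" "b \<in> B" using direct_sumD(5)[OF Z] \<open>z \<in> Z\<close> by blast
  ultimately show "\<exists>m\<in>A. \<exists>n\<in>{b + w |b w. b \<in> B \<and> w \<in> W}. y = m + n"
    by (intro bexI[of _ a] bexI[of _ "b + w"]) (auto simp: add.assoc)
qed

text \<open>For the converse, a complement of \<open>R\<close> plus the span of \<open>B\<close>,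
  added to that span, is a complement of \<open>R\<close> that contains \<open>B\<close>.\<close>

lemma codim_ge_iff:
  assumes Y: "csubspace Y" and R: "csubspace R" "R \<subseteq> Y"
  shows "enat n \<le> codim Y R \<longleftrightarrow>
    (\<exists>B\<subseteq>Y. finite B \<and> \<not> cdependent B \<and> card B = n \<and> cspan B \<inter> R = {0})"
proof
  obtain W where W: "direct_sum Y R W"
    using complement_exists[OF Y R] by blast
  assume "enat n \<le> codim Y R"
  then obtain B where B: "B \<subseteq> W" "finite B" "\<not> cdependent B" "card B = n"
    unfolding codim_eq_cdim_complement[OF W] cdim_ge_iff by blast
  moreover have "cspan B \<subseteq> W"
    using B(1) direct_sumD(2)[OF W] by (rule complex_vector.span_minimal)
  then have "cspan B \<inter> R = {0}"
    using direct_sumD(3)[OF W] complex_vector.span_zero complex_vector.subspace_0[OF R(1)] by blast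
  ultimately show "\<exists>B\<subseteq>Y. finite B \<and> \<not> cdependent B \<and> card B = n \<and> cspan B \<inter> R = {0}"
    using direct_sumD(7)[OF W] by (intro exI[of _ B]) auto
next
  assume "\<exists>B\<subseteq>Y. finite B \<and> \<not> cdependent B \<and> card B = n \<and> cspan B \<inter> R = {0}"
  then obtain B where B: "B \<subseteq> Y" "finite B" "\<not> cdependent B" "card B = n" "cspan B \<inter> R = {0}" by blast
  let ?Z = "{r + b |r b. r \<in> R \<and> b \<in> cspan B}"
  have BY: "cspan B \<subseteq> Y"
    using B(1) Y by (rule complex_vector.span_minimal)
  have Z: "direct_sum ?Z R (cspan B)"
    unfolding direct_sum_def using R B(5) by (auto simp: complex_vector.subspace_span)
  have "csubspace ?Z"
    using R(1) complex_vector.subspace_span by (rule complex_vector.subspace_sums)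
  moreover have "?Z \<subseteq> Y" using R(2) BY Y complex_vector.subspace_add by blast
  ultimately obtain W where W: "direct_sum Y ?Z W" using complement_exists[OF Y] by blast
  let ?W = "{b + w |b w. b \<in> cspan B \<and> w \<in> W}"
  have "codim Y R = cdim ?W"
    using direct_sum_assoc[OF Z W] by (rule codim_eq_cdim_complement)
  moreover have "B \<subseteq> ?W"
    using complex_vector.span_base complex_vector.subspace_0[OF direct_sumD(2)[OF W]] by force
  then have "enat n \<le> cdim ?W" unfolding cdim_ge_iff using B by blast
  ultimately show "enat n \<le> codim Y R" by simp
qed

lemma codim_eq_0_iff:
  assumes "csubspace Y" "csubspace R" "R \<subseteq> Y"
  shows "codim Y R = 0 \<longleftrightarrow> R = Y"
proof -
  have "codim Y R = 0 \<longleftrightarrow> (\<exists>B\<subseteq>Y. finite B \<and> card B \<le> 0 \<and> Y \<subseteq> cspan (R \<union> B))"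
    using codim_le_iff[OF assms, of 0] by (simp flip: zero_enat_def)
  also have "\<dots> \<longleftrightarrow> Y \<subseteq> cspan R"
    by (auto intro!: exI[of _ "{}"])
  also have "cspan R = R" using assms(2) by simp
  finally show ?thesis using assms(3) by blast
qed

section \<open>Bounded functionals, finite-dimensional summands and biorthogonal families\<close>

lemma cfunctional_props:
  assumes "cfunctional f"
  shows "f (x + y) = f x + f y" "f (x - y) = f x - f y" "f (c *\<^sub>C x) = c * f x" "f 0 = 0"
    "f (sum g A) = (\<Sum>a\<in>A. f (g a))" "continuous_on S f"
  using assms bounded_linear.linear[of f]
  by (auto simp: cfunctional_def linear_add linear_diff linear_0 linear_sum linear_continuous_on)

lemma cfunctional_bound:
  assumes "cfunctional f"
  obtains K where "K \<ge> 0" "\<And>x. norm (f x) \<le> K * norm x"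
  using assms bounded_linear.nonneg_bounded[of f] by (auto simp: cfunctional_def mult.commute)

lemma tendsto_scaleC_left:
  fixes x :: "'a::complex_banach"
  assumes "(f \<longlongrightarrow> c) F"
  shows "((\<lambda>n. f n *\<^sub>C x) \<longlongrightarrow> c *\<^sub>C x) F"
proof -
  have "((\<lambda>n. cmod (f n - c) * norm x) \<longlongrightarrow> 0) F"
    by (intro tendsto_mult_left_zero tendsto_norm_zero LIM_zero assms)
  then have "((\<lambda>n. norm (f n *\<^sub>C x - c *\<^sub>C x)) \<longlongrightarrow> 0) F"
    by (simp add: norm_scaleC flip: complex_vector.scale_left_diff_distrib)
  then show ?thesis by (rule LIM_zero_cancel[OF tendsto_norm_zero_cancel])
qed

text \<open>If a is outside \<open>V\<close>, a functional f with f a = 1 that vanishes on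
  \<open>V\<close> determines the coefficient k as f x, and the set becomes a preimage of
  \<open>V\<close> under a continuous map.\<close>

lemma closed_add_line:
  assumes V: "csubspace V" "closed V"
  shows "closed {x. \<exists>k. x - k *\<^sub>C a \<in> V}"
proof (cases "a \<in> V")
  case True
  have "{x. \<exists>k. x - k *\<^sub>C a \<in> V} = V"
  proof
    show "{x. \<exists>k. x - k *\<^sub>C a \<in> V} \<subseteq> V"
    proof clarify
      fix x k assume "x - k *\<^sub>C a \<in> V"
      then have "(x - k *\<^sub>C a) + k *\<^sub>C a \<in> V"
        using V(1) True by (intro complex_vector.subspace_add complex_vector.subspace_scale)
      then show "x \<in> V" by simp
    qed
    show "V \<subseteq> {x. \<exists>k. x - k *\<^sub>C a \<in> V}" by (auto intro!: exI[of _ 0])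
  qed
  then show ?thesis using V by simp
next
  case False
  then obtain f where f: "cfunctional f" "\<And>z. z \<in> V \<Longrightarrow> f z = 0" "f a = 1"
    using Hahn_Banach_separation[OF V] by blast
  have "{x. \<exists>k. x - k *\<^sub>C a \<in> V} = {x. x - f x *\<^sub>C a \<in> V}"
  proof (intro Collect_cong iffI)
    fix x assume "\<exists>k. x - k *\<^sub>C a \<in> V"
    then obtain k where k: "x - k *\<^sub>C a \<in> V" by blast
    have "f (x - k *\<^sub>C a) = 0" using f(2)[OF k] .
    then have "k = f x" using f(3) cfunctional_props[OF f(1)] by simp
    with k show "x - f x *\<^sub>C a \<in> V" by simp
  qed blast
  moreover have "continuous_on UNIV (\<lambda>x. x - f x *\<^sub>C a)"
    using cfunctional_props(6)[OF f(1), of UNIV]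
    by (auto simp: continuous_on_def intro!: tendsto_intros tendsto_scaleC_left)
  then have "closed ((\<lambda>x. x - f x *\<^sub>C a) -` V)"
    using V(2) closed_vimage by blast
  ultimately show ?thesis by (simp add: vimage_def)
qed

lemma closed_cspan_Un_finite:
  assumes V: "csubspace V" "closed V" and B: "finite B"
  shows "closed (cspan (V \<union> B))"
  using B
proof induction
  case empty
  have "cspan V = V" using V by (simp add: complex_vector.span_eq_iff)
  then show ?case using V by (simp only: Un_empty_right)
next
  case (insert b B)
  then show ?case
    using closed_add_line[OF complex_vector.subspace_span] by (simp add: complex_vector.span_insert)
qed

lemma closed_cspan_finite: "finite B \<Longrightarrow> closed (cspan B)"
  using closed_cspan_Un_finite[of "{0}" B] complex_vector.subspace_0 
  by (simp add: complex_vector.span_insert_0 complex_vector.subspace_single_0)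

text \<open>Each functional separates b from the closed span of \<open>R\<close> and the other
  vectors of \<open>B\<close>. Independence and the trivial intersection together keep b outside
  that span.\<close>

lemma dual_functionals:
  assumes B: "finite B" "\<not> cdependent B" and R: "csubspace R" "closed R" "cspan B \<inter> R = {0}"
  obtains f where "\<And>b. b \<in> B \<Longrightarrow> cfunctional (f b)" "\<And>b z. b \<in> B \<Longrightarrow> z \<in> R \<Longrightarrow> f b z = 0"
    "\<And>b b'. b \<in> B \<Longrightarrow> b' \<in> B \<Longrightarrow> f b b' = (if b' = b then 1 else 0)"
proof -
  have "\<exists>f. cfunctional f \<and> (\<forall>z\<in>R. f z = 0) \<and> (\<forall>b'\<in>B. f b' = (if b' = b then 1 else 0))"
    if b: "b \<in> B" for b
  proof -
    let ?V = "cspan (R \<union> (B - {b}))"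
    have "b \<notin> ?V"
    proof
      assume "b \<in> ?V"
      then obtain r s where rs: "b = r + s" "r \<in> R" "s \<in> cspan (B - {b})"
        unfolding cspan_Un_csubspace[OF R(1)] by blast
      have "s \<in> cspan B" using rs(3) complex_vector.span_mono[of "B - {b}" B] by blast
      then have "b - s \<in> cspan B" using b complex_vector.span_base complex_vector.span_diff by blast
      then have "r \<in> cspan B" using rs(1) by simp
      then have "r = 0" using R(3) rs(2) by blast
      then have "b \<in> cspan (B - {b})" using rs by simp
      then show False using B(2) b complex_vector.dependent_def by blast
    qed
    moreover have "closed ?V"
      using R B(1) by (intro closed_cspan_Un_finite) auto
    ultimately obtain f where f: "cfunctional f" "\<And>z. z \<in> ?V \<Longrightarrow> f z = 0" "f b = 1"
      using Hahn_Banach_separation[of ?V b] complex_vector.subspace_span by blast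
    then show ?thesis
      using complex_vector.span_base[of _ "R \<union> (B - {b})"] by (intro exI[of _ f]) auto
  qed
  then obtain f where "\<And>b. b \<in> B \<Longrightarrow> cfunctional (f b) \<and> (\<forall>z\<in>R. f b z = 0) \<and>
      (\<forall>b'\<in>B. f b b' = (if b' = b then 1 else 0))" by metis
  then show thesis using that[of f] by blast
qed

lemma functionals_bound:
  assumes "finite B" "\<And>b. b \<in> B \<Longrightarrow> cfunctional (f b)"
  obtains K where "K > 0" "\<And>b x. b \<in> B \<Longrightarrow> norm (f b x) \<le> K * norm x"
proof -
  have "\<forall>b\<in>B. \<exists>k\<ge>0. \<forall>x. norm (f b x) \<le> k * norm x"
    using assms(2) cfunctional_bound by blast
  then obtain k where k: "\<And>b x. b \<in> B \<Longrightarrow> k b \<ge> 0 \<and> norm (f b x) \<le> k b * norm x"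
    by metis
  have "k b \<le> (\<Sum>b\<in>B. k b) + 1" if "b \<in> B" for b
    using member_le_sum[of b B k] assms(1) k that by force
  then have "norm (f b x) \<le> ((\<Sum>b\<in>B. k b) + 1) * norm x" if "b \<in> B" for b x
    using k[OF that, of x] mult_right_mono[OF _ norm_ge_zero[of x]] that order_trans by blast
  moreover have "(\<Sum>b\<in>B. k b) + 1 > 0" using k by (simp add: add_nonneg_pos sum_nonneg)
  ultimately show thesis using that by blast
qed

text \<open>Applying the dual functional of b to a vanishing combination of the g b' expresses the
  coefficient of b by the errors g b' - b'. Summing over b bounds the sum of the absolute values of
  all coefficients by half of itself.\<close>

lemma independent_perturbation:
  assumes B: "finite B" "\<not> cdependent B"
  obtains d where "d > 0"
    "\<And>g. (\<And>b. b \<in> B \<Longrightarrow> norm (g b - b) \<le> d) \<Longrightarrow> inj_on g B \<and> \<not> cdependent (g ` B)"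
proof -
  have "csubspace ({0} :: 'a set)" "closed ({0} :: 'a set)" "cspan B \<inter> {0} = {0}"
    by (auto simp: complex_vector.subspace_single_0 complex_vector.span_zero)
  then obtain f where f: "\<And>b. b \<in> B \<Longrightarrow> cfunctional (f b)"
    "\<And>b b'. b \<in> B \<Longrightarrow> b' \<in> B \<Longrightarrow> f b b' = (if b' = b then 1 else 0)"
    using dual_functionals[OF B] by metis
  obtain K where K: "K > 0" "\<And>b x. b \<in> B \<Longrightarrow> norm (f b x) \<le> K * norm x"
    using functionals_bound[of B f] B(1) f(1) by blast
  \<comment> \<open>Makes card B * K * d at most 1 / 2; the added 1 covers empty
    \<open>B\<close>.\<close>
  define d where "d = 1 / (2 * K * (real (card B) + 1))"
  have d: "d > 0" using K by (simp add: d_def)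
  show thesis
  proof (rule that[OF d])
    fix g assume g: "\<And>b. b \<in> B \<Longrightarrow> norm (g b - b) \<le> d"
    have zero: "\<forall>b\<in>B. c b = 0" if c: "(\<Sum>b\<in>B. c b *\<^sub>C g b) = 0" for c
    proof -
      define s where "s = (\<Sum>b\<in>B. cmod (c b))"
      have "cmod (c b) \<le> K * d * s" if b: "b \<in> B" for b
      proof -
        have "0 = f b (\<Sum>b'\<in>B. c b' *\<^sub>C g b')"
          using c cfunctional_props(4)[OF f(1)[OF b]] by simp
        also have "\<dots> = (\<Sum>b'\<in>B. c b' * f b b' + c b' * f b (g b' - b'))"
          by (simp add: cfunctional_props(2,3,5)[OF f(1)[OF b]] algebra_simps)
        also have "\<dots> = c b + (\<Sum>b'\<in>B. c b' * f b (g b' - b'))"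
          using b f(2)[OF b] B(1) by (simp add: sum.distrib if_distrib[of "(*) _"] sum.delta cong: if_cong)
        finally have "c b = - (\<Sum>b'\<in>B. c b' * f b (g b' - b'))"
          by (simp add: eq_neg_iff_add_eq_0)
        then have "cmod (c b) \<le> (\<Sum>b'\<in>B. cmod (c b') * cmod (f b (g b' - b')))"
          using norm_sum[of "\<lambda>b'. c b' * f b (g b' - b')" B] by (simp add: norm_mult)
        also have "\<dots> \<le> (\<Sum>b'\<in>B. cmod (c b') * (K * d))"
        proof (intro sum_mono mult_left_mono)
          fix b' assume b': "b' \<in> B"
          show "cmod (f b (g b' - b')) \<le> K * d"
            using K(2)[OF b, of "g b' - b'"] mult_left_mono[OF g[OF b'], of K] K(1) by linarith
        qed simp
        also have "\<dots> = K * d * s" by (simp add: s_def sum_distrib_left mult.commute)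
        finally show ?thesis .
      qed
      then have "s \<le> (\<Sum>b\<in>B. K * d * s)" unfolding s_def[symmetric] by (subst s_def) (rule sum_mono)
      also have "\<dots> = real (card B) / (real (card B) + 1) / 2 * s"
        using K by (simp add: d_def)
      also have "\<dots> \<le> 1 / 2 * s"
        by (intro mult_right_mono) (auto simp: s_def field_simps intro: sum_nonneg)
      finally have "s \<le> 0" by simp
      then have "s = 0" using sum_nonneg[of B "\<lambda>b. cmod (c b)"] by (simp add: s_def)
      then show ?thesis
        using B(1) by (simp add: s_def sum_nonneg_eq_0_iff)
    qed
    have inj: "inj_on g B"
    proof (rule inj_onI, rule ccontr)
      fix a b assume ab: "a \<in> B" "b \<in> B" "g a = g b" "a \<noteq> b"
      define c where "c x = (if x = a then 1 else if x = b then - 1 else 0 :: complex)" for x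
      have "(\<Sum>x\<in>B. c x *\<^sub>C g x) = (\<Sum>x\<in>{a, b}. c x *\<^sub>C g x)"
        using ab B(1) by (intro sum.mono_neutral_right) (auto simp: c_def)
      also have "\<dots> = 0" using ab by (simp add: c_def)
      finally have "c a = 0" using zero ab by blast
      then show False by (simp add: c_def)
    qed
    have "\<not> cdependent (g ` B)"
    proof
      assume "cdependent (g ` B)"
      then obtain u where u: "\<exists>v\<in>g ` B. u v \<noteq> 0" "(\<Sum>v\<in>g ` B. u v *\<^sub>C v) = 0"
        using complex_vector.dependent_finite[of "g ` B"] B(1) by auto
      then have "(\<Sum>b\<in>B. u (g b) *\<^sub>C g b) = 0" using u(2) by (simp add: sum.reindex[OF inj] o_def)
      then show False using zero[of "\<lambda>b. u (g b)"] u(1) by auto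
    qed
    with inj show "inj_on g B \<and> \<not> cdependent (g ` B)" by blast
  qed
qed

section \<open>Operators on closed subspaces\<close>

lemma finite_cdim_basis:
  assumes V: "csubspace V" and fin: "cdim V < \<infinity>"
  obtains B where "finite B" "\<not> cdependent B" "V = cspan B" "cdim V = enat (card B)" "B \<subseteq> V"
proof -
  obtain A where A: "finite A" "V \<subseteq> cspan A"
    using fin by (auto simp: cdim_def split: if_splits)
  obtain B where B: "B \<subseteq> V" "\<not> cdependent B" "V \<subseteq> cspan B" "card B = cdim_nat V"
    using complex_vector.basis_exists[of V] by blast
  have "finite B"
    using A B complex_vector.independent_span_bound by (meson subset_trans)
  moreover have "V = cspan B" using B V complex_vector.span_minimal by blast
  moreover have "cdim V = enat (card B)"
    using A B by (auto simp: cdim_def)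
  ultimately show thesis using that B by blast
qed

lemma closed_finite_cdim: "csubspace V \<Longrightarrow> cdim V < \<infinity> \<Longrightarrow> closed V"
  using finite_cdim_basis closed_cspan_finite by metis

lemma L_add_scaleC:
  assumes "S \<in> L UNIV" "P \<in> L UNIV"
  shows "(\<lambda>x. S x + z *\<^sub>C P x) \<in> L UNIV"
proof -
  obtain K K' where K: "\<And>x. norm (S x) \<le> K * norm x" "\<And>x. norm (P x) \<le> K' * norm x"
    using assms by (auto simp: L_def)
  have "norm (S x + z *\<^sub>C P x) \<le> (K + cmod z * K') * norm x" for x
    using norm_triangle_ineq[of "S x" "z *\<^sub>C P x"] K(1)[of x] mult_left_mono[OF K(2)[of x], of "cmod z"]
    by (simp add: norm_scaleC algebra_simps)
  then have "\<exists>K. \<forall>x. norm (S x + z *\<^sub>C P x) \<le> K * norm x" by blast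
  then show ?thesis
    using assms by (simp add: L_def scaleC_add_right scaleC_scaleC mult.commute)
qed

lemma id_in_L: "(\<lambda>x. x) \<in> L UNIV"
  by (auto simp: L_def intro: exI[of _ 1])

text \<open>\<open>T\<close> is bounded and linear on the whole space, not only on \<open>Y\<close>,
  so general facts on bounded linear maps apply directly. Powers, shifts and restrictions to
  invariant closed subspaces are again instances.\<close>

locale operator_on =
  fixes T :: "'a::complex_banach \<Rightarrow> 'a" and Y :: "'a set"
  assumes T: "T \<in> L UNIV" and Y: "csubspace Y" "closed Y" and inv: "T ` Y \<subseteq> Y"
begin

lemma bl: "bounded_linear T"
  using T by (simp add: L_UNIV_iff)

lemma T_simps [simp]: "T (c *\<^sub>C x) = c *\<^sub>C T x" "T (x + y) = T x + T y" "T (x - y) = T x - T y" "T 0 = 0"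
  using T bl by (auto simp: L_UNIV_iff bounded_linear.linear linear_add linear_diff linear_0)

lemma Y_closed_ops: "0 \<in> Y" "x \<in> Y \<Longrightarrow> y \<in> Y \<Longrightarrow> x + y \<in> Y" "x \<in> Y \<Longrightarrow> y \<in> Y \<Longrightarrow> x - y \<in> Y"
    "x \<in> Y \<Longrightarrow> c *\<^sub>C x \<in> Y" "x \<in> Y \<Longrightarrow> T x \<in> Y"
  using complex_vector.subspace_0[OF Y(1)] complex_vector.subspace_add[OF Y(1)] complex_vector.subspace_diff[OF Y(1)]
    complex_vector.subspace_scale[OF Y(1)] inv by (simp_all add: image_subset_iff)

lemma subspace_Y: "subspace Y"
  using Y(1) by (rule csubspace_imp_subspace)

lemma in_L: "T \<in> L Y"
  using T Y_closed_ops(5) by (auto simp: L_def)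

lemma operator_on_subset:
  assumes "csubspace Z" "closed Z" "T ` Z \<subseteq> Z"
  shows "operator_on T Z"
  using T assms by unfold_locales

lemma operator_on_funpow: "operator_on (T ^^ n) Y"
proof (induction n)
  case 0
  show ?case using Y by unfold_locales (auto simp: id_in_L id_def)
next
  case (Suc n)
  then interpret Tn: operator_on "T ^^ n" Y .
  show ?case
  proof
    show "T ^^ Suc n \<in> L UNIV"
      using bounded_linear_compose[OF bl Tn.bl] by (simp add: L_UNIV_iff o_def)
    show "(T ^^ Suc n) ` Y \<subseteq> Y" using inv Tn.inv by auto
  qed (rule Y)+
qed

lemma operator_on_shift: "operator_on (\<lambda>x. T x + z *\<^sub>C x) Y"
proof
  show "(\<lambda>x. T x + z *\<^sub>C x) \<in> L UNIV" by (rule L_add_scaleC[OF T id_in_L])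
qed (use Y Y_closed_ops in auto)

lemma operator_on_diff: "operator_on (\<lambda>x. T x - z *\<^sub>C x) Y"
  using operator_on_shift[of "- z"] by simp

lemma csubspace_image: "csubspace Z \<Longrightarrow> csubspace (T ` Z)"
  unfolding complex_vector.subspace_def
  by (safe; (simp add: image_iff)?) (metis T_simps)+

lemma csubspace_vimage: "csubspace Z \<Longrightarrow> csubspace {x. T x \<in> Z}"
  by (auto simp: complex_vector.subspace_def)

lemma image_cspan: "T ` cspan B \<subseteq> cspan (T ` B)"
proof -
  have "cspan B \<subseteq> {x. T x \<in> cspan (T ` B)}"
    by (intro complex_vector.span_minimal csubspace_vimage complex_vector.subspace_span)
      (auto intro: complex_vector.span_base)
  then show ?thesis by blast
qed

lemma csubspace_ran: "csubspace (ran Y T)" and ran_subset: "ran Y T \<subseteq> Y"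
  using csubspace_image[OF Y(1)] inv by (auto simp: ran_def)

lemma csubspace_ker: "csubspace (ker Y T)" and ker_subset: "ker Y T \<subseteq> Y"
  using Y(1) by (auto simp: ker_def complex_vector.subspace_def)

lemma ran_lift:
  assumes "closed (ran Y T)"
  obtains C where "C > 0" "\<And>v. v \<in> ran Y T \<Longrightarrow> \<exists>x\<in>Y. T x = v \<and> norm x \<le> C * norm v"
  using open_mapping_lift[OF bl subspace_Y Y(2)] assms unfolding ran_def by blast

lemma closed_ran_if_lift:
  assumes "\<And>v. v \<in> ran Y T \<Longrightarrow> \<exists>x\<in>Y. T x = v \<and> norm x \<le> C * norm v"
  shows "closed (ran Y T)"
  using closed_image_if_lift[OF bl subspace_Y Y(2)] assms unfolding ran_def by blast

lemma nullity_eq_0_iff: "nullity Y T = 0 \<longleftrightarrow> ker Y T = {0}"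
  unfolding nullity_def using csubspace_ker by (rule cdim_eq_0_iff)

lemma defect_eq_0_iff: "defect Y T = 0 \<longleftrightarrow> ran Y T = Y"
  unfolding defect_def using Y(1) csubspace_ran ran_subset by (rule codim_eq_0_iff)

lemma ker_eq_0_iff: "ker Y T = {0} \<longleftrightarrow> inj_on T Y"
proof
  assume k: "ker Y T = {0}"
  show "inj_on T Y"
  proof (rule inj_onI)
    fix x y assume "x \<in> Y" "y \<in> Y" "T x = T y"
    then have "x - y \<in> ker Y T" by (simp add: ker_def Y_closed_ops)
    then show "x = y" using k by auto
  qed
qed (use Y_closed_ops(1) T_simps(4) in \<open>force simp: ker_def inj_on_def\<close>)

text \<open>A lift of T z differs from z by a kernel vector and so lies in \<open>Z\<close>; the
  lifting constant of \<open>T\<close> on \<open>Y\<close> is inherited.\<close>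

lemma closed_image_superset_ker:
  assumes ran: "closed (ran Y T)" and Z: "csubspace Z" "closed Z" "ker Y T \<subseteq> Z" "Z \<subseteq> Y"
  shows "closed (T ` Z)"
proof -
  obtain C where C: "\<And>v. v \<in> ran Y T \<Longrightarrow> \<exists>x\<in>Y. T x = v \<and> norm x \<le> C * norm v"
    using ran_lift[OF ran] by blast
  have "\<exists>x\<in>Z. T x = v \<and> norm x \<le> C * norm v" if v: "v \<in> T ` Z" for v
  proof -
    obtain z where z: "z \<in> Z" "v = T z" using v by blast
    then obtain x where x: "x \<in> Y" "T x = v" "norm x \<le> C * norm v"
      using C Z(4) by (auto simp: ran_def)
    have "x - z \<in> ker Y T" using x z Z(4) Y_closed_ops by (auto simp: ker_def)
    then have "(x - z) + z \<in> Z" using Z z(1) complex_vector.subspace_add by blast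
    then show ?thesis using x by auto
  qed
  then show ?thesis
    by (intro closed_image_if_lift[OF bl csubspace_imp_subspace[OF Z(1)] Z(2)])
qed

lemma ran_Suc: "ran Y (T ^^ Suc n) = T ` ran Y (T ^^ n)"
  by (simp add: ran_def image_comp)

lemma ran_funpow_mono: "m \<le> n \<Longrightarrow> ran Y (T ^^ n) \<subseteq> ran Y (T ^^ m)"
proof (induction n rule: dec_induct)
  case (step n)
  interpret Tn: operator_on "T ^^ n" Y by (rule operator_on_funpow)
  have "ran Y (T ^^ Suc n) \<subseteq> ran Y (T ^^ n)"
    using Y_closed_ops(5) by (auto simp: ran_def funpow_swap1)
  with step show ?case by blast
qed simp

text \<open>Adding the finite-dimensional kernel to the range of T^n keeps it closed, does not
  change its image under T, and makes \<open>closed_image_superset_ker\<close> applicable.\<close>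

lemma closed_ran_funpow_if_nullity:
  assumes ran: "closed (ran Y T)" and fin: "nullity Y T < \<infinity>"
  shows "closed (ran Y (T ^^ n))"
proof (induction n)
  case 0
  then show ?case using Y by (simp add: ran_def)
next
  case (Suc n)
  interpret Tn: operator_on "T ^^ n" Y by (rule operator_on_funpow)
  obtain B where B: "finite B" "ker Y T = cspan B"
    using finite_cdim_basis[OF csubspace_ker] fin unfolding nullity_def by metis
  let ?Z = "ran Y (T ^^ n)"
  let ?Z' = "cspan (?Z \<union> B)"
  have Z': "?Z' = {r + b |r b. r \<in> ?Z \<and> b \<in> ker Y T}"
    unfolding cspan_Un_csubspace[OF Tn.csubspace_ran] B(2) ..
  have "closed (T ` ?Z')"
  proof (rule closed_image_superset_ker[OF ran complex_vector.subspace_span])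
    show "closed ?Z'" using Tn.csubspace_ran Suc B(1) by (rule closed_cspan_Un_finite)
    show "ker Y T \<subseteq> ?Z'"
      unfolding B(2) by (rule complex_vector.span_mono) simp
    show "?Z' \<subseteq> Y"
      unfolding Z' using Tn.ran_subset Y_closed_ops by (auto simp: ker_def)
  qed
  also have "T ` ?Z' = T ` ?Z"
  proof
    show "T ` ?Z' \<subseteq> T ` ?Z" unfolding Z' by (auto simp: ker_def)
    show "T ` ?Z \<subseteq> T ` ?Z'" by (intro image_mono) (auto intro: complex_vector.span_base)
  qed
  finally show ?case unfolding ran_Suc .
qed

lemma defect_finite_iff: "defect Y T < \<infinity> \<longleftrightarrow> (\<exists>B\<subseteq>Y. finite B \<and> Y \<subseteq> cspan (ran Y T \<union> B))"
proof
  assume "defect Y T < \<infinity>"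
  then obtain n where "codim Y (ran Y T) \<le> enat n" by (cases "codim Y (ran Y T)") (auto simp: defect_def)
  then show "\<exists>B\<subseteq>Y. finite B \<and> Y \<subseteq> cspan (ran Y T \<union> B)"
    using codim_le_iff[OF Y(1) csubspace_ran ran_subset] by blast
next
  assume "\<exists>B\<subseteq>Y. finite B \<and> Y \<subseteq> cspan (ran Y T \<union> B)"
  then obtain B where "B \<subseteq> Y" "finite B" "Y \<subseteq> cspan (ran Y T \<union> B)" by blast
  then have "codim Y (ran Y T) \<le> enat (card B)"
    using codim_le_iff[OF Y(1) csubspace_ran ran_subset, of "card B"] by blast
  then show "defect Y T < \<infinity>" unfolding defect_def using enat_ord_simps(4) order_le_less_trans by blast
qed

text \<open>With a finite-dimensional complement \<open>W\<close> of the range, (x, w) |-> T x + w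
  maps Y x W onto \<open>Y\<close> and so has bounded lifts. For a vector of the range the second
  component of the lift vanishes, and the first is a bounded lift for T.\<close>

lemma closed_ran_if_defect:
  assumes "defect Y T < \<infinity>"
  shows "closed (ran Y T)"
proof -
  obtain W where W: "direct_sum Y (ran Y T) W"
    using complement_exists[OF Y(1) csubspace_ran ran_subset] by blast
  have "cdim W < \<infinity>"
    using assms codim_eq_cdim_complement[OF W] by (simp add: defect_def)
  then have cW: "closed W" using direct_sumD(2)[OF W] closed_finite_cdim by blast
  define f where "f p = T (fst p) + snd p" for p :: "'a \<times> 'a"
  have f: "bounded_linear f"
    unfolding f_def by (intro bounded_linear_add bounded_linear_compose[OF bl] bounded_linear_fst bounded_linear_snd)
  have sub: "subspace (Y \<times> W)"
    using subspace_Y direct_sumD(2)[OF W] csubspace_imp_subspace by (intro subspace_Times) auto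
  have fY: "f ` (Y \<times> W) = Y"
  proof
    show "f ` (Y \<times> W) \<subseteq> Y" using direct_sumD(4)[OF W] by (auto simp: f_def ran_def)
    show "Y \<subseteq> f ` (Y \<times> W)"
    proof
      fix y assume "y \<in> Y"
      then obtain m w where "m \<in> Y" "w \<in> W" "y = T m + w"
        using direct_sumD(5)[OF W, of y] unfolding ran_def by blast
      then show "y \<in> f ` (Y \<times> W)" by (intro image_eqI[of _ _ "(m, w)"]) (auto simp: f_def)
    qed
  qed
  obtain C where C: "\<And>v. v \<in> Y \<Longrightarrow> \<exists>p\<in>Y \<times> W. f p = v \<and> norm p \<le> C * norm v"
    using open_mapping_lift[OF f sub] cW Y(2) fY closed_Times by metis
  show ?thesis
  proof (rule closed_ran_if_lift)
    fix v assume v: "v \<in> ran Y T"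
    then obtain m w where p: "m \<in> Y" "w \<in> W" "T m + w = v" "norm (m, w) \<le> C * norm v"
      using C ran_subset by (force simp: f_def)
    have "T m + w = v + 0" using p by simp
    then have "T m = v"
      using direct_sum_unique(1)[OF W _ v p(2)] p(1) complex_vector.subspace_0[OF direct_sumD(2)[OF W]]
      by (auto simp: ran_def)
    moreover have "norm m \<le> C * norm v"
      using norm_fst_le[of m w] p(4) by simp
    ultimately show "\<exists>x\<in>Y. T x = v \<and> norm x \<le> C * norm v" using p by blast
  qed
qed

text \<open>If T^n(Y) and a finite set A span \<open>Y\<close>, then T^(n+1)(Y) and T(A) span T(Y),
  and finitely many more vectors complete it to \<open>Y\<close>.\<close>

lemma defect_funpow_finite:
  assumes "defect Y T < \<infinity>"
  shows "defect Y (T ^^ n) < \<infinity>"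
proof (induction n)
  case 0
  have "defect Y (T ^^ 0) = 0"
    using operator_on.defect_eq_0_iff[OF operator_on_funpow[of 0]] by (simp add: ran_def)
  then show ?case by (simp only: i0_less) simp
next
  case (Suc n)
  interpret Tn: operator_on "T ^^ n" Y by (rule operator_on_funpow)
  interpret TS: operator_on "T ^^ Suc n" Y by (rule operator_on_funpow)
  obtain B where B: "B \<subseteq> Y" "finite B" "Y \<subseteq> cspan (ran Y T \<union> B)"
    using assms defect_finite_iff by blast
  obtain A where A: "A \<subseteq> Y" "finite A" "Y \<subseteq> cspan (ran Y (T ^^ n) \<union> A)"
    using Suc Tn.defect_finite_iff by blast
  let ?S = "cspan (ran Y (T ^^ Suc n) \<union> (T ` A \<union> B))"
  have "ran Y T \<subseteq> T ` cspan (ran Y (T ^^ n) \<union> A)" using A(3) by (auto simp: ran_def)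
  also have "\<dots> \<subseteq> cspan (T ` (ran Y (T ^^ n) \<union> A))" by (rule image_cspan)
  also have "\<dots> \<subseteq> ?S" unfolding image_Un ran_Suc by (rule complex_vector.span_mono) auto
  finally have "ran Y T \<union> B \<subseteq> ?S" by (auto intro: complex_vector.span_base)
  then have "cspan (ran Y T \<union> B) \<subseteq> ?S"
    using complex_vector.subspace_span complex_vector.span_minimal by blast
  then have "Y \<subseteq> ?S" using B(3) by blast
  moreover have "T ` A \<union> B \<subseteq> Y" "finite (T ` A \<union> B)" using A(1,2) B(1,2) Y_closed_ops(5) by auto
  ultimately show ?case unfolding TS.defect_finite_iff by blast
qed

text \<open>This and the two lemmas below express the last three classes by closed range, nullity
  and defect, the terms in which the other classes are given.\<close>

lemma bounded_below_iff: "T \<in> bounded_below Y \<longleftrightarrow> closed (ran Y T) \<and> nullity Y T = 0"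
proof
  assume "T \<in> bounded_below Y"
  then obtain c where c: "c > 0" "\<And>x. x \<in> Y \<Longrightarrow> c * norm x \<le> norm (T x)"
    by (auto simp: bounded_below_def)
  have "closed (ran Y T)"
  proof (rule closed_ran_if_lift[of "1 / c"])
    fix v assume "v \<in> ran Y T"
    then obtain x where "x \<in> Y" "T x = v" by (auto simp: ran_def)
    then show "\<exists>x\<in>Y. T x = v \<and> norm x \<le> 1 / c * norm v"
      using c by (intro bexI[of _ x]) (auto simp: field_simps)
  qed
  moreover have "ker Y T = {0}"
    using c Y_closed_ops(1) by (fastforce simp: ker_def mult_le_0_iff)
  ultimately show "closed (ran Y T) \<and> nullity Y T = 0" by (simp add: nullity_eq_0_iff)
next
  assume *: "closed (ran Y T) \<and> nullity Y T = 0"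
  then obtain C where C: "C > 0" "\<And>v. v \<in> ran Y T \<Longrightarrow> \<exists>x\<in>Y. T x = v \<and> norm x \<le> C * norm v"
    using ran_lift by blast
  have inj: "inj_on T Y" using * nullity_eq_0_iff ker_eq_0_iff by simp
  have "1 / C * norm x \<le> norm (T x)" if x: "x \<in> Y" for x
  proof -
    obtain x' where "x' \<in> Y" "T x' = T x" "norm x' \<le> C * norm (T x)"
      using C(2)[of "T x"] x by (auto simp: ran_def)
    moreover from this have "x' = x" using inj x by (auto dest: inj_onD)
    ultimately show ?thesis using C(1) by (simp add: field_simps)
  qed
  then show "T \<in> bounded_below Y"
    unfolding bounded_below_def using in_L C(1) by (auto intro!: exI[of _ "1 / C"])
qed

lemma surjective_ops_iff: "T \<in> surjective_ops Y \<longleftrightarrow> defect Y T = 0"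
  by (simp add: surjective_ops_def in_L defect_eq_0_iff)

text \<open>For an injective T the lift with bounded norm is the inverse image itself, so the
  lifting constant bounds the inverse.\<close>

lemma invertible_ops_iff: "T \<in> invertible_ops Y \<longleftrightarrow> nullity Y T = 0 \<and> defect Y T = 0"
proof
  assume "T \<in> invertible_ops Y"
  then obtain S where S: "S \<in> L Y" "\<And>x. x \<in> Y \<Longrightarrow> T (S x) = x \<and> S (T x) = x"
    by (auto simp: invertible_ops_def)
  have "inj_on T Y" using S(2) by (metis inj_onI)
  moreover have "Y \<subseteq> ran Y T"
    using S by (force simp: ran_def L_def image_iff)
  ultimately show "nullity Y T = 0 \<and> defect Y T = 0"
    using ran_subset by (auto simp: nullity_eq_0_iff ker_eq_0_iff defect_eq_0_iff)
next
  assume *: "nullity Y T = 0 \<and> defect Y T = 0"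
  then have inj: "inj_on T Y" and ran: "T ` Y = Y"
    using defect_eq_0_iff by (auto simp: nullity_eq_0_iff ker_eq_0_iff ran_def)
  obtain C where C: "C > 0" "\<And>v. v \<in> ran Y T \<Longrightarrow> \<exists>x\<in>Y. T x = v \<and> norm x \<le> C * norm v"
    using ran_lift ran Y(2) by (auto simp: ran_def)
  define S where "S = the_inv_into Y T"
  have ST: "S (T x) = x" if "x \<in> Y" for x
    unfolding S_def using inj that by (rule the_inv_into_f_f)
  have S: "S y \<in> Y" "T (S y) = y" if "y \<in> Y" for y
    using that ran ST by (metis imageE)+
  have "S \<in> L Y"
    unfolding L_def
  proof (intro CollectI conjI ballI allI)
    show "S x \<in> Y" if "x \<in> Y" for x using S that by blast
    show "S (x + y) = S x + S y" if "x \<in> Y" "y \<in> Y" for x y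
      using S ST[of "S x + S y"] that Y_closed_ops by simp
    show "S (c *\<^sub>C x) = c *\<^sub>C S x" if "x \<in> Y" for c x
      using S ST[of "c *\<^sub>C S x"] that Y_closed_ops by simp
    have "norm (S x) \<le> C * norm x" if "x \<in> Y" for x
      using C(2)[of x] ST that ran by (auto simp: ran_def)
    then show "\<exists>K. \<forall>x\<in>Y. norm (S x) \<le> K * norm x" by blast
  qed
  then show "T \<in> invertible_ops Y"
    unfolding invertible_ops_def using in_L S ST by blast
qed

end

text \<open>Addition maps M x N onto the whole space; a bounded lift of y is its pair of components,
  so the component in \<open>N\<close> depends boundedly on y.\<close>

lemma closed_direct_sum_projection:
  assumes sum: "direct_sum UNIV M N" and cl: "closed M" "closed N"
  obtains P where "P \<in> L UNIV" "\<And>x. x \<in> M \<Longrightarrow> P x = 0" "\<And>x. x \<in> N \<Longrightarrow> P x = x" "\<And>x. P x \<in> N"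
    "\<And>x. x - P x \<in> M"
proof -
  have subs: "subspace (M \<times> N)"
    using direct_sumD(1,2)[OF sum] csubspace_imp_subspace by (intro subspace_Times) auto
  define f where "f p = fst p + snd p" for p :: "'a \<times> 'a"
  have f: "bounded_linear f"
    unfolding f_def by (intro bounded_linear_add bounded_linear_fst bounded_linear_snd)
  have "f ` (M \<times> N) = UNIV"
  proof -
    have "y \<in> f ` (M \<times> N)" for y
    proof -
      obtain m n where "m \<in> M" "n \<in> N" "y = m + n" using direct_sumD(5)[OF sum, of y] by blast
      then show ?thesis by (intro image_eqI[of _ _ "(m, n)"]) (auto simp: f_def)
    qed
    then show ?thesis by blast
  qed
  then obtain C where C: "\<And>v. \<exists>p\<in>M \<times> N. f p = v \<and> norm p \<le> C * norm v"
    using open_mapping_lift[OF f subs] cl closed_Times by (metis UNIV_I closed_UNIV)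
  have "\<forall>y. \<exists>n. n \<in> N \<and> y - n \<in> M \<and> norm n \<le> C * norm y"
  proof
    fix y
    obtain m n where mn: "m \<in> M" "n \<in> N" "m + n = y" "norm (m, n) \<le> C * norm y"
      using C[of y] by (auto simp: f_def)
    have "norm n \<le> C * norm y" using norm_snd_le[of n m] mn(4) by simp
    moreover have "y - n = m" using mn(3) by auto
    ultimately show "\<exists>n. n \<in> N \<and> y - n \<in> M \<and> norm n \<le> C * norm y" using mn by metis
  qed
  then obtain P where P: "\<And>y. P y \<in> N" "\<And>y. y - P y \<in> M" "\<And>y. norm (P y) \<le> C * norm y"
    by metis
  have uniq: "P y = n" if "n \<in> N" "y - n \<in> M" for y n
    using direct_sum_unique(2)[OF sum that(2) P(2)[of y] that(1) P(1)] by simp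
  have "P \<in> L UNIV"
    unfolding L_def
  proof (intro CollectI conjI ballI allI)
    show "P (x + y) = P x + P y" for x y
    proof (rule uniq)
      show "P x + P y \<in> N" using P direct_sumD(2)[OF sum] complex_vector.subspace_add by blast
      have "(x - P x) + (y - P y) \<in> M" using P direct_sumD(1)[OF sum] complex_vector.subspace_add by blast
      then show "x + y - (P x + P y) \<in> M" by (simp add: algebra_simps)
    qed
    show "P (c *\<^sub>C x) = c *\<^sub>C P x" for c x
    proof (rule uniq)
      show "c *\<^sub>C P x \<in> N" using P direct_sumD(2)[OF sum] complex_vector.subspace_scale by blast
      have "c *\<^sub>C (x - P x) \<in> M" using P direct_sumD(1)[OF sum] complex_vector.subspace_scale by blast
      then show "c *\<^sub>C x - c *\<^sub>C P x \<in> M" by (simp add: complex_vector.scale_right_diff_distrib)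
    qed
    show "\<exists>K. \<forall>x\<in>UNIV. norm (P x) \<le> K * norm x" using P(3) by blast
  qed simp
  moreover have "P x = 0" if "x \<in> M" for x
    using that complex_vector.subspace_0[OF direct_sumD(2)[OF sum]] by (intro uniq) auto
  moreover have "P x = x" if "x \<in> N" for x
    using that complex_vector.subspace_0[OF direct_sumD(1)[OF sum]] by (intro uniq) auto
  ultimately show thesis using that P by blast
qed

section \<open>Perturbation of Kato operators\<close>

lemma infdist_scaleC_le:
  assumes R: "csubspace R"
  shows "infdist (c *\<^sub>C x) R \<le> cmod c * infdist x R"
proof (cases "c = 0")
  case True
  then show ?thesis using complex_vector.subspace_0[OF R] by simp
next
  case False
  have ne: "R \<noteq> {}" using complex_vector.subspace_0[OF R] by blast
  have "infdist (c *\<^sub>C x) R / cmod c \<le> dist x a" if a: "a \<in> R" for a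
  proof -
    have "infdist (c *\<^sub>C x) R \<le> dist (c *\<^sub>C x) (c *\<^sub>C a)"
      using R a by (intro infdist_le complex_vector.subspace_scale)
    also have "\<dots> = cmod c * dist x a"
      by (simp add: dist_norm norm_scaleC flip: complex_vector.scale_right_diff_distrib)
    finally show ?thesis using False by (simp add: field_simps)
  qed
  then have "infdist (c *\<^sub>C x) R / cmod c \<le> infdist x R"
    using ne by (simp add: infdist_notempty cINF_greatest)
  then show ?thesis using False by (simp add: field_simps)
qed

lemma Inf_enat_finite_iff: "Inf {enat n |n. P n} < \<infinity> \<longleftrightarrow> (\<exists>n. P n)"
  unfolding Inf_less_iff by auto

lemma ascent_finite_iff: "ascent Y S < \<infinity> \<longleftrightarrow> (\<exists>n. ker Y (S ^^ n) = ker Y (S ^^ (n + 1)))"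
  unfolding ascent_def by (rule Inf_enat_finite_iff)

lemma descent_finite_iff: "descent Y S < \<infinity> \<longleftrightarrow> (\<exists>n. ran Y (S ^^ n) = ran Y (S ^^ (n + 1)))"
  unfolding descent_def by (rule Inf_enat_finite_iff)

section \<open>Kato operators and their behaviour on the intersection of the ranges of all
  powers\<close>

context operator_on
begin

lemma Kato_iff: "T \<in> Kato Y \<longleftrightarrow> closed (ran Y T) \<and> (\<forall>n. ker Y T \<subseteq> ran Y (T ^^ n))"
  by (simp add: Kato_def in_L)

text \<open>The kernel lies in the range of every T^n, so \<open>closed_image_superset_ker\<close>
  carries closedness from one power to the next.\<close>

lemma closed_ran_funpow_Kato:
  assumes "T \<in> Kato Y"
  shows "closed (ran Y (T ^^ n))"
proof (induction n)
  case 0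
  then show ?case using Y by (simp add: ran_def)
next
  case (Suc n)
  interpret Tn: operator_on "T ^^ n" Y by (rule operator_on_funpow)
  show ?case
    unfolding ran_Suc using assms Suc Tn.csubspace_ran Tn.ran_subset
    by (intro closed_image_superset_ker) (auto simp: Kato_iff)
qed

text \<open>If T^(n+1) x = 0, then T^n x lies in the kernel, hence in the range of T^(n+1), say T^n
  x = T^n (T u). The difference x - T u is killed by T^n, and the induction hypothesis applies to
  it.\<close>

lemma ker_funpow_subset_ran_Kato:
  assumes "T \<in> Kato Y"
  shows "ker Y (T ^^ n) \<subseteq> ran Y T"
proof (induction n)
  case 0
  show ?case using complex_vector.subspace_0[OF csubspace_ran] by (auto simp: ker_def)
next
  case (Suc n)
  interpret Tn: operator_on "T ^^ n" Y by (rule operator_on_funpow)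
  show ?case
  proof
    fix x assume x: "x \<in> ker Y (T ^^ Suc n)"
    then have "(T ^^ n) x \<in> ker Y T"
      using Tn.Y_closed_ops(5) by (auto simp: ker_def)
    then have "(T ^^ n) x \<in> ran Y (T ^^ Suc n)" using assms unfolding Kato_iff by blast
    then obtain u where u: "u \<in> Y" "(T ^^ n) x = (T ^^ n) (T u)"
      by (auto simp: ran_def funpow_swap1)
    then have "x - T u \<in> ker Y (T ^^ n)"
      using x Y_closed_ops by (simp add: ker_def)
    then have "(x - T u) + T u \<in> ran Y T"
      using Suc u by (intro complex_vector.subspace_add[OF csubspace_ran]) (auto simp: ran_def)
    then show "x \<in> ran Y T" by simp
  qed
qed

text \<open>A kernel vector is T^n y for every n. Where the kernels of T^n and T^(n+1) agree, y is
  already killed by T^n.\<close>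

lemma Kato_ascent_finite_iff:
  assumes "T \<in> Kato Y"
  shows "ascent Y T < \<infinity> \<longleftrightarrow> nullity Y T = 0"
proof
  assume "ascent Y T < \<infinity>"
  then obtain n where n: "ker Y (T ^^ n) = ker Y (T ^^ (n + 1))"
    unfolding ascent_finite_iff by blast
  have "x = 0" if x: "x \<in> ker Y T" for x
  proof -
    obtain y where y: "y \<in> Y" "x = (T ^^ n) y"
      using x assms by (auto simp: Kato_iff ran_def)
    then have "y \<in> ker Y (T ^^ (n + 1))" using x by (simp add: ker_def)
    then show ?thesis using y n by (auto simp: ker_def)
  qed
  then show "nullity Y T = 0"
    using complex_vector.subspace_0[OF csubspace_ker] by (auto simp: nullity_eq_0_iff)
next
  assume "nullity Y T = 0"
  then have "ker Y (T ^^ 0) = ker Y (T ^^ (0 + 1))"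
    using Y_closed_ops(1) by (auto simp: nullity_eq_0_iff ker_def)
  then show "ascent Y T < \<infinity>" unfolding ascent_finite_iff by blast
qed

text \<open>Where the ranges of T^n and T^(n+1) agree, x differs from some T y by a vector in the
  kernel of T^n, and that kernel lies in the range of T.\<close>

lemma Kato_descent_finite_iff:
  assumes "T \<in> Kato Y"
  shows "descent Y T < \<infinity> \<longleftrightarrow> defect Y T = 0"
proof
  assume "descent Y T < \<infinity>"
  then obtain n where n: "ran Y (T ^^ n) = ran Y (T ^^ (n + 1))"
    unfolding descent_finite_iff by blast
  interpret Tn: operator_on "T ^^ n" Y by (rule operator_on_funpow)
  have "x \<in> ran Y T" if x: "x \<in> Y" for x
  proof -
    have "(T ^^ n) x \<in> ran Y (T ^^ (n + 1))" unfolding n[symmetric] using x by (simp add: ran_def)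
    then obtain y where y: "y \<in> Y" "(T ^^ n) x = (T ^^ n) (T y)"
      by (auto simp: ran_def funpow_swap1)
    then have "x - T y \<in> ker Y (T ^^ n)" using x Y_closed_ops by (simp add: ker_def)
    then have "x - T y \<in> ran Y T" using ker_funpow_subset_ran_Kato[OF assms] by blast
    then have "(x - T y) + T y \<in> ran Y T"
      using y by (intro complex_vector.subspace_add[OF csubspace_ran]) (auto simp: ran_def)
    then show ?thesis by simp
  qed
  then show "defect Y T = 0" using ran_subset by (auto simp: defect_eq_0_iff)
next
  assume "defect Y T = 0"
  then have "ran Y (T ^^ 0) = ran Y (T ^^ (0 + 1))"
    by (simp add: defect_eq_0_iff) (simp add: ran_def)
  then show "descent Y T < \<infinity>" unfolding descent_finite_iff by blast
qed

text \<open>The hyperrange of T on \<open>Y\<close>. For a Kato operator it is closed, contains the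
  kernel and is mapped onto itself.\<close>

definition core :: "'a set" where
  "core = (\<Inter>n. ran Y (T ^^ n))"

lemma core_subset: "core \<subseteq> Y"
proof -
  have "core \<subseteq> ran Y (T ^^ 0)" unfolding core_def by blast
  then show ?thesis by (simp add: ran_def)
qed

lemma csubspace_core: "csubspace core"
  unfolding core_def using operator_on.csubspace_ran[OF operator_on_funpow]
  by (intro complex_vector.subspace_Inter) auto

lemma closed_core: "T \<in> Kato Y \<Longrightarrow> closed core"
  unfolding core_def using closed_ran_funpow_Kato by blast

lemma ker_subset_core: "T \<in> Kato Y \<Longrightarrow> ker Y T \<subseteq> core"
  by (auto simp: core_def Kato_iff)

text \<open>For each n, T x = T u with u in the range of T^n, and x - u is in the kernel and so in
  that range too. Hence lifts of vectors of \<open>core\<close> stay in \<open>core\<close>.\<close>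

lemma in_core_if_image:
  assumes K: "T \<in> Kato Y" and x: "x \<in> Y" "T x \<in> core"
  shows "x \<in> core"
  unfolding core_def
proof
  fix n
  interpret Tn: operator_on "T ^^ n" Y by (rule operator_on_funpow)
  have "T x \<in> ran Y (T ^^ Suc n)" using x(2) unfolding core_def by blast
  then obtain u where u: "u \<in> ran Y (T ^^ n)" "T x = T u" unfolding ran_Suc by blast
  then have "x - u \<in> ker Y T" using x Tn.ran_subset Y_closed_ops by (auto simp: ker_def)
  then have "x - u \<in> ran Y (T ^^ n)" using K by (auto simp: Kato_iff)
  then have "(x - u) + u \<in> ran Y (T ^^ n)" using u complex_vector.subspace_add[OF Tn.csubspace_ran] by blast
  then show "x \<in> ran Y (T ^^ n)" by simp
qed

lemma image_in_core: "x \<in> core \<Longrightarrow> T x \<in> core"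
  unfolding core_def
proof
  fix n assume "x \<in> (\<Inter>n. ran Y (T ^^ n))"
  then have "T x \<in> ran Y (T ^^ Suc n)" unfolding ran_Suc by blast
  then show "T x \<in> ran Y (T ^^ n)" using ran_funpow_mono[of n "Suc n"] by auto
qed

text \<open>T lifts within \<open>core\<close> with constant C, and using this lift for T - l leaves
  the residual l x, at most half as long. The geometric series doubles the constant.\<close>

lemma core_shift_lift:
  assumes K: "T \<in> Kato Y"
    and C: "\<And>v. v \<in> ran Y T \<Longrightarrow> \<exists>x\<in>Y. T x = v \<and> norm x \<le> C * norm v"
    and l: "cmod l * C \<le> 1 / 2" and z: "z \<in> core"
  shows "\<exists>x\<in>core. T x - l *\<^sub>C x = z \<and> norm x \<le> 2 * C * norm z"
proof -
  interpret Tl: operator_on "\<lambda>x. T x - l *\<^sub>C x" Y by (rule operator_on_diff)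
  have "\<exists>x\<in>core. T x - l *\<^sub>C x = z \<and> norm x \<le> C / (1 - 1 / 2) * norm z"
  proof (rule approx_lift[OF Tl.bl csubspace_imp_subspace[OF csubspace_core] closed_core[OF K], where V = core])
    fix v assume v: "v \<in> core"
    have "v \<in> ran Y (T ^^ 1)" using v unfolding core_def by blast
    then obtain x where x: "x \<in> Y" "T x = v" "norm x \<le> C * norm v" using C by auto
    then have xc: "x \<in> core" using in_core_if_image[OF K] v by simp
    show "\<exists>x\<in>core. norm x \<le> C * norm v \<and> v - (T x - l *\<^sub>C x) \<in> core \<and>
        norm (v - (T x - l *\<^sub>C x)) \<le> 1 / 2 * norm v"
    proof (intro bexI[OF _ xc] conjI x)
      show "v - (T x - l *\<^sub>C x) \<in> core"
        using x xc complex_vector.subspace_scale[OF csubspace_core] by simp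
      have "norm (v - (T x - l *\<^sub>C x)) = cmod l * norm x" using x by (simp add: norm_scaleC)
      also have "\<dots> \<le> cmod l * (C * norm v)" using x by (intro mult_left_mono) auto
      also have "\<dots> \<le> 1 / 2 * norm v" using mult_right_mono[OF l, of "norm v"] by (simp add: mult.assoc)
      finally show "norm (v - (T x - l *\<^sub>C x)) \<le> 1 / 2 * norm v" .
    qed
  qed (use z in auto)
  then show ?thesis by (simp add: mult.commute)
qed

text \<open>The operator induced by T on the quotient by \<open>core\<close> is bounded below by 1 /
  C: lifts of \<open>core\<close> lie in \<open>core\<close>, and so do kernel vectors.\<close>

lemma infdist_core_le:
  assumes K: "T \<in> Kato Y"
    and C: "\<And>v. v \<in> ran Y T \<Longrightarrow> \<exists>x\<in>Y. T x = v \<and> norm x \<le> C * norm v" "C > 0"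
    and y: "y \<in> Y"
  shows "infdist y core \<le> C * infdist (T y) core"
proof -
  have ne: "core \<noteq> {}" using complex_vector.subspace_0[OF csubspace_core] by blast
  have "infdist y core / C \<le> dist (T y) a" if a: "a \<in> core" for a
  proof -
    have "a \<in> ran Y (T ^^ 1)" using a unfolding core_def by blast
    then obtain u where u: "u \<in> Y" "T u = a" by (auto simp: ran_def)
    then have uc: "u \<in> core" using in_core_if_image[OF K] a by simp
    have "T y - a \<in> ran Y T"
      using u y Y_closed_ops by (auto simp: ran_def intro!: image_eqI[of _ _ "y - u"])
    then obtain x where x: "x \<in> Y" "T x = T y - a" "norm x \<le> C * norm (T y - a)" using C by blast
    have "y - u - x \<in> ker Y T" using u x y Y_closed_ops by (simp add: ker_def)
    then have "(y - u - x) + u \<in> core"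
      using ker_subset_core[OF K] uc complex_vector.subspace_add[OF csubspace_core] by blast
    then have "infdist y core \<le> dist y (y - x)" by (intro infdist_le) (simp add: algebra_simps)
    also have "\<dots> \<le> C * dist (T y) a" using x by (simp add: dist_norm)
    finally show ?thesis using C(2) by (simp add: field_simps)
  qed
  then have "infdist y core / C \<le> infdist (T y) core"
    using ne by (simp add: infdist_notempty cINF_greatest)
  then show ?thesis using C(2) by (simp add: field_simps)
qed

text \<open>An arbitrary preimage y of v is near some z in \<open>core\<close>, because T - l is
  still bounded below modulo \<open>core\<close>. The image w of z lies in \<open>core\<close>;
  lifting w again inside \<open>core\<close>, now with control of the norm, gives z', and y - z + z'
  is the lift sought. The constant does not involve l.\<close>

lemma shift_lift:
  assumes K: "T \<in> Kato Y"
    and C: "\<And>v. v \<in> ran Y T \<Longrightarrow> \<exists>x\<in>Y. T x = v \<and> norm x \<le> C * norm v" "C > 0"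
    and l: "cmod l * C \<le> 1 / 2"
    and B: "\<And>x. norm (T x) \<le> B * norm x" "B \<ge> 0"
    and v: "v \<in> ran Y (\<lambda>x. T x - l *\<^sub>C x)"
  shows "\<exists>x\<in>Y. T x - l *\<^sub>C x = v \<and> norm x \<le> (4 * C + 2 * C * (3 + 4 * B * C)) * norm v"
proof -
  have sl: "sublinear (\<lambda>z. infdist z core)"
    using csubspace_core by (intro sublinear_infdist csubspace_imp_subspace)
  obtain y where y: "y \<in> Y" "v = T y - l *\<^sub>C y" using v by (auto simp: ran_def)
  have "infdist (T y) core \<le> infdist v core + infdist (l *\<^sub>C y) core"
    using sublinear_add[OF sl, of v "l *\<^sub>C y"] y by simp
  also have "\<dots> \<le> norm v + cmod l * infdist y core"
    using infdist_le[OF complex_vector.subspace_0[OF csubspace_core], of v]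
      infdist_scaleC_le[OF csubspace_core, of l y] by simp
  finally have "C * infdist (T y) core \<le> C * (norm v + cmod l * infdist y core)"
    using C(2) by (intro mult_left_mono) auto
  then have "infdist y core \<le> C * norm v + (cmod l * C) * infdist y core"
    using infdist_core_le[OF K C y(1)] by (simp add: algebra_simps)
  also have "\<dots> \<le> C * norm v + 1 / 2 * infdist y core"
    using l by (intro add_left_mono mult_right_mono) (auto simp: infdist_nonneg)
  finally have near: "infdist y core \<le> 2 * C * norm v" by simp
  have ne: "core \<noteq> {}" using complex_vector.subspace_0[OF csubspace_core] by blast
  \<comment> \<open>The distance may not be attained, so the factor 2 is relaxed to 4. For v = 0
    this gives no room, and closedness of \<open>core\<close> is used instead.\<close>
  have "\<exists>z\<in>core. norm (y - z) \<le> 4 * C * norm v"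
  proof (cases "v = 0")
    case True
    then have "infdist y core = 0" using near infdist_nonneg[of y core] by simp
    then have "y \<in> core" using in_closed_iff_infdist_zero[OF closed_core[OF K] ne] by blast
    then show ?thesis using True by (intro bexI[of _ y]) auto
  next
    case False
    then have "C * norm v > 0" using C(2) by simp
    then have "infdist y core < 4 * C * norm v" using near by simp
    then obtain z where "z \<in> core" "dist y z < 4 * C * norm v" using infdist_less_obtain ne by blast
    then show ?thesis by (intro bexI[of _ z]) (simp_all add: dist_norm)
  qed
  then obtain z where z: "z \<in> core" "norm (y - z) \<le> 4 * C * norm v" by blast
  \<comment> \<open>Since w = v - (T - l)(y - z), its norm is controlled by that of v; the factor 3
    + 4 * B * C arises from 4 * cmod l * C being at most 2.\<close>
  define w where "w = T z - l *\<^sub>C z"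
  have "w \<in> core"
    unfolding w_def using z image_in_core complex_vector.subspace_diff[OF csubspace_core]
      complex_vector.subspace_scale[OF csubspace_core] by blast
  then obtain z' where z': "z' \<in> core" "T z' - l *\<^sub>C z' = w" "norm z' \<le> 2 * C * norm w"
    using core_shift_lift[OF K C(1) l] by blast
  have w_eq: "w = v - (T (y - z) - l *\<^sub>C (y - z))"
    by (simp add: w_def y complex_vector.scale_right_diff_distrib)
  have "norm w \<le> norm v + (norm (T (y - z)) + norm (l *\<^sub>C (y - z)))"
    unfolding w_eq using norm_triangle_ineq4[of v "T (y - z) - l *\<^sub>C (y - z)"] norm_triangle_ineq4[of "T (y - z)" "l *\<^sub>C (y - z)"]
    by linarith
  also have "\<dots> \<le> norm v + (B * (4 * C * norm v) + cmod l * (4 * C * norm v))"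
    using B(1)[of "y - z"] mult_left_mono[OF z(2) B(2)] mult_left_mono[OF z(2), of "cmod l"]
    by (intro add_left_mono add_mono) (auto simp: norm_scaleC)
  also have "\<dots> = (1 + 4 * B * C + 4 * (cmod l * C)) * norm v" by (simp add: algebra_simps)
  also have "\<dots> \<le> (3 + 4 * B * C) * norm v"
    by (rule mult_right_mono[OF _ norm_ge_zero]) (use l in linarith)
  finally have w: "norm w \<le> (3 + 4 * B * C) * norm v" .
  show ?thesis
  proof (intro bexI[of _ "(y - z) + z'"] conjI)
    show "T (y - z + z') - l *\<^sub>C (y - z + z') = v"
      using z'(2) by (simp add: y w_def scaleC_add_right complex_vector.scale_right_diff_distrib algebra_simps)
    have "norm (y - z + z') \<le> norm (y - z) + norm z'" by (rule norm_triangle_ineq)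
    also have "\<dots> \<le> 4 * C * norm v + 2 * C * ((3 + 4 * B * C) * norm v)"
    proof (rule add_mono[OF z(2) order_trans[OF z'(3)]])
      show "2 * C * norm w \<le> 2 * C * ((3 + 4 * B * C) * norm v)"
        using w C(2) by (intro mult_left_mono) auto
    qed
    finally show "norm (y - z + z') \<le> (4 * C + 2 * C * (3 + 4 * B * C)) * norm v"
      by (simp add: algebra_simps)
    show "y - z + z' \<in> Y" using y z z' core_subset Y_closed_ops by (meson subsetD)
  qed
qed

text \<open>T - l maps \<open>core\<close> onto itself and has its kernel there, so the ranges of
  all its powers contain that kernel. The inclusion for the kernel of T and the lift with constant
  \<open>D\<close>, the same for all l, are what lower semicontinuity is derived from.\<close>

lemma Kato_shift:
  assumes K: "T \<in> Kato Y"
  obtains e D where "e > 0" "D > 0"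
    "\<And>l. cmod l < e \<Longrightarrow> (\<lambda>x. T x - l *\<^sub>C x) \<in> Kato Y"
    "\<And>l. cmod l < e \<Longrightarrow> ker Y T \<subseteq> ran Y (\<lambda>x. T x - l *\<^sub>C x)"
    "\<And>l v. cmod l < e \<Longrightarrow> v \<in> ran Y (\<lambda>x. T x - l *\<^sub>C x) \<Longrightarrow>
       \<exists>x\<in>Y. T x - l *\<^sub>C x = v \<and> norm x \<le> D * norm v"
proof -
  obtain C where C: "C > 0" "\<And>v. v \<in> ran Y T \<Longrightarrow> \<exists>x\<in>Y. T x = v \<and> norm x \<le> C * norm v"
    using ran_lift K by (auto simp: Kato_iff)
  obtain B where B: "B \<ge> 0" "\<And>x. norm (T x) \<le> B * norm x"
    using bounded_linear.nonneg_bounded[OF bl] by (auto simp: mult.commute)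
  \<comment> \<open>Residuals on \<open>core\<close> then shrink by the factor 1 / 2.\<close>
  define e where "e = 1 / (2 * C)"
  define D where "D = 4 * C + 2 * C * (3 + 4 * B * C)"
  have small: "cmod l * C \<le> 1 / 2" if "cmod l < e" for l
    using that C(1) by (simp add: e_def field_simps)
  have lift: "\<exists>x\<in>Y. T x - l *\<^sub>C x = v \<and> norm x \<le> D * norm v"
    if "cmod l < e" "v \<in> ran Y (\<lambda>x. T x - l *\<^sub>C x)" for l v
    unfolding D_def using that small B C K by (intro shift_lift) auto
  show thesis
  proof
    show "e > 0" "D > 0" using B C by (auto simp: e_def D_def intro!: add_pos_nonneg)
    fix l :: complex assume l: "cmod l < e"
    interpret Tl: operator_on "\<lambda>x. T x - l *\<^sub>C x" Y by (rule operator_on_diff)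
    have surj: "core \<subseteq> (\<lambda>x. T x - l *\<^sub>C x) ` core"
      using core_shift_lift[OF K C(2) small[OF l]] by blast
    have core: "core \<subseteq> ran Y ((\<lambda>x. T x - l *\<^sub>C x) ^^ n)" for n
    proof (induction n)
      case 0
      then show ?case using core_subset by (simp add: ran_def)
    next
      case (Suc n)
      then show ?case unfolding Tl.ran_Suc using surj by blast
    qed
    from core[of 1] show "ker Y T \<subseteq> ran Y (\<lambda>x. T x - l *\<^sub>C x)"
      using ker_subset_core[OF K] by auto
    have "ker Y (\<lambda>x. T x - l *\<^sub>C x) \<subseteq> core"
    proof (cases "l = 0")
      case True
      then show ?thesis using ker_subset_core[OF K] by simp
    next
      case False
      \<comment> \<open>An eigenvector x for nonzero l is the image of x / l, and so by induction it
        lies in the range of every power.\<close>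
      have "x \<in> ran Y (T ^^ n)" if x: "x \<in> Y" "T x = l *\<^sub>C x" for x n
      proof (induction n)
        case 0
        show ?case using x by (simp add: ran_def)
      next
        case (Suc n)
        then have "(1 / l) *\<^sub>C x \<in> ran Y (T ^^ n)"
          using operator_on.csubspace_ran[OF operator_on_funpow] complex_vector.subspace_scale by blast
        then have "T ((1 / l) *\<^sub>C x) \<in> ran Y (T ^^ Suc n)" unfolding ran_Suc by blast
        then show ?case using x False by (simp add: scaleC_scaleC scaleC_one del: funpow.simps)
      qed
      then show ?thesis by (auto simp: ker_def core_def)
    qed
    moreover have "closed (ran Y (\<lambda>x. T x - l *\<^sub>C x))"
      using lift[OF l] by (rule Tl.closed_ran_if_lift)
    ultimately show "(\<lambda>x. T x - l *\<^sub>C x) \<in> Kato Y"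
      using core by (auto simp: Tl.Kato_iff)
  qed (rule lift)
qed

end

section \<open>Constancy of nullity and defect\<close>

text \<open>At a point with infinite value the radius in \<open>ge\<close> may shrink with n, so no
  neighbourhood of constancy is immediate there. Connectedness still excludes that a finite value
  occurs elsewhere.\<close>

lemma enat_locally_constant:
  fixes g :: "'b::metric_space \<Rightarrow> enat"
  assumes U: "connected U" "open U"
    and ge: "\<And>x n. x \<in> U \<Longrightarrow> enat n \<le> g x \<Longrightarrow> \<exists>e>0. \<forall>y. dist y x < e \<longrightarrow> enat n \<le> g y"
    and le: "\<And>x n. x \<in> U \<Longrightarrow> g x \<le> enat n \<Longrightarrow> \<exists>e>0. \<forall>y. dist y x < e \<longrightarrow> g y \<le> enat n"
    and xy: "x \<in> U" "y \<in> U"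
  shows "g x = g y"
proof -
  have no_less: "\<not> g x < g y" if xy: "x \<in> U" "y \<in> U" for x y
  proof
    assume less: "g x < g y"
    then obtain n where n: "g x = enat n" by (cases "g x") auto
    \<comment> \<open>If n is the smaller of two values, then values up to n and values from n + 1
      on split \<open>U\<close> into two nonempty open sets.\<close>
    have dich: "g z \<le> enat n \<or> enat (Suc n) \<le> g z" for z
      by (cases "g z") auto
    define A where "A = {z \<in> U. g z \<le> enat n}"
    define B where "B = {z \<in> U. enat (Suc n) \<le> g z}"
    have "open A"
      unfolding open_dist
    proof
      fix z assume "z \<in> A"
      then obtain e1 e2 where "e1 > 0" "\<forall>y. dist y z < e1 \<longrightarrow> g y \<le> enat n" "e2 > 0" "\<forall>y. dist y z < e2 \<longrightarrow> y \<in> U"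
        using le U(2) unfolding A_def open_dist by blast
      then show "\<exists>e>0. \<forall>y. dist y z < e \<longrightarrow> y \<in> A"
        by (intro exI[of _ "min e1 e2"]) (auto simp: A_def)
    qed
    moreover have "open B"
      unfolding open_dist
    proof
      fix z assume "z \<in> B"
      then obtain e1 e2 where "e1 > 0" "\<forall>y. dist y z < e1 \<longrightarrow> enat (Suc n) \<le> g y" "e2 > 0" "\<forall>y. dist y z < e2 \<longrightarrow> y \<in> U"
        using ge U(2) unfolding B_def open_dist by blast
      then show "\<exists>e>0. \<forall>y. dist y z < e \<longrightarrow> y \<in> B"
        by (intro exI[of _ "min e1 e2"]) (auto simp: B_def)
    qed
    moreover have "A \<inter> B \<inter> U = {}"
      by (auto simp: A_def B_def) (metis Suc_n_not_le_n enat_ord_simps(1) order_trans)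
    moreover have "U \<subseteq> A \<union> B" using dich by (auto simp: A_def B_def)
    moreover have "x \<in> A \<inter> U" "y \<in> B \<inter> U"
      using n less xy by (auto simp: A_def B_def Suc_ile_eq)
    ultimately show False using connectedD[OF U(1), of A B] by blast
  qed
  show ?thesis using no_less[OF xy] no_less[OF xy(2,1)] by (simp add: not_less order_antisym)
qed

section \<open>Semicontinuity of nullity and defect under small shifts\<close>

context operator_on
begin

text \<open>A kernel vector b of T is corrected to a kernel vector b + u of T - l by solving (T - l)
  u = l b. This is possible since b lies in the range of T - l, and the uniform lifting constant
  makes u small.\<close>

lemma nullity_shift_ge:
  assumes K: "T \<in> Kato Y" and n: "enat n \<le> nullity Y T"
  shows "\<exists>e>0. \<forall>l. cmod l < e \<longrightarrow> enat n \<le> nullity Y (\<lambda>x. T x - l *\<^sub>C x)"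
proof -
  obtain e D where eD: "e > 0" "D > 0"
    and "\<And>l. cmod l < e \<Longrightarrow> (\<lambda>x. T x - l *\<^sub>C x) \<in> Kato Y"
    and eD': "\<And>l. cmod l < e \<Longrightarrow> ker Y T \<subseteq> ran Y (\<lambda>x. T x - l *\<^sub>C x)"
    "\<And>l v. cmod l < e \<Longrightarrow> v \<in> ran Y (\<lambda>x. T x - l *\<^sub>C x) \<Longrightarrow>
       \<exists>x\<in>Y. T x - l *\<^sub>C x = v \<and> norm x \<le> D * norm v"
    using Kato_shift[OF K] by blast
  obtain B where B: "B \<subseteq> ker Y T" "finite B" "\<not> cdependent B" "card B = n"
    using n unfolding nullity_def cdim_ge_iff by blast
  obtain d where d: "d > 0"
    "\<And>g. (\<And>b. b \<in> B \<Longrightarrow> norm (g b - b) \<le> d) \<Longrightarrow> inj_on g B \<and> \<not> cdependent (g ` B)"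
    using independent_perturbation[OF B(2,3)] by blast
  define s where "s = (\<Sum>b\<in>B. norm b) + 1"
  have s: "s > 0" "\<And>b. b \<in> B \<Longrightarrow> norm b \<le> s"
    using member_le_sum[of _ B norm] B(2) by (auto simp: s_def sum_nonneg add_nonneg_pos add_increasing2)
  \<comment> \<open>Bounds the corrections, of norm at most D * cmod l * s, by the tolerance d up to
    which independence persists.\<close>
  define e' where "e' = min e (d / (D * s))"
  have "e' > 0" using eD d s by (simp add: e'_def)
  moreover have "enat n \<le> nullity Y (\<lambda>x. T x - l *\<^sub>C x)" if l: "cmod l < e'" for l
  proof -
    interpret Tl: operator_on "\<lambda>x. T x - l *\<^sub>C x" Y by (rule operator_on_diff)
    have le: "cmod l < e" "cmod l * (D * s) \<le> d"
      using l eD(2) s(1) by (auto simp: e'_def field_simps)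
    have "\<exists>u\<in>Y. T u - l *\<^sub>C u = l *\<^sub>C b \<and> norm u \<le> d" if b: "b \<in> B" for b
    proof -
      have "l *\<^sub>C b \<in> ran Y (\<lambda>x. T x - l *\<^sub>C x)"
        using eD'(1)[OF le(1)] b B(1) complex_vector.subspace_scale[OF Tl.csubspace_ran] by blast
      then obtain u where u: "u \<in> Y" "T u - l *\<^sub>C u = l *\<^sub>C b" "norm u \<le> D * norm (l *\<^sub>C b)"
        using eD'(2)[OF le(1)] by blast
      have "D * norm (l *\<^sub>C b) = cmod l * (D * norm b)" by (simp add: norm_scaleC)
      also have "\<dots> \<le> cmod l * (D * s)" using s(2)[OF b] eD(2) by (intro mult_left_mono) auto
      finally show ?thesis using u le(2) by force
    qed
    then obtain u where u: "\<And>b. b \<in> B \<Longrightarrow> u b \<in> Y \<and> T (u b) - l *\<^sub>C u b = l *\<^sub>C b \<and> norm (u b) \<le> d"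
      by metis
    define g where "g b = b + u b" for b
    have g: "inj_on g B" "\<not> cdependent (g ` B)" using d(2)[of g] u by (auto simp: g_def)
    have "g b \<in> ker Y (\<lambda>x. T x - l *\<^sub>C x)" if "b \<in> B" for b
      using B(1) u[OF that] that Y_closed_ops(2)
      by (auto simp: g_def ker_def scaleC_add_right algebra_simps)
    then show ?thesis
      unfolding nullity_def cdim_ge_iff using g B(2,4) by (intro exI[of _ "g ` B"]) (auto simp: card_image)
  qed
  ultimately show ?thesis by blast
qed

text \<open>A projection \<open>Q\<close> onto the kernel of T is injective on the kernel of T - l.
  If T x = l x, Q x = 0 and u is a short lift of l x, then x - u is fixed by \<open>Q\<close>, so x
  = u - Q u has at most half its own norm.\<close>

lemma nullity_shift_le:
  assumes ran: "closed (ran Y T)" and n: "nullity Y T \<le> enat n"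
  shows "\<exists>e>0. \<forall>l. cmod l < e \<longrightarrow> nullity Y (\<lambda>x. T x - l *\<^sub>C x) \<le> enat n"
proof -
  obtain C where C: "C > 0" "\<And>v. v \<in> ran Y T \<Longrightarrow> \<exists>x\<in>Y. T x = v \<and> norm x \<le> C * norm v"
    using ran_lift[OF ran] by blast
  have "cdim (ker Y T) < \<infinity>"
    using n unfolding nullity_def using enat_ord_simps(4) order_le_less_trans by blast
  then obtain B where B: "finite B" "\<not> cdependent B" "ker Y T = cspan B" "cdim (ker Y T) = enat (card B)"
    using finite_cdim_basis[OF csubspace_ker] by metis
  have "csubspace ({0} :: 'a set)" "closed ({0} :: 'a set)" "cspan B \<inter> {0} = {0}"
    by (auto simp: complex_vector.subspace_single_0 complex_vector.span_zero)
  then obtain f where f: "\<And>b. b \<in> B \<Longrightarrow> cfunctional (f b)"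
    "\<And>b b'. b \<in> B \<Longrightarrow> b' \<in> B \<Longrightarrow> f b b' = (if b' = b then 1 else 0)"
    using dual_functionals[OF B(1,2)] by metis
  obtain K where K: "K > 0" "\<And>b x. b \<in> B \<Longrightarrow> norm (f b x) \<le> K * norm x"
    using functionals_bound[of B f] B(1) f(1) by blast
  \<comment> \<open>A bounded projection onto the kernel of T, built from the functionals dual to
    its basis \<open>B\<close>.\<close>
  define Q where "Q x = (\<Sum>b\<in>B. f b x *\<^sub>C b)" for x
  have Qadd: "Q (x - y) = Q x - Q y" for x y
    using f(1) by (simp add: Q_def cfunctional_props complex_vector.scale_left_diff_distrib sum_subtractf)
  have Qplus: "Q (x + y) = Q x + Q y" for x y
    using f(1) by (simp add: Q_def cfunctional_props scaleC_add_left sum.distrib)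
  have Qscale: "Q (c *\<^sub>C x) = c *\<^sub>C Q x" for c x
    using f(1) by (simp add: Q_def cfunctional_props complex_vector.scale_sum_right scaleC_scaleC)
  have Qid: "Q k = k" if "k \<in> ker Y T" for k
  proof -
    obtain c where "k = (\<Sum>b\<in>B. c b *\<^sub>C b)"
      using \<open>k \<in> ker Y T\<close> complex_vector.span_finite[OF B(1)] unfolding B(3) by blast
    moreover have "Q (\<Sum>b\<in>B. c b *\<^sub>C b) = (\<Sum>b\<in>B. c b *\<^sub>C b)"
      unfolding Q_def
    proof (rule sum.cong[OF refl])
      fix b assume b: "b \<in> B"
      have "f b (\<Sum>b'\<in>B. c b' *\<^sub>C b') = (\<Sum>b'\<in>B. c b' * f b b')"
        by (simp add: cfunctional_props(3,5)[OF f(1)[OF b]])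
      also have "\<dots> = c b"
        using b f(2)[OF b] B(1) by (simp add: if_distrib[of "(*) _"] sum.delta cong: if_cong)
      finally show "f b (\<Sum>b'\<in>B. c b' *\<^sub>C b') *\<^sub>C b = c b *\<^sub>C b" by simp
    qed
    ultimately show ?thesis by simp
  qed
  define q where "q = (\<Sum>b\<in>B. K * norm b)"
  have q: "q \<ge> 0" using K by (simp add: q_def sum_nonneg)
  have Qb: "norm (Q x) \<le> q * norm x" for x
  proof -
    have "norm (Q x) \<le> (\<Sum>b\<in>B. norm (f b x *\<^sub>C b))" unfolding Q_def by (rule norm_sum)
    also have "\<dots> \<le> (\<Sum>b\<in>B. K * norm x * norm b)"
      using K(2) by (intro sum_mono) (auto simp: norm_scaleC mult_right_mono)
    also have "\<dots> = q * norm x" by (simp add: q_def sum_distrib_right sum_distrib_left ac_simps)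
    finally show ?thesis .
  qed
  define e where "e = 1 / (2 * ((1 + q) * C))"
  have "e > 0" using q C(1) by (simp add: e_def)
  moreover have "nullity Y (\<lambda>x. T x - l *\<^sub>C x) \<le> enat n" if l: "cmod l < e" for l
  proof -
    interpret Tl: operator_on "\<lambda>x. T x - l *\<^sub>C x" Y by (rule operator_on_diff)
    let ?G = "ker Y (\<lambda>x. T x - l *\<^sub>C x)"
    have zero: "x = 0" if x: "x \<in> ?G" "Q x = 0" for x
    proof -
      have xY: "x \<in> Y" "T x = l *\<^sub>C x" using x by (auto simp: ker_def)
      then have "l *\<^sub>C x \<in> ran Y T" unfolding ran_def by (metis imageI)
      then obtain u where u: "u \<in> Y" "T u = l *\<^sub>C x" "norm u \<le> C * norm (l *\<^sub>C x)"
        using C(2) by blast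
      have "x - u \<in> ker Y T" using xY u Y_closed_ops by (simp add: ker_def)
      then have "Q x - Q u = x - u" using Qid Qadd by metis
      then have "x = u - Q u" using x(2) by (simp add: algebra_simps)
      then have "norm x \<le> norm u + norm (Q u)" using norm_triangle_ineq4 by metis
      also have "\<dots> \<le> (1 + q) * norm u" using Qb[of u] by (simp add: algebra_simps)
      also have "\<dots> \<le> (1 + q) * (C * norm (l *\<^sub>C x))" using u q by (intro mult_left_mono) auto
      also have "\<dots> = (cmod l * ((1 + q) * C)) * norm x" by (simp add: norm_scaleC)
      also have "\<dots> \<le> 1 / 2 * norm x"
      proof (rule mult_right_mono)
        have "(1 + q) * C > 0" using q C(1) by simp
        then show "cmod l * ((1 + q) * C) \<le> 1 / 2" using l by (simp add: e_def field_simps)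
      qed simp
      finally show ?thesis by simp
    qed
    have "\<not> enat (Suc n) \<le> cdim ?G"
    proof
      assume "enat (Suc n) \<le> cdim ?G"
      then obtain A where A: "A \<subseteq> ?G" "finite A" "\<not> cdependent A" "card A = Suc n"
        unfolding cdim_ge_iff by blast
      have AG: "cspan A \<subseteq> ?G" using A(1) Tl.csubspace_ker by (rule complex_vector.span_minimal)
      have injQ: "inj_on Q (cspan A)"
      proof (rule inj_onI)
        fix x y assume xy: "x \<in> cspan A" "y \<in> cspan A" "Q x = Q y"
        from complex_vector.span_diff[OF xy(1,2)] have "x - y \<in> ?G" by (rule subsetD[OF AG])
        moreover have "Q (x - y) = 0" using xy(3) by (simp only: Qadd) simp
        ultimately have "x - y = 0" by (rule zero)
        then show "x = y" by simp
      qed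
      have "\<not> cdependent (Q ` A)"
      proof
        assume "cdependent (Q ` A)"
        then obtain u where u: "\<exists>v\<in>Q ` A. u v \<noteq> 0" "(\<Sum>v\<in>Q ` A. u v *\<^sub>C v) = 0"
          using complex_vector.dependent_finite[of "Q ` A"] A(2) by auto
        have Qsum: "Q (sum h F) = (\<Sum>a\<in>F. Q (h a))" if "finite F" for h :: "'a \<Rightarrow> 'a" and F
          using that Qadd[of 0 0] by (induction F rule: finite_induct) (auto simp: Qplus)
        have iA: "inj_on Q A" using injQ complex_vector.span_superset by (rule inj_on_subset)
        have "Q (\<Sum>a\<in>A. u (Q a) *\<^sub>C a) = 0"
          using u(2) A(2) by (simp add: Qsum Qscale sum.reindex[OF iA] o_def)
        moreover have "(\<Sum>a\<in>A. u (Q a) *\<^sub>C a) \<in> ?G"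
          using AG by (intro subsetD[OF AG] complex_vector.span_sum complex_vector.span_scale complex_vector.span_base)
        ultimately have "(\<Sum>a\<in>A. u (Q a) *\<^sub>C a) = 0" using zero by blast
        then have "cdependent A"
          using complex_vector.dependent_finite[OF A(2)] u(1) by auto
        then show False using A(3) by blast
      qed
      moreover have "Q ` A \<subseteq> cspan B"
        unfolding Q_def
        by (intro image_subsetI complex_vector.span_sum complex_vector.span_scale complex_vector.span_base)
      ultimately have "card (Q ` A) \<le> card B"
        using complex_vector.independent_span_bound B(1) by blast
      moreover have "card (Q ` A) = Suc n"
        using card_image[OF inj_on_subset[OF injQ complex_vector.span_superset]] A(4) by simp
      ultimately show False using n B(4) by (simp add: nullity_def)
    qed
    then show ?thesis unfolding nullity_def not_enat_Suc_le_iff .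
  qed
  ultimately show ?thesis by blast
qed

text \<open>The set \<open>B\<close> that is independent modulo the range of T remains so for T - l.
  A vector w of its span that equals (T - l) y with norm y at most D * norm w has coefficients of
  order l, and this forces w = 0.\<close>

lemma defect_shift_ge:
  assumes K: "T \<in> Kato Y" and n: "enat n \<le> defect Y T"
  shows "\<exists>e>0. \<forall>l. cmod l < e \<longrightarrow> enat n \<le> defect Y (\<lambda>x. T x - l *\<^sub>C x)"
proof -
  obtain e D where eD: "e > 0" "D > 0"
    and "\<And>l. cmod l < e \<Longrightarrow> (\<lambda>x. T x - l *\<^sub>C x) \<in> Kato Y"
    and "\<And>l. cmod l < e \<Longrightarrow> ker Y T \<subseteq> ran Y (\<lambda>x. T x - l *\<^sub>C x)"
    and eD': "\<And>l v. cmod l < e \<Longrightarrow> v \<in> ran Y (\<lambda>x. T x - l *\<^sub>C x) \<Longrightarrow>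
       \<exists>x\<in>Y. T x - l *\<^sub>C x = v \<and> norm x \<le> D * norm v"
    using Kato_shift[OF K] by blast
  obtain B where B: "B \<subseteq> Y" "finite B" "\<not> cdependent B" "card B = n" "cspan B \<inter> ran Y T = {0}"
    using n unfolding defect_def codim_ge_iff[OF Y(1) csubspace_ran ran_subset] by blast
  have "closed (ran Y T)" using K by (simp add: Kato_iff)
  then obtain f where f: "\<And>b. b \<in> B \<Longrightarrow> cfunctional (f b)"
    "\<And>b z. b \<in> B \<Longrightarrow> z \<in> ran Y T \<Longrightarrow> f b z = 0"
    "\<And>b b'. b \<in> B \<Longrightarrow> b' \<in> B \<Longrightarrow> f b b' = (if b' = b then 1 else 0)"
    using dual_functionals[OF B(2,3) csubspace_ran _ B(5)] by metis
  obtain M where M: "M > 0" "\<And>b x. b \<in> B \<Longrightarrow> norm (f b x) \<le> M * norm x"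
    using functionals_bound[of B f] B(2) f(1) by blast
  define s where "s = (\<Sum>b\<in>B. norm b) + 1"
  have s: "s > 0" by (auto simp: s_def sum_nonneg add_nonneg_pos)
  \<comment> \<open>Makes norm w at most half of itself in the estimate below.\<close>
  define e' where "e' = min e (1 / (2 * (M * D * s)))"
  have "e' > 0" using eD M s by (simp add: e'_def)
  moreover have "enat n \<le> defect Y (\<lambda>x. T x - l *\<^sub>C x)" if l: "cmod l < e'" for l
  proof -
    interpret Tl: operator_on "\<lambda>x. T x - l *\<^sub>C x" Y by (rule operator_on_diff)
    have pos: "M * D * s > 0" using M eD s by simp
    have le: "cmod l < e" "cmod l * (M * D * s) \<le> 1 / 2"
      using l pos by (auto simp: e'_def field_simps)
    have "w = 0" if w: "w \<in> cspan B" "w \<in> ran Y (\<lambda>x. T x - l *\<^sub>C x)" for w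
    proof -
      obtain c where c: "w = (\<Sum>b\<in>B. c b *\<^sub>C b)"
        using w(1) complex_vector.span_finite[OF B(2)] by blast
      obtain y where y: "y \<in> Y" "T y - l *\<^sub>C y = w" "norm y \<le> D * norm w"
        using eD'[OF le(1) w(2)] by blast
      have cb: "cmod (c b) \<le> cmod l * M * D * norm w" if b: "b \<in> B" for b
      proof -
        have "f b w = (\<Sum>b'\<in>B. c b' * f b b')"
          unfolding c by (simp add: cfunctional_props(3,5)[OF f(1)[OF b]])
        also have "\<dots> = c b"
          using b f(3)[OF b] B(2) by (simp add: if_distrib[of "(*) _"] sum.delta cong: if_cong)
        finally have "c b = f b (T y - l *\<^sub>C y)" using y(2) by simp
        \<comment> \<open>The functional vanishes on the range of T, so only the shift
          contributes.\<close>
        also have "\<dots> = - (l * f b y)"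
          using f(2)[OF b, of "T y"] y(1) by (simp add: cfunctional_props(2,3)[OF f(1)[OF b]] ran_def)
        finally have "cmod (c b) = cmod l * cmod (f b y)" by (simp add: norm_mult)
        also have "\<dots> \<le> cmod l * (M * (D * norm w))"
        proof (rule mult_left_mono[OF order_trans[OF M(2)[OF b]]])
          show "M * norm y \<le> M * (D * norm w)" using y(3) M(1) by (intro mult_left_mono) auto
        qed simp
        finally show ?thesis by (simp add: mult.assoc)
      qed
      have "norm w \<le> (\<Sum>b\<in>B. cmod (c b) * norm b)"
        unfolding c using norm_sum[of "\<lambda>b. c b *\<^sub>C b" B] by (simp add: norm_scaleC)
      also have "\<dots> \<le> (\<Sum>b\<in>B. cmod l * M * D * norm w * norm b)"
        using cb by (intro sum_mono mult_right_mono) auto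
      also have "\<dots> = cmod l * M * D * norm w * (s - 1)" by (simp add: s_def sum_distrib_left)
      also have "\<dots> \<le> cmod l * M * D * norm w * s"
        using M(1) eD(2) by (intro mult_left_mono) auto
      also have "\<dots> = cmod l * (M * D * s) * norm w" by simp
      also have "\<dots> \<le> 1 / 2 * norm w" using le(2) by (rule mult_right_mono) simp
      finally show ?thesis by simp
    qed
    then have "cspan B \<inter> ran Y (\<lambda>x. T x - l *\<^sub>C x) = {0}"
      using complex_vector.span_zero complex_vector.subspace_0[OF Tl.csubspace_ran] by blast
    then show ?thesis
      unfolding defect_def codim_ge_iff[OF Y(1) Tl.csubspace_ran Tl.ran_subset] using B by blast
  qed
  ultimately show ?thesis by blast
qed

text \<open>(x, b) |-> T x + b maps Y times the span of \<open>B\<close> onto \<open>Y\<close>. By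
  \<open>approx_lift\<close> this survives replacing T by T - l, so the same \<open>B\<close>
  completes the new range.\<close>

lemma defect_shift_le:
  assumes n: "defect Y T \<le> enat n"
  shows "\<exists>e>0. \<forall>l. cmod l < e \<longrightarrow> defect Y (\<lambda>x. T x - l *\<^sub>C x) \<le> enat n"
proof -
  obtain B where B: "B \<subseteq> Y" "finite B" "card B \<le> n" "Y \<subseteq> cspan (ran Y T \<union> B)"
    using n unfolding defect_def codim_le_iff[OF Y(1) csubspace_ran ran_subset] by blast
  have BY: "cspan B \<subseteq> Y" using B(1) Y(1) by (rule complex_vector.span_minimal)
  define F where "F l p = T (fst p) - l *\<^sub>C fst p + snd p" for l and p :: "'a \<times> 'a"
  have F: "bounded_linear (F l)" for l
  proof -
    interpret Tl: operator_on "\<lambda>x. T x - l *\<^sub>C x" Y by (rule operator_on_diff)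
    show ?thesis
      unfolding F_def
      by (intro bounded_linear_add bounded_linear_compose[OF Tl.bl] bounded_linear_fst bounded_linear_snd)
  qed
  have sub: "subspace (Y \<times> cspan B)" "closed (Y \<times> cspan B)"
    using subspace_Y csubspace_imp_subspace[OF complex_vector.subspace_span] closed_cspan_finite[OF B(2)] Y(2)
    by (auto intro: subspace_Times closed_Times)
  have FY: "F l ` (Y \<times> cspan B) \<subseteq> Y" for l
    using BY Y_closed_ops by (auto simp: F_def)
  have F0: "F 0 ` (Y \<times> cspan B) = Y"
  proof
    show "Y \<subseteq> F 0 ` (Y \<times> cspan B)"
    proof
      fix y assume "y \<in> Y"
      then obtain x b where "x \<in> Y" "b \<in> cspan B" "y = T x + b"
        using B(4) unfolding cspan_Un_csubspace[OF csubspace_ran] by (auto simp: ran_def)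
      then show "y \<in> F 0 ` (Y \<times> cspan B)" by (intro image_eqI[of _ _ "(x, b)"]) (auto simp: F_def)
    qed
  qed (rule FY)
  have "closed (F 0 ` (Y \<times> cspan B))" unfolding F0 by (rule Y(2))
  then obtain C where C: "C > 0" "\<And>v. v \<in> Y \<Longrightarrow> \<exists>p\<in>Y \<times> cspan B. F 0 p = v \<and> norm p \<le> C * norm v"
    using open_mapping_lift[OF F sub, of 0] unfolding F0 by blast
  have "defect Y (\<lambda>x. T x - l *\<^sub>C x) \<le> enat n" if l: "cmod l < 1 / (2 * C)" for l
  proof -
    interpret Tl: operator_on "\<lambda>x. T x - l *\<^sub>C x" Y by (rule operator_on_diff)
    have "\<exists>p\<in>Y \<times> cspan B. F l p = v \<and> norm p \<le> C / (1 - 1 / 2) * norm v" if v: "v \<in> Y" for v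
    proof (rule approx_lift[OF F sub, where V = Y])
      fix v assume v: "v \<in> Y"
      obtain p where p: "p \<in> Y \<times> cspan B" "F 0 p = v" "norm p \<le> C * norm v" using C(2)[OF v] by blast
      have "norm (v - F l p) = cmod l * norm (fst p)"
        using p(2) by (auto simp: F_def norm_scaleC)
      also have "\<dots> \<le> cmod l * (C * norm v)"
        using p(3) norm_fst_le[of "fst p" "snd p"] by (intro mult_left_mono) auto
      also have "\<dots> = (cmod l * C) * norm v" by simp
      also have "\<dots> \<le> 1 / 2 * norm v"
        using l C(1) by (intro mult_right_mono) (auto simp: field_simps)
      finally show "\<exists>p\<in>Y \<times> cspan B. norm p \<le> C * norm v \<and> v - F l p \<in> Y \<and> norm (v - F l p) \<le> 1 / 2 * norm v"
        using p FY v Y_closed_ops(3) by (intro bexI[of _ p]) auto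
    qed (use v in auto)
    then have "Y \<subseteq> cspan (ran Y (\<lambda>x. T x - l *\<^sub>C x) \<union> B)"
      unfolding cspan_Un_csubspace[OF Tl.csubspace_ran] by (fastforce simp: F_def ran_def)
    then show ?thesis
      unfolding defect_def codim_le_iff[OF Y(1) Tl.csubspace_ran Tl.ran_subset] using B by blast
  qed
  then show ?thesis using C(1) by (intro exI[of _ "1 / (2 * C)"]) auto
qed

theorem Kato_shift_constant:
  assumes K: "T \<in> Kato Y"
  obtains e where "e > 0"
    "\<And>l. cmod l < e \<Longrightarrow> (\<lambda>x. T x - l *\<^sub>C x) \<in> Kato Y"
    "\<And>l. cmod l < e \<Longrightarrow> nullity Y (\<lambda>x. T x - l *\<^sub>C x) = nullity Y T"
    "\<And>l. cmod l < e \<Longrightarrow> defect Y (\<lambda>x. T x - l *\<^sub>C x) = defect Y T"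
proof -
  obtain e where e: "e > 0" "\<And>l. cmod l < e \<Longrightarrow> (\<lambda>x. T x - l *\<^sub>C x) \<in> Kato Y"
    using Kato_shift[OF K] by metis
  \<comment> \<open>Semicontinuity is known at T for shifts near 0. Applied to T - l, which is Kato
    too, it is rewritten here as a statement about shifts of T near l.\<close>
  have shift: "\<exists>d>0. \<forall>m. dist m l < d \<longrightarrow> P (\<lambda>x. T x - m *\<^sub>C x)"
    if "\<exists>d>0. \<forall>m. cmod m < d \<longrightarrow> P (\<lambda>x. T x - l *\<^sub>C x - m *\<^sub>C x)" for l :: complex and P
  proof -
    obtain d where d: "d > 0" "\<And>m. cmod m < d \<Longrightarrow> P (\<lambda>x. T x - l *\<^sub>C x - m *\<^sub>C x)"
      using \<open>\<exists>d>0. _ d\<close> by blast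
    have "(\<lambda>x. T x - l *\<^sub>C x - (m - l) *\<^sub>C x) = (\<lambda>x. T x - m *\<^sub>C x)" for m
      by (simp add: complex_vector.scale_left_diff_distrib)
    then have "P (\<lambda>x. T x - m *\<^sub>C x)" if "dist m l < d" for m
      using d(2)[of "m - l"] that by (simp add: dist_norm)
    then show ?thesis using d(1) by blast
  qed
  have nul: "nullity Y (\<lambda>x. T x - l *\<^sub>C x) = nullity Y (\<lambda>x. T x - 0 *\<^sub>C x)" if l: "cmod l < e" for l
  proof (rule enat_locally_constant[of "ball 0 e" "\<lambda>l. nullity Y (\<lambda>x. T x - l *\<^sub>C x)"])
    fix m :: complex and n assume m: "m \<in> ball 0 e"
    interpret Tm: operator_on "\<lambda>x. T x - m *\<^sub>C x" Y by (rule operator_on_diff)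
    have Km: "(\<lambda>x. T x - m *\<^sub>C x) \<in> Kato Y" using e(2) m by simp
    show "\<exists>e>0. \<forall>y. dist y m < e \<longrightarrow> enat n \<le> nullity Y (\<lambda>x. T x - y *\<^sub>C x)"
      if "enat n \<le> nullity Y (\<lambda>x. T x - m *\<^sub>C x)"
      by (rule shift[where l = m and P = "\<lambda>S. enat n \<le> nullity Y S"]) (rule Tm.nullity_shift_ge[OF Km that])
    show "\<exists>e>0. \<forall>y. dist y m < e \<longrightarrow> nullity Y (\<lambda>x. T x - y *\<^sub>C x) \<le> enat n"
      if "nullity Y (\<lambda>x. T x - m *\<^sub>C x) \<le> enat n"
      by (rule shift[where l = m and P = "\<lambda>S. nullity Y S \<le> enat n"]) (use Tm.nullity_shift_le[OF _ that] Km Tm.Kato_iff in blast)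
  qed (use l e(1) in auto)
  have def: "defect Y (\<lambda>x. T x - l *\<^sub>C x) = defect Y (\<lambda>x. T x - 0 *\<^sub>C x)" if l: "cmod l < e" for l
  proof (rule enat_locally_constant[of "ball 0 e" "\<lambda>l. defect Y (\<lambda>x. T x - l *\<^sub>C x)"])
    fix m :: complex and n assume m: "m \<in> ball 0 e"
    interpret Tm: operator_on "\<lambda>x. T x - m *\<^sub>C x" Y by (rule operator_on_diff)
    have Km: "(\<lambda>x. T x - m *\<^sub>C x) \<in> Kato Y" using e(2) m by simp
    show "\<exists>e>0. \<forall>y. dist y m < e \<longrightarrow> enat n \<le> defect Y (\<lambda>x. T x - y *\<^sub>C x)"
      if "enat n \<le> defect Y (\<lambda>x. T x - m *\<^sub>C x)"
      by (rule shift[where l = m and P = "\<lambda>S. enat n \<le> defect Y S"]) (rule Tm.defect_shift_ge[OF Km that])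
    show "\<exists>e>0. \<forall>y. dist y m < e \<longrightarrow> defect Y (\<lambda>x. T x - y *\<^sub>C x) \<le> enat n"
      if "defect Y (\<lambda>x. T x - m *\<^sub>C x) \<le> enat n"
      by (rule shift[where l = m and P = "\<lambda>S. defect Y S \<le> enat n"]) (rule Tm.defect_shift_le[OF that])
  qed (use l e(1) in auto)
  show thesis using that[OF e] nul def by simp
qed

end

section \<open>Reductions and splitting off nilpotent parts\<close>

lemma class_index_cases:
  fixes i :: nat
  shows "1 \<le> i \<Longrightarrow> i \<le> 12 \<Longrightarrow> i \<in> {1, 2, 3, 4, 5, 6, 7, 8, 9, 10, 11, 12}"
  unfolding insert_iff empty_iff by presburger

text \<open>Every class is determined by closedness of the range, nullity, defect and the finiteness
  of ascent and descent. The two spaces may differ, so this serves shifts on one space as well as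
  the passage to a summand.\<close>

lemma Rclass_cong:
  assumes T: "operator_on T Y" and S: "operator_on S Z" and i: "1 \<le> i" "i \<le> 12"
    and eqs: "closed (ran Y T) \<longleftrightarrow> closed (ran Z S)" "nullity Y T = nullity Z S" "defect Y T = defect Z S"
      "ascent Y T < \<infinity> \<longleftrightarrow> ascent Z S < \<infinity>" "descent Y T < \<infinity> \<longleftrightarrow> descent Z S < \<infinity>"
  shows "T \<in> Rclass i Y \<longleftrightarrow> S \<in> Rclass i Z"
proof -
  have "i \<in> {1, 2, 3, 4, 5, 6, 7, 8, 9, 10, 11, 12}" using i by (rule class_index_cases)
  then show ?thesis
    using eqs operator_on.in_L[OF T] operator_on.in_L[OF S]
    by (elim insertE emptyE)
      (simp_all add: Rclass_def Phi_plus_def Phi_minus_def Phi_def W_plus_def W_minus_def Weyl_def B_plus_def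
        B_minus_def Browder_def ind_def operator_on.bounded_below_iff[OF T] operator_on.bounded_below_iff[OF S]
        operator_on.surjective_ops_iff[OF T] operator_on.surjective_ops_iff[OF S]
        operator_on.invertible_ops_iff[OF T] operator_on.invertible_ops_iff[OF S])
qed

text \<open>Nullity or defect is finite. This gives closed ranges of all powers and a quantity on
  which an induction can run.\<close>

lemma (in operator_on) Rclass_semi_Fredholm:
  assumes i: "1 \<le> i" "i \<le> 12" and R: "T \<in> Rclass i Y"
  shows "closed (ran Y T) \<and> nullity Y T < \<infinity> \<or> defect Y T < \<infinity>"
proof -
  have "i \<in> {1, 2, 3, 4, 5, 6, 7, 8, 9, 10, 11, 12}" using i by (rule class_index_cases)
  then show ?thesis
    using R
    by (elim insertE emptyE)
      (simp_all add: Rclass_def Phi_plus_def Phi_minus_def Phi_def W_plus_def W_minus_def Weyl_def B_plus_def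
        B_minus_def Browder_def bounded_below_iff surjective_ops_iff invertible_ops_iff)
qed

section \<open>Operators that respect a direct sum\<close>

locale reduction =
  operator_on T Y + M: operator_on T M + N: operator_on T N
  for T :: "'a::complex_banach \<Rightarrow> 'a" and Y M N :: "'a set" +
  assumes sum: "direct_sum Y M N"
begin

lemmas sumD = direct_sumD[OF sum]

lemma reduction_funpow: "reduction (T ^^ n) Y M N"
  using operator_on_funpow M.operator_on_funpow N.operator_on_funpow sum
  by (auto intro!: reduction.intro reduction_axioms.intro)

lemma ran_iff: "x \<in> ran Y T \<longleftrightarrow> (\<exists>m\<in>ran M T. \<exists>n\<in>ran N T. x = m + n)"
proof
  assume "x \<in> ran Y T"
  then obtain y where y: "y \<in> Y" "x = T y" by (auto simp: ran_def)
  then obtain m n where "m \<in> M" "n \<in> N" "y = m + n" using sumD(5) by blast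
  then show "\<exists>m\<in>ran M T. \<exists>n\<in>ran N T. x = m + n" using y by (auto simp: ran_def)
next
  assume "\<exists>m\<in>ran M T. \<exists>n\<in>ran N T. x = m + n"
  then obtain m n where "m \<in> M" "n \<in> N" "x = T (m + n)" by (auto simp: ran_def)
  then show "x \<in> ran Y T" using sumD(4) unfolding ran_def by (intro image_eqI[of _ _ "m + n"])
qed

lemma ran_Int: "ran Y T \<inter> M = ran M T"
proof
  show "ran M T \<subseteq> ran Y T \<inter> M" using M.ran_subset sumD(6) by (auto simp: ran_def)
  show "ran Y T \<inter> M \<subseteq> ran M T"
  proof
    fix x assume x: "x \<in> ran Y T \<inter> M"
    then obtain m n where mn: "m \<in> ran M T" "n \<in> ran N T" "x = m + n" using ran_iff by blast
    then have "m \<in> M" "n \<in> N" using M.ran_subset N.ran_subset by auto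
    have "x = m"
      by (rule direct_sum_unique(1)[OF sum _ \<open>m \<in> M\<close> N.Y_closed_ops(1) \<open>n \<in> N\<close>]) (use x mn in auto)
    then show "x \<in> ran M T" using mn by simp
  qed
qed

lemma ker_Int: "ker Y T \<inter> M = ker M T"
  using sumD(6) by (auto simp: ker_def)

lemma closed_ran_part: "closed (ran Y T) \<Longrightarrow> closed (ran M T)"
  unfolding ran_Int[symmetric] using M.Y(2) by (rule closed_Int[rotated])

lemma ascent_part:
  assumes "ascent Y T < \<infinity>"
  shows "ascent M T < \<infinity>"
proof -
  obtain n where "ker Y (T ^^ n) = ker Y (T ^^ (n + 1))" using assms unfolding ascent_finite_iff by blast
  then have "ker M (T ^^ n) = ker M (T ^^ (n + 1))"
    using reduction.ker_Int[OF reduction_funpow] by metis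
  then show ?thesis unfolding ascent_finite_iff by blast
qed

lemma descent_part:
  assumes "descent Y T < \<infinity>"
  shows "descent M T < \<infinity>"
proof -
  obtain n where "ran Y (T ^^ n) = ran Y (T ^^ (n + 1))" using assms unfolding descent_finite_iff by blast
  then have "ran M (T ^^ n) = ran M (T ^^ (n + 1))"
    using reduction.ran_Int[OF reduction_funpow] by metis
  then show ?thesis unfolding descent_finite_iff by blast
qed

text \<open>Nullity and defect change by the same amount, so the index is kept, while closed range
  and finite ascent or descent pass to summands. For the last three classes the assumption on the
  line contradicts a nullity or defect of zero.\<close>

lemma Rclass_part:
  assumes i: "1 \<le> i" "i \<le> 12" and R: "T \<in> Rclass i Y"
    and line: "nullity Y T = nullity M T + 1" "defect Y T = defect M T + 1"
  shows "T \<in> Rclass i M"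
proof -
  have ind: "ind Y T = ind M T"
    unfolding ind_def line by (cases "nullity M T"; cases "defect M T") (auto simp: one_enat_def)
  have lt: "d + 1 < \<infinity> \<longleftrightarrow> d < \<infinity>" for d :: enat
    by (cases d) (auto simp: one_enat_def)
  have "i \<in> {1, 2, 3, 4, 5, 6, 7, 8, 9, 10, 11, 12}" using i by (rule class_index_cases)
  then show ?thesis
    using R closed_ran_part ascent_part descent_part M.in_L ind lt[of "nullity M T"] lt[of "defect M T"]
    by (elim insertE emptyE)
      (simp_all add: Rclass_def Phi_plus_def Phi_minus_def Phi_def W_plus_def W_minus_def Weyl_def B_plus_def
        B_minus_def Browder_def bounded_below_iff surjective_ops_iff invertible_ops_iff line)
qed

text \<open>Ascent and descent involve all powers, so bijectivity on \<open>N\<close> is needed for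
  each of them.\<close>

lemma funpow_bij_part:
  assumes "ker N T = {0}" "ran N T = N"
  shows "ker N (T ^^ n) = {0} \<and> ran N (T ^^ n) = N"
proof (induction n)
  case 0
  show ?case using N.Y_closed_ops(1) by (auto simp: ker_def ran_def)
next
  case (Suc n)
  interpret Tn: operator_on "T ^^ n" N by (rule N.operator_on_funpow)
  have "x = 0" if "x \<in> N" "T ((T ^^ n) x) = 0" for x
  proof -
    have "(T ^^ n) x \<in> ker N T" using that Tn.Y_closed_ops(5) by (simp add: ker_def)
    then have "(T ^^ n) x = 0" using assms(1) by blast
    then have "x \<in> ker N (T ^^ n)" using that by (simp add: ker_def)
    then show ?thesis using Suc by blast
  qed
  then have "ker N (T ^^ Suc n) = {0}"
    using N.Y_closed_ops(1) Tn.T_simps(4) N.T_simps(4) by (auto simp: ker_def)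
  moreover have "ran N (T ^^ Suc n) = N"
    unfolding N.ran_Suc using Suc assms(2) by (simp add: ran_def)
  ultimately show ?case by blast
qed

lemma ker_bij_part: "ker N T = {0} \<Longrightarrow> ker Y T = ker M T"
proof
  assume k: "ker N T = {0}"
  show "ker Y T \<subseteq> ker M T"
  proof
    fix x assume x: "x \<in> ker Y T"
    then obtain m n where mn: "m \<in> M" "n \<in> N" "x = m + n" using sumD(5) ker_subset by blast
    have eq: "T m + T n = 0 + 0" using x mn by (simp add: ker_def)
    have "T n = 0"
      using direct_sum_unique(2)[OF sum _ _ _ _ eq] mn(1,2) M.Y_closed_ops(1,5) N.Y_closed_ops(1,5) by blast
    then have "n \<in> ker N T" using mn by (simp add: ker_def)
    then have "x = m" using k mn by simp
    then show "x \<in> ker M T" using x mn by (simp add: ker_def)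
  qed
qed (use sumD(6) in \<open>auto simp: ker_def\<close>)

text \<open>As all of \<open>N\<close> lies in the range, a complement of the range within
  \<open>M\<close> is already one within \<open>Y\<close>.\<close>

lemma defect_bij_part:
  assumes "ran N T = N"
  shows "defect Y T = defect M T"
proof -
  obtain W where W: "direct_sum M (ran M T) W"
    using complement_exists[OF M.Y(1) M.csubspace_ran M.ran_subset] by blast
  have "direct_sum Y (ran Y T) W"
  proof (rule direct_sumI[OF csubspace_ran direct_sumD(2)[OF W]])
    fix x assume "x \<in> ran Y T" "x \<in> W"
    then have "x \<in> ran M T" using direct_sumD(7)[OF W] ran_Int by blast
    then show "x = 0" using \<open>x \<in> W\<close> direct_sumD(3)[OF W] by blast
  next
    fix m n assume "m \<in> ran Y T" "n \<in> W"
    then show "m + n \<in> Y" using ran_subset direct_sumD(7)[OF W] sumD(6) Y_closed_ops(2) by blast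
  next
    fix y assume "y \<in> Y"
    then obtain m n where mn: "m \<in> M" "n \<in> N" "y = m + n" using sumD(5) by blast
    then obtain r w where rw: "r \<in> ran M T" "w \<in> W" "m = r + w" using direct_sumD(5)[OF W] by blast
    have "r + n \<in> ran Y T" using rw mn assms ran_iff by blast
    moreover have "y = (r + n) + w" using mn rw by (simp add: algebra_simps)
    ultimately show "\<exists>m\<in>ran Y T. \<exists>n\<in>W. y = m + n" using rw by blast
  qed
  then show ?thesis
    unfolding defect_def using codim_eq_cdim_complement[OF W] codim_eq_cdim_complement by metis
qed

end

lemma reductionI:
  assumes T: "T \<in> L UNIV" and MN: "(M, N) \<in> Red T"
  shows "reduction T UNIV M N"
  using assms direct_sumD(1,2)[of UNIV M N]
  by unfold_locales (auto simp: Red_def)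

text \<open>A summand on which T is bijective contributes nothing to any of the five
  invariants.\<close>

lemma Rclass_bij_part:
  assumes T: "T \<in> L UNIV" and MN: "(M, N) \<in> Red T"
    and bij: "ker N T = {0}" "ran N T = N" and i: "1 \<le> i" "i \<le> 12"
  shows "T \<in> Rclass i UNIV \<longleftrightarrow> T \<in> Rclass i M"
proof -
  interpret reduction T UNIV M N using T MN by (rule reductionI)
  interpret Tn: reduction "T ^^ n" UNIV M N for n by (rule reduction_funpow)
  have kerN: "ker N (T ^^ n) = {0}" and ranN: "ran N (T ^^ n) = N" for n
    using funpow_bij_part[OF bij, of n] by simp_all
  have ranU: "x \<in> ran UNIV (T ^^ n) \<longleftrightarrow> (\<exists>m\<in>ran M (T ^^ n). \<exists>k\<in>N. x = m + k)" for x n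
    unfolding Tn.ran_iff ranN by (rule refl)
  have closed: "closed (ran UNIV T)" if cl: "closed (ran M T)"
  proof -
    obtain P where P: "P \<in> L UNIV" "\<And>x. x \<in> M \<Longrightarrow> P x = 0" "\<And>x. x \<in> N \<Longrightarrow> P x = x"
        "\<And>x. P x \<in> N" "\<And>x. x - P x \<in> M"
      using closed_direct_sum_projection[OF sum M.Y(2) N.Y(2)] by blast
    have blP: "bounded_linear P" using P(1) by (simp add: L_UNIV_iff)
    \<comment> \<open>Presents the range as the preimage of the closed set T(M) under the bounded
      projection onto \<open>M\<close> along \<open>N\<close>.\<close>
    have "x \<in> ran UNIV T \<longleftrightarrow> x - P x \<in> ran M T" for x
    proof
      assume "x \<in> ran UNIV T"
      then obtain m k where mk: "m \<in> ran M T" "k \<in> N" "x = m + k" using ranU[of x 1] by auto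
      then have "P x = k"
        using P(2)[of m] P(3)[of k] M.ran_subset bounded_linear.linear[OF blP] by (auto simp: linear_add)
      then show "x - P x \<in> ran M T" using mk by simp
    next
      assume mem: "x - P x \<in> ran M T"
      have "x = (x - P x) + P x" by simp
      with mem P(4)[of x] have "\<exists>m\<in>ran M T. \<exists>k\<in>N. x = m + k" by blast
      then show "x \<in> ran UNIV T" using ranU[of x 1] by simp
    qed
    then have "ran UNIV T = (\<lambda>x. x - P x) -` ran M T" by auto
    moreover have "continuous_on UNIV (\<lambda>x. x - P x)"
      using blP by (intro continuous_intros linear_continuous_on)
    ultimately show ?thesis using closed_vimage[OF cl] by simp
  qed
  have asc: "ascent UNIV T < \<infinity> \<longleftrightarrow> ascent M T < \<infinity>"
  proof -
    have "ker UNIV (T ^^ n) = ker M (T ^^ n)" for n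
      using kerN by (rule Tn.ker_bij_part)
    then show ?thesis unfolding ascent_finite_iff by (simp only:)
  qed
  have desc: "descent UNIV T < \<infinity>" if "descent M T < \<infinity>"
  proof -
    obtain n where "ran M (T ^^ n) = ran M (T ^^ (n + 1))" using \<open>descent M T < \<infinity>\<close> unfolding descent_finite_iff by blast
    then have "x \<in> ran UNIV (T ^^ n) \<longleftrightarrow> x \<in> ran UNIV (T ^^ (n + 1))" for x
      unfolding ranU by simp
    then have "ran UNIV (T ^^ n) = ran UNIV (T ^^ (n + 1))" by blast
    then show ?thesis unfolding descent_finite_iff by blast
  qed
  show ?thesis
  proof (rule Rclass_cong[OF operator_on_axioms M.operator_on_axioms i])
    show "closed (ran UNIV T) \<longleftrightarrow> closed (ran M T)" using closed closed_ran_part by blast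
    show "nullity UNIV T = nullity M T" unfolding nullity_def using ker_bij_part bij by simp
    show "defect UNIV T = defect M T" using defect_bij_part bij by simp
    show "ascent UNIV T < \<infinity> \<longleftrightarrow> ascent M T < \<infinity>" by (rule asc)
    show "descent UNIV T < \<infinity> \<longleftrightarrow> descent M T < \<infinity>" using desc descent_part by blast
  qed
qed

section \<open>Nilpotent summands: invertible shifts, and splitting one off\<close>

context operator_on
begin

text \<open>The shift is added so that one lemma serves T - l with z = - l and T + P with z = 1.
  Injectivity holds because an eigenvector for - z is multiplied by (- z)^n under T^n; surjectivity
  is an induction on the power that kills x.\<close>

lemma nilpotent_shift_bij:
  assumes nil: "nilpotent_on Y T" and z: "z \<noteq> 0"
  shows "ker Y (\<lambda>x. T x + z *\<^sub>C x) = {0}" "ran Y (\<lambda>x. T x + z *\<^sub>C x) = Y"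
proof -
  interpret Tz: operator_on "\<lambda>x. T x + z *\<^sub>C x" Y by (rule operator_on_shift)
  obtain n where n: "\<And>x. x \<in> Y \<Longrightarrow> (T ^^ n) x = 0" using nil by (auto simp: nilpotent_on_def)
  have "x = 0" if x: "x \<in> Y" "T x + z *\<^sub>C x = 0" for x
  proof -
    have Tx: "T x = (- z) *\<^sub>C x" using x by (simp add: eq_neg_iff_add_eq_0)
    have "(T ^^ k) x = (- z) ^ k *\<^sub>C x" for k
      by (induction k) (simp_all add: scaleC_one Tx scaleC_scaleC mult.commute)
    then have "(- z) ^ n *\<^sub>C x = 0" using n[OF x(1)] by simp
    then show ?thesis using z by simp
  qed
  then show "ker Y (\<lambda>x. T x + z *\<^sub>C x) = {0}"
    using Tz.Y_closed_ops(1) by (auto simp: ker_def)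
  have "x \<in> ran Y (\<lambda>x. T x + z *\<^sub>C x)" if "x \<in> Y" "(T ^^ k) x = 0" for x k
    using that
  proof (induction k arbitrary: x)
    case 0
    then show ?case using complex_vector.subspace_0[OF Tz.csubspace_ran] by simp
  next
    case (Suc k)
    have "(T ^^ k) (T x) = 0" using Suc.prems(2) by (simp add: funpow_swap1)
    then obtain u where u: "u \<in> Y" "T x = T u + z *\<^sub>C u"
      using Suc.IH[of "T x"] Suc.prems(1) Y_closed_ops(5) by (auto simp: ran_def)
    \<comment> \<open>By induction T x = (T + z) u. Then T (x - u) = z u, so T + z maps (x - u) / z
      to u + (x - u) = x.\<close>
    let ?v = "(1 / z) *\<^sub>C (x - u)"
    have "T ?v + z *\<^sub>C ?v = (1 / z) *\<^sub>C (T x - T u) + (x - u)"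
      using z by (simp add: scaleC_scaleC scaleC_one)
    also have "\<dots> = x" using u z by (simp add: scaleC_scaleC scaleC_one)
    finally have "x = T ?v + z *\<^sub>C ?v" ..
    moreover have "?v \<in> Y" using u Suc.prems(1) Y_closed_ops by blast
    ultimately show ?case unfolding ran_def by (rule image_eqI)
  qed
  then show "ran Y (\<lambda>x. T x + z *\<^sub>C x) = Y" using n Tz.ran_subset by blast
qed

text \<open>The numbers f (T^(i+j) y) are 1 for i + j = k and 0 for i + j > k. This triangular
  pattern lets the conditions f (T^i u) = 0 determine vectors of \<open>N\<close> uniquely and be
  met by subtracting a vector of \<open>N\<close>, which gives the direct sum. Passing to
  \<open>M\<close>, the kernel loses just the line of x and a complement of the range just the line
  of y.\<close>

lemma Kato_split:
  assumes cl: "\<And>n. closed (ran Y (T ^^ n))" and notK: "T \<notin> Kato Y"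
  obtains M N B where "reduction T Y M N" "finite B" "N = cspan B" "nilpotent_on N T"
    "nullity Y T = nullity M T + 1" "defect Y T = defect M T + 1"
proof -
  interpret Tn: operator_on "T ^^ n" Y for n by (rule operator_on_funpow)
  have "\<exists>n. \<not> ker Y T \<subseteq> ran Y (T ^^ n)" using notK cl[of 1] by (auto simp: Kato_iff)
  \<comment> \<open>\<open>n\<close> is the least exponent where the inclusion fails. It still holds
    for \<open>k = n - 1\<close>, which provides \<open>y\<close>.\<close>
  then obtain n where n: "\<not> ker Y T \<subseteq> ran Y (T ^^ n)" and least: "\<And>m. m < n \<Longrightarrow> ker Y T \<subseteq> ran Y (T ^^ m)"
    using exists_least_iff[of "\<lambda>n. \<not> ker Y T \<subseteq> ran Y (T ^^ n)"] by blast
  have "n \<noteq> 0" using n ker_subset by (auto simp: ran_def)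
  then obtain k where k: "n = Suc k" using not0_implies_Suc by blast
  obtain x where x: "x \<in> ker Y T" "x \<notin> ran Y (T ^^ n)" using n by blast
  have "x \<in> ran Y (T ^^ k)" using least[of k] x k by auto
  then obtain y where y: "y \<in> Y" "x = (T ^^ k) y" by (auto simp: ran_def)
  obtain f where f: "cfunctional f" "\<And>z. z \<in> ran Y (T ^^ n) \<Longrightarrow> f z = 0" "f x = 1"
    using Hahn_Banach_separation[OF Tn.csubspace_ran cl x(2)] by blast
  note f_simps = cfunctional_props(1-4)[OF f(1)]
  have f0: "f ((T ^^ j) m) = 0" if "m \<in> Y" "n \<le> j" for m j
    using f(2) ran_funpow_mono[OF that(2)] that(1) by (auto simp: ran_def)
  have Ty0: "(T ^^ j) y = 0" if "n \<le> j" for j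
  proof -
    obtain d where "j = d + n" using \<open>n \<le> j\<close> by (metis add.commute le_Suc_ex)
    moreover have "(T ^^ n) y = 0" using x(1) y(2) k by (simp add: ker_def)
    ultimately show ?thesis by (simp only: funpow_add comp_apply Tn.T_simps)
  qed
  \<comment> \<open>The tail of the orbit of y from T^j y on. T moves each tail to the next one, and
    from \<open>n\<close> on the tails vanish; the downward inductions below run along j.\<close>
  define S where "S j = (\<lambda>i. (T ^^ i) y) ` {j..}" for j
  have SY: "S j \<subseteq> Y" for j using y Tn.Y_closed_ops(5) by (auto simp: S_def)
  have S_Suc: "S j = insert ((T ^^ j) y) (S (Suc j))" for j
  proof -
    have "{j..} = insert j {Suc j..}" by auto
    then show ?thesis by (simp add: S_def)
  qed
  have TS: "T ` S j = S (Suc j)" for j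
  proof -
    have "i \<in> {Suc j..} \<longleftrightarrow> i \<in> Suc ` {j..}" for i by (cases i) auto
    then have "{Suc j..} = Suc ` {j..}" by blast
    then show ?thesis unfolding S_def by (simp add: image_image)
  qed
  have Sn: "S j \<subseteq> {0}" if "n \<le> j" for j using Ty0 that by (auto simp: S_def)
  have TmS: "(T ^^ m) ` S j = S (j + m)" for m j
  proof (induction m)
    case (Suc m)
    have "(T ^^ Suc m) ` S j = T ` (T ^^ m) ` S j" by (simp add: image_comp)
    then show ?case using Suc TS by simp
  qed simp
  have span0: "(T ^^ m) u = 0" if "u \<in> cspan (S j)" "n \<le> j + m" for m j u
  proof -
    have "(T ^^ m) u \<in> cspan (S (j + m))" using Tn.image_cspan[of m "S j"] that(1) unfolding TmS by blast
    also have "\<dots> \<subseteq> cspan {0}" using Sn[OF that(2)] by (rule complex_vector.span_mono)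
    finally show ?thesis by simp
  qed
  define M where "M = {m \<in> Y. \<forall>j. f ((T ^^ j) m) = 0}"
  define N where "N = cspan (S 0)"
  have NY: "N \<subseteq> Y" unfolding N_def using SY Y(1) by (rule complex_vector.span_minimal)
  have finS: "finite (S 0)"
  proof (rule finite_subset)
    show "S 0 \<subseteq> insert 0 ((\<lambda>i. (T ^^ i) y) ` {..<n})"
    proof
      fix z assume "z \<in> S 0"
      then obtain i where "z = (T ^^ i) y" by (auto simp: S_def)
      then show "z \<in> insert 0 ((\<lambda>i. (T ^^ i) y) ` {..<n})" using Ty0[of i] by (cases "i < n") auto
    qed
  qed simp
  have yN: "y \<in> N" "x \<in> N"
    unfolding N_def y(2) by (auto intro!: complex_vector.span_base simp: S_def intro: image_eqI[of _ _ 0])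
  have fk: "f ((T ^^ k) y) = 1" using f(3) y(2) by simp
  have fgt: "f ((T ^^ j) y) = 0" if "k < j" for j using Ty0[of j] that k f_simps(4) by simp
  have MN0: "u = 0" if u: "u \<in> M" "u \<in> N" for u
  proof -
    \<comment> \<open>Downward from \<open>n\<close>: f after T^(k-j) reads off the coefficient of
      T^j y, which must vanish, and u drops into the next tail.\<close>
    have "\<forall>u. u \<in> cspan (S j) \<longrightarrow> (\<forall>i. f ((T ^^ i) u) = 0) \<longrightarrow> u = 0" if "j \<le> n" for j
      using that
    proof (induction rule: inc_induct)
      case base
      then show ?case using span0[of _ n 0] by simp
    next
      case (step j)
      show ?case
      proof (intro allI impI)
        fix u assume u: "u \<in> cspan (S j)" "\<forall>i. f ((T ^^ i) u) = 0"
        then obtain c where c: "u - c *\<^sub>C (T ^^ j) y \<in> cspan (S (Suc j))"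
          unfolding S_Suc[of j] complex_vector.span_insert by blast
        have "k - j + j = k" using step k by simp
        then have kj: "(T ^^ (k - j)) ((T ^^ j) y) = (T ^^ k) y" by (metis comp_apply funpow_add)
        have "(T ^^ (k - j)) (u - c *\<^sub>C (T ^^ j) y) = 0"
          using c step k by (intro span0) auto
        then have "f ((T ^^ (k - j)) u) = c * f ((T ^^ k) y)"
          using f_simps kj by simp
        then have "c = 0" using u fk by simp
        then show "u = 0" using c u step by simp
      qed
    qed
    from this[of 0] show ?thesis using u by (auto simp: M_def N_def)
  qed
  have split: "\<exists>u\<in>N. m - u \<in> M" if m: "m \<in> Y" for m
  proof -
    \<comment> \<open>Downward from \<open>n\<close>, where f annihilates the range of T^n and u = 0
      works.\<close>
    have "\<exists>u\<in>N. \<forall>i\<ge>j. f ((T ^^ i) (m - u)) = 0" if "j \<le> n" for j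
      using that
    proof (induction rule: inc_induct)
      case base
      show ?case using f0[OF m] complex_vector.span_zero by (intro bexI[of _ 0]) (auto simp: N_def)
    next
      case (step j)
      then obtain u where u: "u \<in> N" "\<And>i. i > j \<Longrightarrow> f ((T ^^ i) (m - u)) = 0" by (auto simp: Suc_le_eq)
      define c where "c = f ((T ^^ j) (m - u))"
      \<comment> \<open>A multiple of T^(k-j) y affects the condition for i = j but none for i >
        j.\<close>
      let ?v = "u + c *\<^sub>C (T ^^ (k - j)) y"
      have "f ((T ^^ i) (m - ?v)) = 0" if ij: "j \<le> i" for i
      proof -
        have "m - ?v = (m - u) - c *\<^sub>C (T ^^ (k - j)) y" by simp
        then have "f ((T ^^ i) (m - ?v)) = f ((T ^^ i) (m - u)) - c * f ((T ^^ (i + (k - j))) y)"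
          using f_simps Tn.T_simps by (simp only: funpow_add comp_apply)
        moreover have "i = j \<Longrightarrow> i + (k - j) = k" "i > j \<Longrightarrow> k < i + (k - j)"
          using step k by auto
        ultimately show ?thesis
          using u(2)[of i] fk fgt[of "i + (k - j)"] ij by (cases "i = j") (auto simp: c_def)
      qed
      moreover have "?v \<in> N"
        unfolding N_def using u(1)
        by (intro complex_vector.span_add complex_vector.span_scale) (auto simp: N_def S_def intro: complex_vector.span_base)
      ultimately show ?case by blast
    qed
    from this[of 0] obtain u where u: "u \<in> N" "\<And>i. f ((T ^^ i) (m - u)) = 0" by auto
    then have "m - u \<in> M" using m NY Y_closed_ops(3) by (auto simp: M_def)
    then show ?thesis using u(1) by blast
  qed
  have subM: "csubspace M"
    using f_simps Y_closed_ops Tn.T_simps by (auto simp: M_def complex_vector.subspace_def)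
  have sum: "direct_sum Y M N"
  proof (rule direct_sumI[OF subM _ MN0])
    show "csubspace N" unfolding N_def by (rule complex_vector.subspace_span)
    show "m + u \<in> Y" if "m \<in> M" "u \<in> N" for m u using that NY Y_closed_ops(2) by (auto simp: M_def)
    show "\<exists>m\<in>M. \<exists>u\<in>N. y = m + u" if "y \<in> Y" for y
      using split[OF that] by (metis diff_add_cancel)
  qed auto
  have "operator_on T M"
  proof (rule operator_on_subset[OF subM])
    have "M = Y \<inter> (\<Inter>j. (\<lambda>m. f ((T ^^ j) m)) -` {0})" by (auto simp: M_def)
    moreover have "closed ((\<lambda>m. f ((T ^^ j) m)) -` {0})" for j
    proof (rule closed_vimage)
      show "continuous_on UNIV (\<lambda>m. f ((T ^^ j) m))"
        using bounded_linear_compose[OF _ Tn.bl[of j], of f] f(1) linear_continuous_on by (auto simp: cfunctional_def)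
    qed simp
    ultimately show "closed M" using Y(2) by (auto intro!: closed_INT)
    show "T ` M \<subseteq> M"
      using Y_closed_ops(5) by (auto simp: M_def) (metis comp_apply funpow_Suc_right)
  qed
  moreover have "operator_on T N"
  proof (rule operator_on_subset)
    show "csubspace N" unfolding N_def by (rule complex_vector.subspace_span)
    show "closed N" unfolding N_def using finS by (rule closed_cspan_finite)
    have "T ` N \<subseteq> cspan (S 1)" unfolding N_def using image_cspan[of "S 0"] TS[of 0] by simp
    also have "\<dots> \<subseteq> N" unfolding N_def by (intro complex_vector.span_mono) (auto simp: S_def)
    finally show "T ` N \<subseteq> N" .
  qed
  ultimately interpret red: reduction T Y M N
    using sum operator_on_axioms by (auto intro!: reduction.intro reduction_axioms.intro)
  have "nilpotent_on N T"
    unfolding nilpotent_on_def N_def using span0[of _ 0 n] by auto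
  moreover have "nullity Y T = nullity M T + 1"
    unfolding nullity_def
  proof (rule cdim_direct_sum_line)
    show "x \<noteq> 0" using f(3) f_simps(4) by auto
    have xN: "cspan {x} \<subseteq> N"
      using yN(2) red.N.Y(1) by (intro complex_vector.span_minimal) auto
    have xk: "cspan {x} \<subseteq> ker Y T"
      using x(1) csubspace_ker by (intro complex_vector.span_minimal) auto
    show "direct_sum (ker Y T) (ker M T) (cspan {x})"
    proof (rule direct_sumI[OF red.M.csubspace_ker complex_vector.subspace_span])
      show "u = 0" if "u \<in> ker M T" "u \<in> cspan {x}" for u
        using that MN0 red.M.ker_subset xN by blast
      show "u + v \<in> ker Y T" if "u \<in> ker M T" "v \<in> cspan {x}" for u v
        using that red.ker_Int xk complex_vector.subspace_add[OF csubspace_ker] by blast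
      show "\<exists>u\<in>ker M T. \<exists>v\<in>cspan {x}. m = u + v" if m: "m \<in> ker Y T" for m
      proof -
        \<comment> \<open>Since f x = 1, f vanishes here; higher powers kill the vector itself, so
          it lies in \<open>M\<close>.\<close>
        let ?u = "m - f m *\<^sub>C x"
        have uk: "?u \<in> ker Y T"
          using m x(1) complex_vector.subspace_diff[OF csubspace_ker] complex_vector.subspace_scale[OF csubspace_ker] by blast
        have "f ((T ^^ j) ?u) = 0" for j
        proof (cases j)
          case 0
          then show ?thesis using f_simps f(3) by simp
        next
          case (Suc i)
          then have "(T ^^ j) ?u = (T ^^ i) (T ?u)" by (simp add: funpow_swap1)
          also have "\<dots> = 0" using uk by (simp only: ker_def mem_Collect_eq Tn.T_simps)
          finally show ?thesis using f_simps by simp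
        qed
        then have "?u \<in> M" using uk ker_subset by (auto simp: M_def)
        then have "?u \<in> ker M T" using uk red.ker_Int by blast
        moreover have "f m *\<^sub>C x \<in> cspan {x}" by (intro complex_vector.span_scale complex_vector.span_base) simp
        ultimately show ?thesis by (metis diff_add_cancel)
      qed
    qed
  qed
  moreover have "defect Y T = defect M T + 1"
  proof -
    obtain W where W: "direct_sum M (ran M T) W"
      using complement_exists[OF red.M.Y(1) red.M.csubspace_ran red.M.ran_subset] by blast
    have yspan: "cspan {y} \<subseteq> N"
      using yN(1) red.N.Y(1) by (intro complex_vector.span_minimal) auto
    \<comment> \<open>T(N) is the span of all T^i y with i >= 1, so y is the one direction of
      \<open>N\<close> that the range misses.\<close>
    let ?W = "{w + v |w v. w \<in> W \<and> v \<in> cspan {y}}"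
    have subW: "csubspace ?W"
      using direct_sumD(2)[OF W] complex_vector.subspace_span by (rule complex_vector.subspace_sums)
    have WM: "W \<subseteq> M" using W by (rule direct_sumD)
    have sumY: "w + v \<in> Y" if "w \<in> M" "v \<in> N" for w v
      using sum that by (rule direct_sumD)
    have "direct_sum ?W W (cspan {y})"
    proof (rule direct_sumI[OF direct_sumD(2)[OF W] complex_vector.subspace_span])
      show "u = 0" if "u \<in> W" "u \<in> cspan {y}" for u
        using that WM yspan MN0 by blast
    qed auto
    moreover have "y \<noteq> 0" using fk f_simps(4) by auto
    ultimately have cdim: "cdim ?W = cdim W + 1" by (rule cdim_direct_sum_line)
    have "direct_sum Y (ran Y T) ?W"
    proof (rule direct_sumI[OF csubspace_ran subW])
      fix u assume u: "u \<in> ran Y T" "u \<in> ?W"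
      then obtain w c where wc: "w \<in> W" "u = w + c *\<^sub>C y"
        by (auto simp: complex_vector.span_singleton)
      obtain m where m: "m \<in> Y" "u = T m" using u by (auto simp: ran_def)
      \<comment> \<open>f after T^k vanishes on the range of T and on \<open>W\<close>, but is 1 at
        y; this isolates the coefficient c.\<close>
      have "(T ^^ k) u = (T ^^ n) m" using m k by (simp add: funpow_swap1)
      then have "f ((T ^^ k) u) = 0" using f0 m by simp
      moreover have "f ((T ^^ k) w) = 0" using wc WM by (auto simp: M_def)
      ultimately have "c = 0" using wc fk f_simps by simp
      then have "u \<in> ran M T" using wc u(1) WM red.ran_Int by auto
      then show "u = 0" using wc \<open>c = 0\<close> direct_sumD(3)[OF W] by simp
    next
      fix u v assume "u \<in> ran Y T" "v \<in> ?W"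
      moreover have "?W \<subseteq> Y"
        using subsetD[OF WM] subsetD[OF yspan] sumY by blast
      ultimately show "u + v \<in> Y"
        using ran_subset by (intro Y_closed_ops(2)) auto
    next
      fix z assume "z \<in> Y"
      then obtain m u where mu: "m \<in> M" "u \<in> N" "z = m + u" using direct_sumD(5)[OF sum] by blast
      then obtain r w where rw: "r \<in> ran M T" "w \<in> W" "m = r + w" using direct_sumD(5)[OF W] by blast
      have "u \<in> cspan (insert y (S 1))" using mu(2) S_Suc[of 0] by (simp add: N_def)
      then obtain c where c: "u - c *\<^sub>C y \<in> cspan (S 1)" unfolding complex_vector.span_insert by blast
      have "cspan (S 1) \<subseteq> ran N T"
      proof (rule complex_vector.span_minimal[OF _ red.N.csubspace_ran])
        have "S 0 \<subseteq> N" unfolding N_def by (rule complex_vector.span_superset)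
        then have "T ` S 0 \<subseteq> ran N T" unfolding ran_def by (rule image_mono)
        then show "S 1 \<subseteq> ran N T" by (simp add: TS)
      qed
      then have "r + (u - c *\<^sub>C y) \<in> ran Y T" using c rw red.ran_iff by blast
      moreover have "w + c *\<^sub>C y \<in> ?W"
        using rw complex_vector.span_base[of y "{y}"] complex_vector.span_scale by blast
      moreover have "z = (r + (u - c *\<^sub>C y)) + (w + c *\<^sub>C y)" using mu rw by simp
      ultimately show "\<exists>r\<in>ran Y T. \<exists>w\<in>?W. z = r + w" by blast
    qed
    then have "codim Y (ran Y T) = cdim ?W" by (rule codim_eq_cdim_complement)
    then show ?thesis
      unfolding defect_def cdim codim_eq_cdim_complement[OF W] .
  qed
  ultimately show thesis
    using that[OF red.reduction_axioms finS N_def] by blast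
qed

end

section \<open>Equivalence of the four conditions\<close>

text \<open>The induction runs on whichever of nullity and defect is finite. A splitting lowers both
  by one, so the disjunction persists, and the finite-dimensional nilpotent piece is absorbed into
  \<open>N\<close>.\<close>

lemma Kato_decomposition_induct:
  assumes T: "T \<in> L UNIV" and i: "1 \<le> i" "i \<le> 12"
    and "(M, N) \<in> Red T" "T \<in> Rclass i M" "nilpotent_on N T"
    and "nullity M T = enat n \<or> defect M T = enat n"
  shows "\<exists>(M', N')\<in>Red T. T \<in> Kato M' \<and> T \<in> Rclass i M' \<and> nilpotent_on N' T"
  using assms(4-)
proof (induction n arbitrary: M N rule: less_induct)
  case (less n)
  interpret red: reduction T UNIV M N using T less.prems(1) by (rule reductionI)
  show ?case
  proof (cases "T \<in> Kato M")
    case True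
    then show ?thesis using less.prems by blast
  next
    case False
    \<comment> \<open>Needed for \<open>Kato_split\<close>; the reason depends on which of the two
      quantities is finite.\<close>
    have "closed (ran M (T ^^ k))" for k
      using red.M.Rclass_semi_Fredholm[OF i less.prems(2)]
    proof
      assume "closed (ran M T) \<and> nullity M T < \<infinity>"
      then show ?thesis using red.M.closed_ran_funpow_if_nullity by blast
    next
      assume "defect M T < \<infinity>"
      then show ?thesis
        using red.M.defect_funpow_finite operator_on.closed_ran_if_defect[OF red.M.operator_on_funpow] by blast
    qed
    then obtain M0 N0 B where split: "reduction T M M0 N0" "finite B" "N0 = cspan B" "nilpotent_on N0 T"
      "nullity M T = nullity M0 T + 1" "defect M T = defect M0 T + 1"
      using red.M.Kato_split False by blast
    interpret sp: reduction T M M0 N0 by (rule split(1))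
    let ?N = "{u + v |u v. u \<in> N0 \<and> v \<in> N}"
    have sum: "direct_sum UNIV M0 ?N" using sp.sum red.sum by (rule direct_sum_assoc)
    have N_span: "?N = cspan (N \<union> B)"
      unfolding cspan_Un_csubspace[OF red.N.Y(1)] split(3) by (metis (no_types, opaque_lifting) add.commute)
    have "closed ?N"
      unfolding N_span using red.N.Y split(2) by (rule closed_cspan_Un_finite)
    moreover have "T ` ?N \<subseteq> ?N"
    proof clarify
      fix u v assume "u \<in> N0" "v \<in> N"
      then show "\<exists>u' v'. T (u + v) = u' + v' \<and> u' \<in> N0 \<and> v' \<in> N"
        using sp.N.Y_closed_ops(5) red.N.Y_closed_ops(5) red.T_simps(2) by blast
    qed
    ultimately have Red: "(M0, ?N) \<in> Red T"
      unfolding Red_def using sum sp.M.Y(2) sp.M.inv by blast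
    have nil: "nilpotent_on ?N T"
    proof -
      obtain p q where pq: "\<And>u. u \<in> N0 \<Longrightarrow> (T ^^ p) u = 0" "\<And>v. v \<in> N \<Longrightarrow> (T ^^ q) v = 0"
        using split(4) less.prems(3) by (auto simp: nilpotent_on_def)
      interpret Tp: operator_on "T ^^ p" M by (rule red.M.operator_on_funpow)
      interpret Tq: operator_on "T ^^ q" M by (rule red.M.operator_on_funpow)
      have "(T ^^ (p + q)) (u + v) = 0" if "u \<in> N0" "v \<in> N" for u v
      proof -
        have "(T ^^ (p + q)) (u + v) = (T ^^ (q + p)) u + (T ^^ (p + q)) v"
          by (simp only: funpow_add comp_apply Tp.T_simps Tq.T_simps add.commute[of q p])
        also have "\<dots> = 0" using pq(1)[OF that(1)] pq(2)[OF that(2)] by (simp add: funpow_add)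
        finally show ?thesis .
      qed
      then show ?thesis unfolding nilpotent_on_def by blast
    qed
    have R: "T \<in> Rclass i M0" using sp.Rclass_part[OF i less.prems(2) split(5,6)] .
    have "\<exists>m<n. nullity M0 T = enat m \<or> defect M0 T = enat m"
    proof -
      have "\<exists>m<n. d = enat m" if "d + 1 = enat n" for d :: enat
        using that by (cases d) (auto simp: one_enat_def)
      then show ?thesis using less.prems(4) split(5,6) by metis
    qed
    then show ?thesis using less.IH[OF _ Red R nil] by blast
  qed
qed

lemma Kato_decomposition:
  assumes T: "T \<in> L UNIV" and i: "1 \<le> i" "i \<le> 12"
    and MN: "(M, N) \<in> Red T" "T \<in> Rclass i M" "nilpotent_on N T"
  obtains M' N' where "(M', N') \<in> Red T" "T \<in> Kato M'" "T \<in> Rclass i M'" "nilpotent_on N' T"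
proof -
  interpret red: reduction T UNIV M N using T MN(1) by (rule reductionI)
  have "\<exists>n. nullity M T = enat n \<or> defect M T = enat n"
    using red.M.Rclass_semi_Fredholm[OF i MN(2)] by auto
  then show thesis
    using Kato_decomposition_induct[OF T i MN] that by blast
qed

lemma (in operator_on) Kato_Rclass_shift:
  assumes K: "T \<in> Kato Y" and i: "1 \<le> i" "i \<le> 12"
  obtains e where "e > 0" "\<And>l. cmod l < e \<Longrightarrow> (\<lambda>x. T x - l *\<^sub>C x) \<in> Rclass i Y \<longleftrightarrow> T \<in> Rclass i Y"
proof -
  obtain e where e: "e > 0"
    "\<And>l. cmod l < e \<Longrightarrow> (\<lambda>x. T x - l *\<^sub>C x) \<in> Kato Y"
    "\<And>l. cmod l < e \<Longrightarrow> nullity Y (\<lambda>x. T x - l *\<^sub>C x) = nullity Y T"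
    "\<And>l. cmod l < e \<Longrightarrow> defect Y (\<lambda>x. T x - l *\<^sub>C x) = defect Y T"
    using Kato_shift_constant[OF K] by blast
  have "(\<lambda>x. T x - l *\<^sub>C x) \<in> Rclass i Y \<longleftrightarrow> T \<in> Rclass i Y" if l: "cmod l < e" for l
  proof (rule Rclass_cong[OF operator_on_diff operator_on_axioms i])
    interpret Tl: operator_on "\<lambda>x. T x - l *\<^sub>C x" Y by (rule operator_on_diff)
    note Kl = e(2)[OF l]
    show "closed (ran Y (\<lambda>x. T x - l *\<^sub>C x)) \<longleftrightarrow> closed (ran Y T)"
      using K Kl by (simp add: Kato_iff Tl.Kato_iff)
    show "ascent Y (\<lambda>x. T x - l *\<^sub>C x) < \<infinity> \<longleftrightarrow> ascent Y T < \<infinity>"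
      unfolding Kato_ascent_finite_iff[OF K] Tl.Kato_ascent_finite_iff[OF Kl] e(3)[OF l] ..
    show "descent Y (\<lambda>x. T x - l *\<^sub>C x) < \<infinity> \<longleftrightarrow> descent Y T < \<infinity>"
      unfolding Kato_descent_finite_iff[OF K] Tl.Kato_descent_finite_iff[OF Kl] e(4)[OF l] ..
  qed (use e l in auto)
  then show thesis using that e(1) by blast
qed

lemma Red_diff_scaleC:
  assumes MN: "(M, N) \<in> Red T"
  shows "(M, N) \<in> Red (\<lambda>x. T x - l *\<^sub>C x)"
proof -
  have "csubspace M" "csubspace N" using MN direct_sumD(1,2)[of UNIV M N] by (auto simp: Red_def)
  then show ?thesis
    using MN by (auto simp: Red_def image_subset_iff complex_vector.subspace_diff complex_vector.subspace_scale)
qed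

text \<open>For nonzero l the nilpotent part becomes bijective, so only \<open>M\<close> matters. At
  l = 0 this fails, which is why 0 may be an isolated point of the spectrum.\<close>

lemma Rclass_shift_iff:
  assumes T: "T \<in> L UNIV" and MN: "(M, N) \<in> Red T" and nil: "nilpotent_on N T"
    and i: "1 \<le> i" "i \<le> 12" and l: "l \<noteq> 0"
  shows "(\<lambda>x. T x - l *\<^sub>C x) \<in> Rclass i UNIV \<longleftrightarrow> (\<lambda>x. T x - l *\<^sub>C x) \<in> Rclass i M"
proof -
  interpret red: reduction T UNIV M N using T MN by (rule reductionI)
  interpret Tl: operator_on "\<lambda>x. T x - l *\<^sub>C x" UNIV by (rule red.operator_on_diff)
  have "- l \<noteq> 0" using l by simp
  then show ?thesis
    using red.N.nilpotent_shift_bij[OF nil, of "- l"]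
    by (intro Rclass_bij_part[OF Tl.T Red_diff_scaleC[OF MN] _ _ i]) simp_all
qed

lemma DR_if_not_interior:
  assumes T: "T \<in> L UNIV" and i: "1 \<le> i" "i \<le> 12"
    and K: "Kato_type T" and int: "0 \<notin> interior (Rspectrum i T)"
  shows "T \<in> DR i"
proof -
  obtain M N where MN: "(M, N) \<in> Red T" "T \<in> Kato M" "nilpotent_on N T"
    using K by (auto simp: Kato_type_def)
  interpret red: reduction T UNIV M N using T MN(1) by (rule reductionI)
  obtain e where e: "e > 0" "\<And>l. cmod l < e \<Longrightarrow> (\<lambda>x. T x - l *\<^sub>C x) \<in> Rclass i M \<longleftrightarrow> T \<in> Rclass i M"
    using red.M.Kato_Rclass_shift[OF MN(2) i] by blast
  have "\<not> ball 0 e \<subseteq> Rspectrum i T"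
    using int e(1) by (auto simp: mem_interior)
  then obtain l where l: "cmod l < e" "(\<lambda>x. T x - l *\<^sub>C x) \<in> Rclass i UNIV"
    by (auto simp: Rspectrum_def)
  show ?thesis
  \<comment> \<open>The shift 0 does not make the part on \<open>N\<close> bijective; but then T
    itself is in the class, and the trivial reduction does.\<close>
  proof (cases "l = 0")
    case True
    then have "T \<in> Rclass i UNIV" using l(2) by simp
    moreover have "(UNIV, {0}) \<in> Red T"
      by (auto simp: Red_def direct_sum_def complex_vector.subspace_UNIV complex_vector.subspace_single_0)
    moreover have "nilpotent_on {0} T"
      by (auto simp: nilpotent_on_def intro: exI[of _ 0])
    ultimately show ?thesis using T by (auto simp: DR_def)
  next
    case False
    then have "T \<in> Rclass i M"
      using l e(2)[OF l(1)] Rclass_shift_iff[OF T MN(1,3) i] by blast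
    then show ?thesis using T MN by (auto simp: DR_def)
  qed
qed

text \<open>The given summand need not be Kato, so the decomposition is refined first; constancy on
  a disc then clears a punctured disc of the spectrum.\<close>

lemma Kato_type_isolated_if_DR:
  assumes i: "1 \<le> i" "i \<le> 12" and DR: "T \<in> DR i"
  shows "Kato_type T \<and> \<not> 0 islimpt Rspectrum i T"
proof -
  have T: "T \<in> L UNIV" using DR by (simp add: DR_def)
  obtain M0 N0 where "(M0, N0) \<in> Red T" "T \<in> Rclass i M0" "nilpotent_on N0 T"
    using DR by (auto simp: DR_def)
  then obtain M N where MN: "(M, N) \<in> Red T" "T \<in> Kato M" "T \<in> Rclass i M" "nilpotent_on N T"
    by (rule Kato_decomposition[OF T i])
  interpret red: reduction T UNIV M N using T MN(1) by (rule reductionI)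
  obtain e where e: "e > 0" "\<And>l. cmod l < e \<Longrightarrow> (\<lambda>x. T x - l *\<^sub>C x) \<in> Rclass i M \<longleftrightarrow> T \<in> Rclass i M"
    using red.M.Kato_Rclass_shift[OF MN(2) i] by blast
  have "l \<notin> Rspectrum i T" if "l \<noteq> 0" "cmod l < e" for l
    using e(2)[OF that(2)] MN(3) Rclass_shift_iff[OF T MN(1,4) i that(1)] by (simp add: Rspectrum_def)
  then have "\<not> 0 islimpt Rspectrum i T"
    using e(1) by (auto simp: islimpt_approachable intro!: exI[of _ e])
  then show ?thesis using MN by (auto simp: Kato_type_def)
qed

text \<open>The invariants see only values on \<open>Y\<close>, also for powers, because
  \<open>Y\<close> is invariant. This identifies T + P with T on the kernel of P.\<close>

lemma Rclass_operator_cong: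
  assumes "operator_on T Y" "operator_on S Y" and eq: "\<And>x. x \<in> Y \<Longrightarrow> S x = T x" and i: "1 \<le> i" "i \<le> 12"
  shows "S \<in> Rclass i Y \<longleftrightarrow> T \<in> Rclass i Y"
proof -
  interpret T: operator_on T Y by (rule assms)
  interpret Tn: operator_on "T ^^ n" Y for n by (rule T.operator_on_funpow)
  have pow: "(S ^^ n) x = (T ^^ n) x" if "x \<in> Y" for x n
    using that Tn.Y_closed_ops(5) eq by (induction n) auto
  have ker: "ker Y (S ^^ n) = ker Y (T ^^ n)" and ran: "ran Y (S ^^ n) = ran Y (T ^^ n)" for n
    using pow by (auto simp: ker_def ran_def)
  have "ker Y S = ker Y T" "ran Y S = ran Y T" using ker[of 1] ran[of 1] by simp_all
  then show ?thesis
    by (intro Rclass_cong[OF assms(2,1) i]) (simp_all only: nullity_def defect_def ascent_def descent_def ker ran)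
qed

lemma DR_if_projection:
  assumes T: "T \<in> L UNIV" and i: "1 \<le> i" "i \<le> 12"
    and P: "P \<in> L UNIV" "P \<circ> P = P" "P \<circ> T = T \<circ> P"
    and R: "(\<lambda>x. T x + P x) \<in> Rclass i UNIV" and nil: "nilpotent_on UNIV (T \<circ> P)"
  shows "T \<in> DR i"
proof -
  have blP: "bounded_linear P" and PC: "\<And>c x. P (c *\<^sub>C x) = c *\<^sub>C P x"
    using P(1) by (auto simp: L_UNIV_iff)
  have Plin: "P (x + y) = P x + P y" "P (x - y) = P x - P y" "P 0 = 0" for x y
    using bounded_linear.linear[OF blP] by (auto simp: linear_add linear_diff linear_0)
  have PP: "P (P x) = P x" and PT: "P (T x) = T (P x)" for x
    using P(2,3) by (auto simp: fun_eq_iff)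
  define M where "M = {x. P x = 0}"
  \<comment> \<open>The range of P, written as a fixed-point set so that its closedness comes from
    continuity.\<close>
  define N where "N = {x. P x = x}"
  have cont: "continuous_on UNIV P" using blP by (rule linear_continuous_on)
  have "closed M" "closed N"
    unfolding M_def N_def using cont by (auto intro!: closed_Collect_eq)
  have sum: "direct_sum UNIV M N"
  proof (rule direct_sumI)
    show "csubspace M" "csubspace N"
      using Plin PC by (auto simp: M_def N_def complex_vector.subspace_def)
    show "\<exists>m\<in>M. \<exists>n\<in>N. y = m + n" for y
      by (intro bexI[of _ "y - P y"] bexI[of _ "P y"]) (auto simp: M_def N_def Plin PP)
  qed (auto simp: M_def N_def)
  have T0: "T 0 = 0" using T bounded_linear.linear[of T] linear_0[of T] by (auto simp: L_UNIV_iff)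
  have Red: "(M, N) \<in> Red T"
    using \<open>closed M\<close> \<open>closed N\<close> sum T0 by (auto simp: Red_def M_def N_def PT)
  interpret red: reduction T UNIV M N using T Red by (rule reductionI)
  define S where "S x = T x + P x" for x
  have S: "S \<in> L UNIV" using L_add_scaleC[OF T P(1), of 1] by (simp add: S_def[abs_def] scaleC_one)
  have SM: "S x = T x" if "x \<in> M" for x using that by (simp add: S_def M_def)
  have SN: "S x = T x + 1 *\<^sub>C x" if "x \<in> N" for x using that by (simp add: S_def N_def scaleC_one)
  have RedS: "(M, N) \<in> Red S"
    using Red SM SN red.N.Y_closed_ops(2,5) by (auto simp: Red_def scaleC_one)
  interpret redS: reduction S UNIV M N using S RedS by (rule reductionI)
  obtain n where n: "\<And>x. ((T \<circ> P) ^^ n) x = 0" using nil by (auto simp: nilpotent_on_def)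
  \<comment> \<open>On the invariant set \<open>N\<close> the factor P is invisible, so nilpotency
    of T P gives nilpotency of T there.\<close>
  have "((T \<circ> P) ^^ k) x = (T ^^ k) x \<and> (T ^^ k) x \<in> N" if "x \<in> N" for k x
    using that red.N.Y_closed_ops(5) by (induction k) (auto simp: N_def)
  then have nilN: "nilpotent_on N T"
    unfolding nilpotent_on_def using n by metis
  have "ker N S = {0}" "ran N S = N"
    using red.N.nilpotent_shift_bij[OF nilN, of 1] SN by (auto simp: ker_def ran_def)
  then have "S \<in> Rclass i M"
    using Rclass_bij_part[OF S RedS _ _ i] R by (simp add: S_def[abs_def])
  then have "T \<in> Rclass i M"
    using Rclass_operator_cong[OF red.M.operator_on_axioms redS.M.operator_on_axioms SM i] by blast
  then show ?thesis using T Red nilN by (auto simp: DR_def)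
qed

lemma projection_if_DR:
  assumes i: "1 \<le> i" "i \<le> 12" and DR: "T \<in> DR i"
  shows "\<exists>P \<in> L UNIV. P \<circ> P = P \<and> P \<circ> T = T \<circ> P \<and> (\<lambda>x. T x + P x) \<in> Rclass i UNIV
    \<and> nilpotent_on UNIV (T \<circ> P)"
proof -
  have T: "T \<in> L UNIV" using DR by (simp add: DR_def)
  obtain M N where Red: "(M, N) \<in> Red T" and R: "T \<in> Rclass i M" and nil: "nilpotent_on N T"
    using DR by (auto simp: DR_def)
  interpret red: reduction T UNIV M N using T Red by (rule reductionI)
  obtain P where P: "P \<in> L UNIV" "\<And>x. x \<in> M \<Longrightarrow> P x = 0" "\<And>x. x \<in> N \<Longrightarrow> P x = x" "\<And>x. P x \<in> N"
      "\<And>x. x - P x \<in> M"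
    using closed_direct_sum_projection[OF red.sum red.M.Y(2) red.N.Y(2)] by blast
  have linP: "linear P" using P(1) by (simp add: L_UNIV_iff bounded_linear.linear)
  \<comment> \<open>Split x into its parts in \<open>M\<close> and \<open>N\<close>: invariance
    keeps each part in place, where P is zero or the identity.\<close>
  have "P (T x) = T (P x)" for x
  proof -
    have "P (T x) = P (T (x - P x)) + P (T (P x))"
      by (simp flip: linear_add[OF linP])
    then show ?thesis
      using P(2)[OF red.M.Y_closed_ops(5)[OF P(5)]] P(3)[OF red.N.Y_closed_ops(5)[OF P(4)]] by simp
  qed
  then have PT: "P \<circ> T = T \<circ> P" by auto
  have PP: "P \<circ> P = P" using P(3)[OF P(4)] by auto
  define S where "S x = T x + P x" for x
  have S: "S \<in> L UNIV" using L_add_scaleC[OF T P(1), of 1] by (simp add: S_def[abs_def] scaleC_one)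
  have SM: "S x = T x" if "x \<in> M" for x using that P(2) by (simp add: S_def)
  have SN: "S x = T x + 1 *\<^sub>C x" if "x \<in> N" for x using that P(3) by (simp add: S_def scaleC_one)
  have RedS: "(M, N) \<in> Red S"
    using Red SM SN red.N.Y_closed_ops(2,5) by (auto simp: Red_def scaleC_one)
  interpret redS: reduction S UNIV M N using S RedS by (rule reductionI)
  have "S \<in> Rclass i M"
    using Rclass_operator_cong[OF red.M.operator_on_axioms redS.M.operator_on_axioms SM i] R by blast
  moreover have "ker N S = {0}" "ran N S = N"
    using red.N.nilpotent_shift_bij[OF nil, of 1] SN by (auto simp: ker_def ran_def)
  ultimately have RS: "(\<lambda>x. T x + P x) \<in> Rclass i UNIV"
    using Rclass_bij_part[OF S RedS _ _ i] by (simp add: S_def[abs_def])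
  obtain n where n: "\<And>x. x \<in> N \<Longrightarrow> (T ^^ n) x = 0" using nil by (auto simp: nilpotent_on_def)
  \<comment> \<open>Only positive powers: the power 0 of T P is the identity and not P.\<close>
  have "((T \<circ> P) ^^ Suc k) x = (T ^^ Suc k) (P x) \<and> (T ^^ Suc k) (P x) \<in> N" for k x
    using red.N.Y_closed_ops(5) P(3,4) by (induction k) auto
  moreover have "(T ^^ Suc n) (P x) = 0" for x using n[OF P(4)] by simp
  ultimately have "nilpotent_on UNIV (T \<circ> P)" unfolding nilpotent_on_def by metis
  then show ?thesis using P(1) PP PT RS by blast
qed

theorem theorem3p8:
  fixes T :: "'a::complex_banach \<Rightarrow> 'a" and i :: nat
  assumes "cdim (UNIV :: 'a set) = \<infinity>"
    and "T \<in> L UNIV"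
    and "1 \<le> i" and "i \<le> 12"
  shows "((\<exists>(M, N)\<in>Red T. T \<in> Rclass i M \<and> nilpotent_on N T) \<longleftrightarrow> T \<in> DR i)
    \<and> (T \<in> DR i \<longleftrightarrow> Kato_type T \<and> \<not> 0 islimpt Rspectrum i T)
    \<and> (T \<in> DR i \<longleftrightarrow> Kato_type T \<and> 0 \<notin> interior (Rspectrum i T))
    \<and> (T \<in> DR i \<longleftrightarrow> (\<exists>P \<in> L UNIV. P \<circ> P = P \<and> P \<circ> T = T \<circ> P
          \<and> (\<lambda>x. T x + P x) \<in> Rclass i UNIV \<and> nilpotent_on UNIV (T \<circ> P)))"
proof (intro conjI)
  note i = assms(3,4)
  have isolated: "T \<in> DR i \<Longrightarrow> Kato_type T \<and> \<not> 0 islimpt Rspectrum i T"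
    by (rule Kato_type_isolated_if_DR[OF i])
  \<comment> \<open>The complex plane has no isolated points, so interior points are limit points.
    With \<open>isolated\<close> and \<open>DR\<close> this closes a cycle of implications.\<close>
  have interior: "\<not> 0 islimpt Rspectrum i T \<Longrightarrow> 0 \<notin> interior (Rspectrum i T)"
    using interior_limit_point by blast
  have DR: "Kato_type T \<Longrightarrow> 0 \<notin> interior (Rspectrum i T) \<Longrightarrow> T \<in> DR i"
    by (rule DR_if_not_interior[OF assms(2) i])
  show "(\<exists>(M, N)\<in>Red T. T \<in> Rclass i M \<and> nilpotent_on N T) \<longleftrightarrow> T \<in> DR i"
    using assms(2) by (simp add: DR_def)
  show "T \<in> DR i \<longleftrightarrow> Kato_type T \<and> \<not> 0 islimpt Rspectrum i T"
    and "T \<in> DR i \<longleftrightarrow> Kato_type T \<and> 0 \<notin> interior (Rspectrum i T)"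
    using isolated interior DR by blast+
  show "T \<in> DR i \<longleftrightarrow> (\<exists>P \<in> L UNIV. P \<circ> P = P \<and> P \<circ> T = T \<circ> P
      \<and> (\<lambda>x. T x + P x) \<in> Rclass i UNIV \<and> nilpotent_on UNIV (T \<circ> P))"
    using projection_if_DR[OF i] DR_if_projection[OF assms(2) i] by blast
qed

end
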